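(* Let $f$ and $g$ satisfy the standing assumptions (A) of the context, let $F=f+g$, and take $\gamma\in(0,1/L)$. Consider the sequences $(x_k),(y_k)$ generated by the proximal gradient algorithm with Riemannian truncated Newton manifold update described in the context. Then all limit points of $(x_k)$ are critical points of $F$ (i.e. $0\in\nabla f(x)+\partial g(x)$) and share the same function value. Furthermore, assume that the sequence $(y_k)$ admits a limit point $x^\star$ such that (i) $x^\star\in\mathcal{M}$ is an $r$-structured critical point for $(f,g)$ with $r<1/\gamma$, where $\mathcal{M}$ is a $\mathcal{C}^2$ submanifold of $\mathbb{R}^n$; (ii) $\mathrm{Hess}_{\mathcal{M}}F(x^\star)\succ0$ and $\mathrm{Hess}_{\mathcal{M}}F$ is locally Lipschitz around $x^\star$; (iii) the forcing parameters satisfy $\eta_k=\mathcal{O}(\|\mathrm{grad}\,F(x_k)\|^\theta)$ for some $\theta\in(0,1]$. Then, for $k$ large enough, the full sequence $(x_k)$ lies on $\mathcal{M}$, and $x_k$ converges to $x^\star$ superlinearly with order $1+\theta$: there exists $c>0$ such that, for all large $k$, $$\mathrm{dist}_{\mathcal{M}}(x_{k+1},x^\star)\le c\,\mathrm{dist}_{\mathcal{M}}(x_k,x^\star)^{1+\theta}.$$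
   Context: Standing assumptions (A): $f,g$ are proper; $f:\mathbb{R}^n\to\mathbb{R}$ is $\mathcal{C}^2$ with $L$-Lipschitz gradient; $g:\mathbb{R}^n\to\mathbb{R}\cup\{+\infty\}$ is lower semi-continuous; $\mathrm{prox}_{\gamma g}$ is non-empty on $\mathbb{R}^n$ for any $\gamma>0$; $F=f+g$ is bounded below. Here $\mathrm{prox}_{\gamma g}(y)=\operatorname{argmin}_{u}\{g(u)+\frac{1}{2\gamma}\|u-y\|^2\}$ (set-valued). Algorithm: from an arbitrary starting point, iterate for $k=1,2,\dots$: (1) compute $x_k\in\mathrm{prox}_{\gamma g}(y_{k-1}-\gamma\nabla f(y_{k-1}))$ and get a submanifold $\mathcal{M}_k\ni x_k$ (the current active manifold, delivered along with the proximal point); the returned manifold is the active one, so that $\mathcal{M}_k=\mathcal{M}$ whenever $x_k\in\mathcal{M}$ is close enough to $x^\star$; (2) Riemannian truncated Newton update on $\mathcal{M}_k$ for the restriction of $F$ to $\mathcal{M}_k$: with a forcing parameter $\eta_k\ge0$ (the algorithm's listing takes $\eta_k=\|\mathrm{grad}\,F(x_k)\|^\theta$ with $\theta\in(0,1]$), find $d_k\in T_{x_k}\mathcal{M}_k$ with $$\|\mathrm{grad}\,F(x_k)+\mathrm{Hess}\,F(x_k)[d_k]\|\le\eta_k\|\mathrm{grad}\,F(x_k)\|$$ by a conjugate gradient procedure applied to $\mathrm{grad}\,F(x_k)+\mathrm{Hess}\,F(x_k)[d]=0$, a procedure such that the resulting direction is a descent direction ($\langle\mathrm{grad}\,F(x_k),d_k\rangle<0$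 if $\mathrm{grad}\,F(x_k)\neq0$, and $d_k=0$ otherwise); find by backtracking line search (trying $\alpha=1$ first, then reducing the stepsize geometrically) $\alpha_k>0$ satisfying the Armijo condition $F(\mathrm{R}_{x_k}(\alpha_k d_k))\le F(x_k)+m_1\alpha_k\langle\mathrm{grad}\,F(x_k),d_k\rangle$, with fixed $0<m_1<1/2$; set $y_k=\mathrm{R}_{x_k}(\alpha_k d_k)$. Riemannian notions: submanifolds of $\mathbb{R}^n$ carry the metric induced by the ambient scalar product; $\mathrm{grad}$ and $\mathrm{Hess}$ are the Riemannian gradient and Hessian of the restriction of $F$ to the current manifold; $\mathrm{Hess}_{\mathcal{M}}F$ is that of $F|_{\mathcal{M}}$; $\mathrm{dist}_{\mathcal{M}}$ is the Riemannian distance. A retraction $\mathrm{R}$ on $\mathcal{M}$ is a smooth map from the tangent bundle to $\mathcal{M}$ with $\mathrm{R}_x(0)=x$ and $\mathrm{D}\mathrm{R}_x(0)=\mathrm{Id}$; the retractions used are second-order: for all $(x,\eta)$, the curve $t\mapsto\mathrm{R}_x(t\eta)$ has zero Riemannian acceleration at $t=0$. Subdifferentials: the regular subdifferential is $\widehat\partial g(\bar x)=\{v: g(x)\ge g(\bar x)+\langle v,x-\bar x\rangle+o(\|x-\bar x\|)\}$, and the limiting subdifferential is $\partial g(\bar x)=\{\lim_k v_k: v_k\in\widehat\partial g(x_k),\ x_k\to\bar x,\ g(x_k)\to g(\bar x)\}$. $g$ is (Clarke) regular at $\bar x$ if the two coincide there. $\mathrm{ri}$ denotes relative interior. Prox-regularity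 ($r>0$): $g$ is $r$-prox-regular at $\bar x$ if $g$ is finite and locally lower semi-continuous at $\bar x$ and for every $\bar v\in\partial g(\bar x)$ there is $\varepsilon>0$ such that $g(x')\ge g(x)+\langle v,x'-x\rangle-\frac r2\|x'-x\|^2$ whenever $v\in\partial g(x)$, $\|x-\bar x\|<\varepsilon$, $\|x'-\bar x\|<\varepsilon$, $\|v-\bar v\|<\varepsilon$, $g(x)<g(\bar x)+\varepsilon$. Partial smoothness: $g$ is partly smooth at $\bar x$ relative to $\mathcal{M}\ni\bar x$ if $\mathcal{M}$ is a $\mathcal{C}^2$ submanifold of $\mathbb{R}^n$ around $\bar x$ and: the restriction of $g$ to $\mathcal{M}$ is $\mathcal{C}^2$ near $\bar x$; $g$ is Clarke regular at all $x\in\mathcal{M}$ near $\bar x$, with $\partial g(x)\ne\emptyset$; the affine span of $\partial g(\bar x)$ is a translate of the normal space $N_{\bar x}\mathcal{M}$; the set-valued map $\partial g$ restricted to $\mathcal{M}$ is continuous at $\bar x$. $r$-structured critical point: $\bar x\in\mathcal{M}$ is an $r$-structured critical point for $(f,g)$ if (i) $\bar x=\mathrm{prox}_{g/r}(\bar x-\frac1r\nabla f(\bar x))$ (the prox set is exactly $\{\bar x\}$); (ii) $0\in\mathrm{ri}(\nabla f(\bar x)+\partial g(\bar x))$; (iii) $g$ is $r$-prox-regular at $\bar x$; (iv) $g$ is partly smooth at $\bar x$ relative to $\mathcal{M}$. *)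

theory Defs
  imports "HOL-Analysis.Analysis" "HOL-Library.Landau_Symbols"
begin

section \<open>Nonsmooth analysis\<close>

definition nabla :: "('a::real_inner \<Rightarrow> real) \<Rightarrow> 'a \<Rightarrow> 'a" where
  "nabla f x = (THE D. GDERIV f x :> D)"

definition C1_on :: "'a set \<Rightarrow> ('a::real_normed_vector \<Rightarrow> 'b::real_normed_vector) \<Rightarrow> bool" where
  "C1_on U h \<longleftrightarrow> (\<exists>h' :: 'a \<Rightarrow> 'a \<Rightarrow>\<^sub>L 'b.
     (\<forall>x\<in>U. (h has_derivative blinfun_apply (h' x)) (at x)) \<and> continuous_on U h')"

text \<open>Both notions are only used on open sets, where \<open>at x\<close> is the appropriate filter.\<close>

definition C2_on :: "'a set \<Rightarrow> ('a::real_normed_vector \<Rightarrow> 'b::real_normed_vector) \<Rightarrow> bool" where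
  "C2_on U h \<longleftrightarrow> (\<exists>h' :: 'a \<Rightarrow> 'a \<Rightarrow>\<^sub>L 'b.
     (\<forall>x\<in>U. (h has_derivative blinfun_apply (h' x)) (at x)) \<and> C1_on U h')"

definition proper_fun :: "('a \<Rightarrow> ereal) \<Rightarrow> bool" where
  "proper_fun g \<longleftrightarrow> (\<forall>x. g x \<noteq> -\<infinity>) \<and> (\<exists>x. g x \<noteq> \<infinity>)"

definition lower_semicont :: "('a::topological_space \<Rightarrow> ereal) \<Rightarrow> bool" where
  "lower_semicont g \<longleftrightarrow> (\<forall>x. g x \<le> Liminf (at x) g)"

definition prox :: "real \<Rightarrow> ('a::real_inner \<Rightarrow> ereal) \<Rightarrow> 'a \<Rightarrow> 'a set" where
  "prox \<gamma> g y =
     {u. is_arg_min (\<lambda>u. g u + ereal (1 / (2 * \<gamma>) * (norm (u - y))\<^sup>2)) (\<lambda>_. True) u}"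

text \<open>Both subdifferentials are empty where \<open>g\<close> is not finite.\<close>

definition regular_subdiff :: "('a::real_inner \<Rightarrow> ereal) \<Rightarrow> 'a \<Rightarrow> 'a set" where
  "regular_subdiff g xb = {v. \<bar>g xb\<bar> \<noteq> \<infinity> \<and>
     (\<exists>\<rho> :: 'a \<Rightarrow> real. \<rho> \<in> o[at xb](\<lambda>x. norm (x - xb)) \<and>
        (\<forall>\<^sub>F x in at xb. g xb + ereal (v \<bullet> (x - xb) + \<rho> x) \<le> g x))}"

definition limiting_subdiff :: "('a::real_inner \<Rightarrow> ereal) \<Rightarrow> 'a \<Rightarrow> 'a set" where
  "limiting_subdiff g xb = {v. \<bar>g xb\<bar> \<noteq> \<infinity> \<and>
     (\<exists>xs vs. (\<forall>k. vs k \<in> regular_subdiff g (xs k)) \<and> vs \<longlonglongrightarrow> v \<and>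
        xs \<longlonglongrightarrow> xb \<and> (\<lambda>k. g (xs k)) \<longlonglongrightarrow> g xb)}"

definition clarke_regular :: "('a::real_inner \<Rightarrow> ereal) \<Rightarrow> 'a \<Rightarrow> bool" where
  "clarke_regular g xb \<longleftrightarrow> regular_subdiff g xb = limiting_subdiff g xb"

definition subdiff_sum :: "('a::real_inner \<Rightarrow> real) \<Rightarrow> ('a \<Rightarrow> ereal) \<Rightarrow> 'a \<Rightarrow> 'a set" where
  "subdiff_sum f g x = (\<lambda>v. nabla f x + v) ` limiting_subdiff g x"

definition critical_point :: "('a::real_inner \<Rightarrow> real) \<Rightarrow> ('a \<Rightarrow> ereal) \<Rightarrow> 'a \<Rightarrow> bool" where
  "critical_point f g x \<longleftrightarrow> 0 \<in> subdiff_sum f g x"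

definition locally_lsc_at :: "('a::metric_space \<Rightarrow> ereal) \<Rightarrow> 'a \<Rightarrow> bool" where
  "locally_lsc_at g xb \<longleftrightarrow>
     (\<exists>\<epsilon>>0. \<forall>a \<le> g xb + ereal \<epsilon>. closed {x \<in> cball xb \<epsilon>. g x \<le> a})"

definition prox_regular :: "real \<Rightarrow> ('a::real_inner \<Rightarrow> ereal) \<Rightarrow> 'a \<Rightarrow> bool" where
  "prox_regular r g xb \<longleftrightarrow> \<bar>g xb\<bar> \<noteq> \<infinity> \<and> locally_lsc_at g xb \<and>
     (\<forall>vb \<in> limiting_subdiff g xb. \<exists>\<epsilon>>0. \<forall>x x' v.
        v \<in> limiting_subdiff g x \<and> norm (x - xb) < \<epsilon> \<and> norm (x' - xb) < \<epsilon> \<and>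
        norm (v - vb) < \<epsilon> \<and> g x < g xb + ereal \<epsilon> \<longrightarrow>
        g x + ereal (v \<bullet> (x' - x) - r / 2 * (norm (x' - x))\<^sup>2) \<le> g x')"

text \<open>Continuity of a set-valued map relative to a set, in the sense of
  Painleve and Kuratowski: outer and inner semicontinuity.\<close>

definition setmap_continuous_at ::
  "('a::metric_space) set \<Rightarrow> ('a \<Rightarrow> 'b::metric_space set) \<Rightarrow> 'a \<Rightarrow> bool" where
  "setmap_continuous_at M S xb \<longleftrightarrow>
     (\<forall>xs vs v. (\<forall>k. xs k \<in> M \<and> vs k \<in> S (xs k)) \<and> xs \<longlonglongrightarrow> xb \<and> vs \<longlonglongrightarrow> v
        \<longrightarrow> v \<in> S xb) \<and>
     (\<forall>v \<in> S xb. \<forall>xs. (\<forall>k. xs k \<in> M) \<and> xs \<longlonglongrightarrow> xb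
        \<longrightarrow> (\<exists>vs. (\<forall>\<^sub>F k in sequentially. vs k \<in> S (xs k)) \<and> vs \<longlonglongrightarrow> v))"

section \<open>Riemannian geometry of submanifolds\<close>

text \<open>A local defining map with values in \<open>\<real>\<^sup>n\<^sup>-\<^sup>p\<close> is represented by a map with values in a
  linear subspace \<open>W\<close> of the ambient space, since the codimension may not be a type.\<close>

definition submanifold_around :: "('a::euclidean_space) set \<Rightarrow> 'a \<Rightarrow> bool" where
  "submanifold_around M xb \<longleftrightarrow> xb \<in> M \<and>
     (\<exists>U W (\<Phi> :: 'a \<Rightarrow> 'a) \<Phi>'. open U \<and> xb \<in> U \<and> subspace W \<and> C2_on U \<Phi> \<and> \<Phi> ` U \<subseteq> W \<and>
        (\<Phi> has_derivative \<Phi>') (at xb) \<and> range \<Phi>' = W \<and>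
        M \<inter> U = {x \<in> U. \<Phi> x = 0})"

definition submanifold :: "('a::euclidean_space) set \<Rightarrow> bool" where
  "submanifold M \<longleftrightarrow> (\<forall>x\<in>M. submanifold_around M x)"

definition curve_in :: "('a::euclidean_space) set \<Rightarrow> 'a \<Rightarrow> 'a \<Rightarrow> (real \<Rightarrow> 'a) \<Rightarrow> bool" where
  "curve_in M x v c \<longleftrightarrow> c 0 = x \<and> (c has_vector_derivative v) (at 0) \<and>
     (\<exists>e>0. c C1_differentiable_on {-e<..<e} \<and> c ` {-e<..<e} \<subseteq> M)"

definition tangent_space :: "('a::euclidean_space) set \<Rightarrow> 'a \<Rightarrow> 'a set" where
  "tangent_space M x = {v. \<exists>c. curve_in M x v c}"

definition normal_space :: "('a::euclidean_space) set \<Rightarrow> 'a \<Rightarrow> 'a set" where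
  "normal_space M x = (tangent_space M x)\<^sup>\<bottom>"

text \<open>As tangent spaces are linear subspaces, \<open>closest_point\<close> is the orthogonal projection.\<close>

definition tangent_proj :: "('a::euclidean_space) set \<Rightarrow> 'a \<Rightarrow> 'a \<Rightarrow> 'a" where
  "tangent_proj M x = closest_point (tangent_space M x)"

definition C2_restricted_near :: "('a::euclidean_space) set \<Rightarrow> ('a \<Rightarrow> ereal) \<Rightarrow> 'a \<Rightarrow> bool" where
  "C2_restricted_near M \<phi> x \<longleftrightarrow>
     (\<exists>U h. open U \<and> x \<in> U \<and> C2_on U h \<and> (\<forall>z \<in> M \<inter> U. \<phi> z = ereal (h z)))"

text \<open>The differential at \<open>x\<close> of the restriction of \<open>h\<close> to \<open>M\<close>, applied to the tangent
  vector \<open>v\<close>.\<close>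

definition mfd_deriv ::
  "('a::euclidean_space) set \<Rightarrow> ('a \<Rightarrow> 'b::real_normed_vector) \<Rightarrow> 'a \<Rightarrow> 'a \<Rightarrow> 'b" where
  "mfd_deriv M h x v =
     (THE w. \<forall>c. curve_in M x v c \<longrightarrow> ((h \<circ> c) has_vector_derivative w) (at 0))"

text \<open>Curves in \<open>M\<close> only see the restriction of \<open>\<phi>\<close> to \<open>M\<close>, which is finite wherever
  the next notions are used; the conversion to \<open>real\<close> is then harmless.\<close>

definition riem_grad :: "('a::euclidean_space) set \<Rightarrow> ('a \<Rightarrow> ereal) \<Rightarrow> 'a \<Rightarrow> 'a" where
  "riem_grad M \<phi> x = (THE u. u \<in> tangent_space M x \<and>
     (\<forall>v \<in> tangent_space M x. mfd_deriv M (\<lambda>z. real_of_ereal (\<phi> z)) x v = u \<bullet> v))"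

text \<open>The Levi-Civita connection of the induced metric is the tangential projection of the
  ambient derivative; the Hessian is the covariant derivative of the gradient field.\<close>

definition riem_hess :: "('a::euclidean_space) set \<Rightarrow> ('a \<Rightarrow> ereal) \<Rightarrow> 'a \<Rightarrow> 'a \<Rightarrow> 'a" where
  "riem_hess M \<phi> x v = tangent_proj M x (mfd_deriv M (riem_grad M \<phi>) x v)"

definition riem_hess_pos_def :: "('a::euclidean_space) set \<Rightarrow> ('a \<Rightarrow> ereal) \<Rightarrow> 'a \<Rightarrow> bool" where
  "riem_hess_pos_def M \<phi> x \<longleftrightarrow>
     (\<forall>v \<in> tangent_space M x. v \<noteq> 0 \<longrightarrow> riem_hess M \<phi> x v \<bullet> v > 0)"

text \<open>Hessians at different points act on different tangent spaces.  They are compared as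
  operators on the ambient space, after composition with the tangential projections.\<close>

definition riem_hess_loc_lipschitz ::
  "('a::euclidean_space) set \<Rightarrow> ('a \<Rightarrow> ereal) \<Rightarrow> 'a \<Rightarrow> bool" where
  "riem_hess_loc_lipschitz M \<phi> xb \<longleftrightarrow> (\<exists>\<epsilon>>0. \<exists>K. \<forall>x \<in> M \<inter> ball xb \<epsilon>. \<forall>x' \<in> M \<inter> ball xb \<epsilon>. \<forall>v.
     norm (riem_hess M \<phi> x (tangent_proj M x v) - riem_hess M \<phi> x' (tangent_proj M x' v))
       \<le> K * norm (x - x') * norm v)"

text \<open>The infimum is \<open>\<infinity>\<close> if no curve in \<open>M\<close> joins the points.  Asking for \<open>has_integral\<close>
  discards curves of infinite length: \<open>valid_path\<close> does not bound the speed near the finitely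
  many exceptional points, and \<open>integral\<close> would give such curves length \<open>0\<close>.\<close>

definition riem_dist :: "('a::euclidean_space) set \<Rightarrow> 'a \<Rightarrow> 'a \<Rightarrow> ereal" where
  "riem_dist M a b = Inf {ereal l | l. \<exists>c. valid_path c \<and> path_image c \<subseteq> M \<and>
     pathstart c = a \<and> pathfinish c = b \<and>
     ((\<lambda>t. norm (vector_derivative c (at t))) has_integral l) {0..1}}"

definition tangent_bundle :: "('a::euclidean_space) set \<Rightarrow> ('a \<times> 'a) set" where
  "tangent_bundle M = (SIGMA x:M. tangent_space M x)"

definition riem_acceleration :: "('a::euclidean_space) set \<Rightarrow> (real \<Rightarrow> 'a) \<Rightarrow> real \<Rightarrow> 'a" where
  "riem_acceleration M c t =
     tangent_proj M (c t) (vector_derivative (\<lambda>s. vector_derivative c (at s)) (at t))"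

text \<open>On a submanifold of class \<open>C\<^sup>2\<close>, a smooth map on the tangent bundle is
  understood as one that extends locally to a map of class \<open>C\<^sup>2\<close> on an open subset of the
  ambient space.\<close>

definition second_order_retraction ::
  "('a::euclidean_space) set \<Rightarrow> ('a \<Rightarrow> 'a \<Rightarrow> 'a) \<Rightarrow> bool" where
  "second_order_retraction M R \<longleftrightarrow>
     (\<forall>(x, v) \<in> tangent_bundle M. R x v \<in> M) \<and>
     (\<forall>p \<in> tangent_bundle M. \<exists>U G. open U \<and> p \<in> U \<and> C2_on U G \<and>
        (\<forall>(x, v) \<in> tangent_bundle M \<inter> U. R x v = G (x, v))) \<and>
     (\<forall>x\<in>M. R x 0 = x \<and> (R x has_derivative (\<lambda>v. v)) (at 0 within tangent_space M x)) \<and>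
     (\<forall>(x, v) \<in> tangent_bundle M. riem_acceleration M (\<lambda>t. R x (t *\<^sub>R v)) 0 = 0)"

section \<open>Partial smoothness and structured critical points\<close>

definition partly_smooth :: "('a::euclidean_space \<Rightarrow> ereal) \<Rightarrow> 'a \<Rightarrow> 'a set \<Rightarrow> bool" where
  "partly_smooth g xb M \<longleftrightarrow>
     submanifold_around M xb \<and>
     C2_restricted_near M g xb \<and>
     (\<exists>\<epsilon>>0. \<forall>x \<in> M \<inter> ball xb \<epsilon>. clarke_regular g x \<and> limiting_subdiff g x \<noteq> {}) \<and>
     (\<exists>a. affine hull (limiting_subdiff g xb) = (\<lambda>w. a + w) ` normal_space M xb) \<and>
     setmap_continuous_at M (limiting_subdiff g) xb"

definition structured_critical_point ::
  "real \<Rightarrow> ('a::euclidean_space \<Rightarrow> real) \<Rightarrow> ('a \<Rightarrow> ereal) \<Rightarrow> 'a set \<Rightarrow> 'a \<Rightarrow> bool" where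
  "structured_critical_point r f g M xb \<longleftrightarrow> 0 < r \<and> xb \<in> M \<and>
     prox (1 / r) g (xb - (1 / r) *\<^sub>R nabla f xb) = {xb} \<and>
     0 \<in> rel_interior (subdiff_sum f g xb) \<and>
     prox_regular r g xb \<and>
     partly_smooth g xb M"

section \<open>The algorithm\<close>

definition objective :: "('a \<Rightarrow> real) \<Rightarrow> ('a \<Rightarrow> ereal) \<Rightarrow> 'a \<Rightarrow> ereal" where
  "objective f g x = ereal (f x) + g x"

definition standing_assumptions ::
  "real \<Rightarrow> ('a::euclidean_space \<Rightarrow> real) \<Rightarrow> ('a \<Rightarrow> ereal) \<Rightarrow> bool" where
  "standing_assumptions L f g \<longleftrightarrow>
     C2_on UNIV f \<and> L-lipschitz_on UNIV (nabla f) \<and>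
     proper_fun g \<and> lower_semicont g \<and>
     (\<forall>\<gamma>>0. \<forall>y. prox \<gamma> g y \<noteq> {}) \<and>
     (\<exists>b::real. \<forall>x. ereal b \<le> objective f g x)"

definition armijo ::
  "('a::real_inner \<Rightarrow> ereal) \<Rightarrow> real \<Rightarrow> ('a \<Rightarrow> 'a \<Rightarrow> 'a) \<Rightarrow> 'a \<Rightarrow> 'a \<Rightarrow> 'a \<Rightarrow> real \<Rightarrow> bool" where
  "armijo F m R x u d \<alpha> \<longleftrightarrow> F (R x (\<alpha> *\<^sub>R d)) \<le> F x + ereal (m * \<alpha> * (u \<bullet> d))"

text \<open>Backtracking with ratio \<open>\<tau>\<close>: the accepted step is the first element of
  \<open>1, \<tau>, \<tau>\<^sup>2, \<dots>\<close> that satisfies the Armijo condition.\<close>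

definition backtracking_step ::
  "('a::real_inner \<Rightarrow> ereal) \<Rightarrow> real \<Rightarrow> real \<Rightarrow> ('a \<Rightarrow> 'a \<Rightarrow> 'a) \<Rightarrow> 'a \<Rightarrow> 'a \<Rightarrow> 'a \<Rightarrow> real \<Rightarrow> bool" where
  "backtracking_step F m \<tau> R x u d \<alpha> \<longleftrightarrow>
     (\<exists>j::nat. \<alpha> = \<tau> ^ j \<and> armijo F m R x u d \<alpha> \<and> (\<forall>i<j. \<not> armijo F m R x u d (\<tau> ^ i)))"

text \<open>The direction \<open>d\<close> and step length \<open>\<alpha>\<close> lead from \<open>x \<in> N\<close> to \<open>y\<close>.  The conjugate gradient
  procedure enters through what it guarantees on its output: the residual bound and the
  descent property.\<close>

definition truncated_newton_update ::
  "('a::euclidean_space \<Rightarrow> ereal) \<Rightarrow> real \<Rightarrow> real \<Rightarrow> 'a set \<Rightarrow> ('a \<Rightarrow> 'a \<Rightarrow> 'a) \<Rightarrow> real \<Rightarrow>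
     'a \<Rightarrow> 'a \<Rightarrow> real \<Rightarrow> 'a \<Rightarrow> bool" where
  "truncated_newton_update F m \<tau> N R \<eta> x d \<alpha> y \<longleftrightarrow>
     d \<in> tangent_space N x \<and>
     norm (riem_grad N F x + riem_hess N F x d) \<le> \<eta> * norm (riem_grad N F x) \<and>
     (if riem_grad N F x \<noteq> 0 then riem_grad N F x \<bullet> d < 0 else d = 0) \<and>
     backtracking_step F m \<tau> R x (riem_grad N F x) d \<alpha> \<and>
     y = R x (\<alpha> *\<^sub>R d)"

text \<open>The starting point is \<open>y 0\<close>; the other sequences start at index \<open>1\<close>, their values at
  \<open>0\<close> being irrelevant.  \<open>Mk k\<close> is the manifold delivered along with \<open>x k\<close>.  The
  retraction \<open>R N\<close> depends on the manifold \<open>N\<close> and not on the iteration.\<close>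

definition prox_newton_iterates ::
  "('a::euclidean_space \<Rightarrow> real) \<Rightarrow> ('a \<Rightarrow> ereal) \<Rightarrow> real \<Rightarrow> real \<Rightarrow> real \<Rightarrow>
     ('a set \<Rightarrow> 'a \<Rightarrow> 'a \<Rightarrow> 'a) \<Rightarrow> (nat \<Rightarrow> real) \<Rightarrow> (nat \<Rightarrow> 'a set) \<Rightarrow> (nat \<Rightarrow> 'a) \<Rightarrow>
     (nat \<Rightarrow> 'a) \<Rightarrow> (nat \<Rightarrow> 'a) \<Rightarrow> (nat \<Rightarrow> real) \<Rightarrow> bool" where
  "prox_newton_iterates f g \<gamma> m \<tau> R \<eta> Mk x y d \<alpha> \<longleftrightarrow> (\<forall>k\<ge>1.
     x k \<in> prox \<gamma> g (y (k - 1) - \<gamma> *\<^sub>R nabla f (y (k - 1))) \<and>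
     submanifold (Mk k) \<and> x k \<in> Mk k \<and> C2_restricted_near (Mk k) (objective f g) (x k) \<and>
     second_order_retraction (Mk k) (R (Mk k)) \<and>
     0 \<le> \<eta> k \<and>
     truncated_newton_update (objective f g) m \<tau> (Mk k) (R (Mk k)) (\<eta> k) (x k) (d k) (\<alpha> k) (y k))"

definition limit_point_of_seq :: "(nat \<Rightarrow> 'a::topological_space) \<Rightarrow> 'a \<Rightarrow> bool" where
  "limit_point_of_seq x l \<longleftrightarrow> (\<exists>s :: nat \<Rightarrow> nat. strict_mono s \<and> (x \<circ> s) \<longlonglongrightarrow> l)"

definition identifies_near ::
  "(nat \<Rightarrow> 'a::metric_space set) \<Rightarrow> (nat \<Rightarrow> 'a) \<Rightarrow> 'a set \<Rightarrow> 'a \<Rightarrow> bool" where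
  "identifies_near Mk x M xb \<longleftrightarrow>
     (\<exists>\<epsilon>>0. \<forall>k\<ge>1. x k \<in> M \<and> dist (x k) xb < \<epsilon> \<longrightarrow> Mk k = M)"

end

(* The iterates decrease F by at least a multiple of |x(k+1) - y(k)|^2, since the proximal gradient step
   does and the Armijo condition never increases F; so |x(k+1) - y(k)| tends to 0 and limit points
   inherit the optimality condition of the proximal step.

   For the local part, write xs for the structured critical point.  The proximal condition there gives
   g(u) >= g(xs) - <nabla f(xs), u - xs> - (r/2)|u - xs|^2.  Combined with the minimality of the
   proximal point and r < 1/gamma, this yields |x(k+1) - xs| <= K |y(k) - xs| without any smoothness
   of the proximal map.  Partial smoothness and prox-regularity then force x(k+1) into M.  On M, with
   e = x - xs and H the Hessian at xs, grad F(x) = H e + O(|e|^2), so the inexact Newton direction is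
   -e + O(|e|^(1+theta)); the unit step passes the Armijo test because m < 1/2, and the retraction
   changes the step only to second order.  Hence |y(k) - xs| = O(|x(k) - xs|^(1+theta)), and once
   some y(k) is close enough to xs, all later ones are. *)

theory Submission
  imports Defs
begin

section \<open>Calculus of C1 maps with values in spaces of operators\<close>

section \<open>Maps of class C1\<close>

text \<open>Since \<open>M\<close> and the restricted objective are only of class C2, the gradient
  field is only C1, and the Lipschitz assumption concerns the Hessian after tangential projection,
  not the ambient derivative \<open>G'\<close> of the gradient. So the gradient is expanded through
  its projection \<open>P xs (G x)\<close>; the normal part left over is quadratic because
  \<open>G x\<close> is tangent at \<open>x\<close>, has size O(|x - xs|), and the projections vary
  at a Lipschitz rate. This needs a projection field that is C1 near \<open>xs\<close>, hence its
  explicit formula. Taylor formulas use images of segments under a straightening chart in place of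
  geodesics: their velocity differs from the chord by O(|x - xs|^2), so the mean value inequality
  along them suffices. The same curves bound the Riemannian distance by twice the ambient one, so
  all rates are proved in the ambient norm and converted only at the end. One constant
  \<open>A\<close> \<ge> 1 bounds all local data, whence the powers of \<open>A\<close> in the
  estimates.\<close>

lemma C1_onI:
  fixes h :: "'a::euclidean_space \<Rightarrow> 'b::real_normed_vector"
  assumes der: "\<And>x. x \<in> U \<Longrightarrow> (h has_derivative h' x) (at x)"
    and cont: "\<And>v. continuous_on U (\<lambda>x. h' x v)"
  shows "C1_on U h"
  unfolding C1_on_def
proof (intro exI conjI ballI)
  have eq: "blinfun_apply (Blinfun (h' x)) = h' x" if "x \<in> U" for x
    using der[OF that] has_derivative_bounded_linear bounded_linear_Blinfun_apply by blast
  show "(h has_derivative blinfun_apply (Blinfun (h' x))) (at x)" if "x \<in> U" for x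
    using der eq that by simp
  show "continuous_on U (\<lambda>x. Blinfun (h' x))"
  \<comment> \<open>In finite dimension, continuity in operator norm may be checked one direction at
    a time.\<close>
  proof (rule continuous_on_blinfun_componentwise)
    fix i :: 'a
    show "continuous_on U (\<lambda>x. blinfun_apply (Blinfun (h' x)) i)"
      using cont[of i] by (rule continuous_on_eq) (simp add: eq)
  qed
qed

lemma C1_on_subset: "C1_on U h \<Longrightarrow> V \<subseteq> U \<Longrightarrow> C1_on V h"
  unfolding C1_on_def by (meson continuous_on_subset subsetD)

lemma C1_on_const: "C1_on U (\<lambda>x::'a::euclidean_space. c)"
  by (rule C1_onI[where h'="\<lambda>x v. 0"]) auto

lemma C1_on_continuous: "C1_on U h \<Longrightarrow> continuous_on U h"
  unfolding C1_on_def by (meson continuous_at_imp_continuous_on has_derivative_continuous)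

lemma C2_on_imp_C1_on:
  assumes "C2_on U h"
  shows "C1_on U h"
  using assms C1_on_continuous unfolding C2_on_def C1_on_def[of U h] by blast

text \<open>Covers composition and evaluation of operator-valued maps, the two products from which
  the tangential projection and the gradient field are built.\<close>

lemma C1_on_bilinear:
  fixes a :: "'a::euclidean_space \<Rightarrow> 'b::real_normed_vector"
  assumes "bounded_bilinear pr" "C1_on U a" "C1_on U b"
  shows "C1_on U (\<lambda>x. pr (a x) (b x))"
proof -
  interpret bounded_bilinear pr by fact
  obtain a' where a': "\<And>x. x \<in> U \<Longrightarrow> (a has_derivative blinfun_apply (a' x)) (at x)" "continuous_on U a'"
    using assms unfolding C1_on_def by blast
  obtain b' where b': "\<And>x. x \<in> U \<Longrightarrow> (b has_derivative blinfun_apply (b' x)) (at x)" "continuous_on U b'"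
    using assms unfolding C1_on_def by blast
  show ?thesis
  proof (rule C1_onI)
    show "((\<lambda>x. pr (a x) (b x)) has_derivative (\<lambda>v. pr (a x) (b' x v) + pr (a' x v) (b x))) (at x)"
      if "x \<in> U" for x
      by (rule FDERIV) (use a' b' that in auto)
    show "continuous_on U (\<lambda>x. pr (a x) (b' x v) + pr (a' x v) (b x))" for v
      by (intro continuous_intros continuous_on C1_on_continuous a'(2) b'(2) assms)
  qed
qed

lemma C1_on_linear:
  fixes a :: "'a::euclidean_space \<Rightarrow> 'b::real_normed_vector"
  assumes "bounded_linear F" "C1_on U a"
  shows "C1_on U (\<lambda>x. F (a x))"
proof -
  obtain a' where a': "\<And>x. x \<in> U \<Longrightarrow> (a has_derivative blinfun_apply (a' x)) (at x)" "continuous_on U a'"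
    using assms unfolding C1_on_def by blast
  show ?thesis
  proof (rule C1_onI)
    show "((\<lambda>x. F (a x)) has_derivative (\<lambda>v. F (a' x v))) (at x)" if "x \<in> U" for x
      by (rule bounded_linear.has_derivative[OF assms(1)]) (use a' that in auto)
    show "continuous_on U (\<lambda>x. F (a' x v))" for v
      by (intro bounded_linear.continuous_on[OF assms(1)] continuous_intros a'(2))
  qed
qed

lemma C1_on_add:
  fixes a :: "'a::euclidean_space \<Rightarrow> 'b::real_normed_vector"
  assumes "C1_on U a" "C1_on U b"
  shows "C1_on U (\<lambda>x. a x + b x)"
proof -
  obtain a' where a': "\<And>x. x \<in> U \<Longrightarrow> (a has_derivative blinfun_apply (a' x)) (at x)" "continuous_on U a'"
    using assms unfolding C1_on_def by blast
  obtain b' where b': "\<And>x. x \<in> U \<Longrightarrow> (b has_derivative blinfun_apply (b' x)) (at x)" "continuous_on U b'"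
    using assms unfolding C1_on_def by blast
  show ?thesis
  proof (rule C1_onI)
    show "((\<lambda>x. a x + b x) has_derivative (\<lambda>v. a' x v + b' x v)) (at x)" if "x \<in> U" for x
      using a' b' that by (auto intro!: derivative_intros)
    show "continuous_on U (\<lambda>x. a' x v + b' x v)" for v
      by (intro continuous_intros a'(2) b'(2))
  qed
qed

lemma C1_on_diff:
  fixes a :: "'a::euclidean_space \<Rightarrow> 'b::real_normed_vector"
  assumes "C1_on U a" "C1_on U b"
  shows "C1_on U (\<lambda>x. a x - b x)"
  using C1_on_add[OF assms(1) C1_on_linear[OF bounded_linear_minus[OF bounded_linear_ident] assms(2)]]
  by simp

lemma has_derivative_imp_lipschitz_at:
  assumes "(h has_derivative h') (at x)"
  obtains C \<delta> where "C > 0" "\<delta> > 0" "\<And>y. norm (y - x) < \<delta> \<Longrightarrow> norm (h y - h x) \<le> C * norm (y - x)"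
proof -
  have bl: "bounded_linear h'" using assms by (rule has_derivative_bounded_linear)
  obtain K where K: "K > 0" "\<And>v. norm (h' v) \<le> norm v * K"
    using bounded_linear.pos_bounded[OF bl] by blast
  obtain d where d: "d > 0" "\<And>y. norm (y - x) < d \<Longrightarrow> norm (h y - h x - h' (y - x)) \<le> 1 * norm (y - x)"
    using assms unfolding has_derivative_at_alt by (meson zero_less_one)
  have "norm (h y - h x) \<le> (1 + K) * norm (y - x)" if "norm (y - x) < d" for y
  proof -
    have "norm (h y - h x) \<le> norm (h y - h x - h' (y - x)) + norm (h' (y - x))"
      by (metis diff_add_cancel norm_triangle_ineq)
    then show ?thesis using d(2)[OF that] K(2)[of "y - x"] by (simp add: algebra_simps)
  qed
  then show ?thesis using that[of "1 + K" d] K d by auto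
qed

text \<open>Continuity keeps the norm of the derivative below \<open>norm (h' x) + 1\<close> on a
  ball; the mean value inequality turns the same number into a Lipschitz constant.\<close>

lemma C1_on_local_bounds:
  fixes h :: "'a::euclidean_space \<Rightarrow> 'b::real_normed_vector"
  assumes "C1_on U h" "open U" "x \<in> U"
  obtains h' C \<delta> where "C > 0" "\<delta> > 0" "ball x \<delta> \<subseteq> U"
    "\<And>y. y \<in> ball x \<delta> \<Longrightarrow> (h has_derivative blinfun_apply (h' y)) (at y)"
    "\<And>y. y \<in> ball x \<delta> \<Longrightarrow> norm (h' y) \<le> C"
    "\<And>y z. y \<in> ball x \<delta> \<Longrightarrow> z \<in> ball x \<delta> \<Longrightarrow> norm (h y - h z) \<le> C * norm (y - z)"
proof -
  obtain h' where h': "\<And>x. x \<in> U \<Longrightarrow> (h has_derivative blinfun_apply (h' x)) (at x)" "continuous_on U h'"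
    using assms unfolding C1_on_def by blast
  have "isCont h' x" using h' assms by (simp add: continuous_on_eq_continuous_at)
  then obtain d where d: "d > 0" "\<And>y. dist y x < d \<Longrightarrow> dist (h' y) (h' x) < 1"
    unfolding continuous_at_eps_delta by (meson zero_less_one)
  obtain e where e: "e > 0" "ball x e \<subseteq> U" using assms open_contains_ball by blast
  define C where "C = norm (h' x) + 1"
  have le: "norm (h' y) \<le> C" if "y \<in> ball x (min d e)" for y
    using d(2)[of y] that norm_triangle_sub[of "h' y" "h' x"] by (simp add: C_def dist_norm norm_minus_commute)
  have "norm (h y - h z) \<le> C * norm (y - z)" if "y \<in> ball x (min d e)" "z \<in> ball x (min d e)" for y z
  proof (rule differentiable_bound[OF convex_ball _ _ that])
    show "(h has_derivative blinfun_apply (h' w)) (at w within ball x (min d e))" if "w \<in> ball x (min d e)" for w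
    proof (rule has_derivative_at_withinI, rule h'(1))
      show "w \<in> U" using that e by auto
    qed
    show "onorm (blinfun_apply (h' w)) \<le> C" if "w \<in> ball x (min d e)" for w
      using le[OF that] by (simp add: norm_blinfun.rep_eq)
  qed
  moreover have "ball x (min d e) \<subseteq> U" using e by auto
  ultimately show ?thesis
    using that[of C "min d e" h'] d e le h'(1) by (auto simp: C_def add_nonneg_pos subset_iff)
qed

text \<open>The resolvent identity is used twice: on a small ball it bounds the inverses and makes
  \<open>i\<close> Lipschitz at \<open>x\<close>; then replacing its factor \<open>i y\<close> by
  \<open>i x\<close> costs only a quadratic error and yields the derivative.\<close>

lemma C1_on_inverse:
  fixes a i :: "'a::euclidean_space \<Rightarrow> 'b::real_normed_vector \<Rightarrow>\<^sub>L 'b"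
  assumes C1: "C1_on U a" and op: "open U"
    and inv1: "\<And>x. x \<in> U \<Longrightarrow> a x o\<^sub>L i x = id_blinfun"
    and inv2: "\<And>x. x \<in> U \<Longrightarrow> i x o\<^sub>L a x = id_blinfun"
  shows "C1_on U i"
proof -
  obtain a' where a': "\<And>x. x \<in> U \<Longrightarrow> (a has_derivative blinfun_apply (a' x)) (at x)" "continuous_on U a'"
    using C1 unfolding C1_on_def by blast
  have resolvent: "i y - i x = - (i y o\<^sub>L (a y - a x) o\<^sub>L i x)" if "x \<in> U" "y \<in> U" for x y
  proof (rule blinfun_eqI)
    fix v
    have "i y (a y (i x v)) = i x v" "a x (i x v) = v"
      using inv1[OF that(1)] inv2[OF that(2)]
      by (metis blinfun_apply_blinfun_compose blinfun_apply_id_blinfun)+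
    then show "blinfun_apply (i y - i x) v = blinfun_apply (- (i y o\<^sub>L (a y - a x) o\<^sub>L i x)) v"
      by (simp add: blinfun.bilinear_simps)
  qed
  have nc: "norm (p o\<^sub>L q o\<^sub>L s) \<le> norm p * norm q * norm s" for p q s :: "'b \<Rightarrow>\<^sub>L 'b"
    by (metis (no_types, opaque_lifting) mult.commute mult_left_mono norm_blinfun_compose norm_ge_zero order_trans)
  have lip: "\<exists>C>0. \<exists>\<delta>>0. ball x \<delta> \<subseteq> U \<and> (\<forall>y\<in>ball x \<delta>. norm (a y - a x) \<le> C * norm (y - x) \<and> norm (i y - i x) \<le> C * norm (y - x))"
    if x: "x \<in> U" for x
  proof -
    obtain C \<delta> where C: "C > 0" "\<delta> > 0" "\<And>y. norm (y - x) < \<delta> \<Longrightarrow> norm (a y - a x) \<le> C * norm (y - x)"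
      using has_derivative_imp_lipschitz_at[OF a'(1)[OF x]] by blast
    obtain e where e: "e > 0" "ball x e \<subseteq> U" using x op open_contains_ball by blast
    define N where "N = norm (i x) + 1"
    have N: "N > 0" by (simp add: N_def add_nonneg_pos)
    \<comment> \<open>The last entry makes \<open>norm (a y - a x) * norm (i x)\<close> at most 1/2.
      Then \<open>i y - i x\<close> has at most half the norm of \<open>i y\<close>, which forces
      \<open>norm (i y) \<le> 2 * N\<close>.\<close>
    define r where "r = min (min \<delta> e) (1 / (2 * C * N))"
    have r: "r > 0" using C e N by (simp add: r_def)
    have "norm (i y - i x) \<le> (2 * C * N * N) * norm (y - x)" if y: "y \<in> ball x r" for y
    proof -
      have yd: "norm (y - x) < \<delta>" "y \<in> U" "norm (y - x) \<le> 1 / (2 * C * N)"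
        using y e by (auto simp: r_def dist_norm norm_minus_commute)
      have 1: "norm (i y - i x) \<le> norm (i y) * norm (a y - a x) * norm (i x)"
        using nc resolvent[OF x yd(2)] by simp
      have 2: "norm (a y - a x) * norm (i x) \<le> (C * norm (y - x)) * N"
        by (intro mult_mono C(3) yd) (use C in \<open>auto simp: N_def\<close>)
      have 3: "(C * norm (y - x)) * N \<le> 1 / 2"
        using yd(3) C N by (simp add: field_simps)
      have "norm (i y - i x) \<le> norm (i y) * (1 / 2)"
        using 1 mult_left_mono[OF order_trans[OF 2 3], of "norm (i y)"] by (simp add: mult.assoc)
      then have "norm (i y) \<le> 2 * N" using norm_triangle_sub[of "i y" "i x"] by (simp add: N_def)
      then have "norm (i y) * (norm (a y - a x) * norm (i x)) \<le> 2 * N * ((C * norm (y - x)) * N)"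
        by (intro mult_mono 2) (use N in auto)
      then show ?thesis using 1 by (simp add: algebra_simps)
    qed
    moreover have "norm (a y - a x) \<le> C * norm (y - x)" if "y \<in> ball x r" for y
      by (rule C(3)) (use that in \<open>simp add: r_def dist_norm norm_minus_commute\<close>)
    moreover have "ball x r \<subseteq> U" using e by (auto simp: r_def)
    ultimately have "\<forall>y\<in>ball x r. norm (a y - a x) \<le> max C (2 * C * N * N) * norm (y - x)
        \<and> norm (i y - i x) \<le> max C (2 * C * N * N) * norm (y - x)"
      by (meson max.cobounded1 max.cobounded2 mult_right_mono norm_ge_zero order_trans)
    moreover have "max C (2 * C * N * N) > 0" using C by simp
    ultimately show ?thesis using r \<open>ball x r \<subseteq> U\<close> by blast
  qed
  show ?thesis
  proof (rule C1_onI)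
    fix x assume x: "x \<in> U"
    obtain C \<delta> where C: "C > 0" "\<delta> > 0" "ball x \<delta> \<subseteq> U"
      and lipa: "\<And>y. y \<in> ball x \<delta> \<Longrightarrow> norm (a y - a x) \<le> C * norm (y - x)"
      and lipi: "\<And>y. y \<in> ball x \<delta> \<Longrightarrow> norm (i y - i x) \<le> C * norm (y - x)"
      using lip[OF x] by blast
    have bl: "bounded_linear (\<lambda>v. - (i x o\<^sub>L a' x v o\<^sub>L i x))"
      by (intro bounded_linear_intros bounded_linear_minus)
    show "(i has_derivative (\<lambda>v. - (i x o\<^sub>L a' x v o\<^sub>L i x))) (at x)"
      unfolding has_derivative_at_alt
    proof (intro conjI bl allI impI)
      fix e :: real assume e: "e > 0"
      define N where "N = norm (i x) + 1"
      have N: "N > 0" by (simp add: N_def add_nonneg_pos)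
      \<comment> \<open>Two errors share \<open>e\<close> equally: the first-order remainder of
        \<open>a\<close>, controlled through \<open>e1\<close>, and a product of two increments,
        controlled by the radius \<open>e / (2 * C * C * N)\<close> below.\<close>
      define e1 where "e1 = e / (2 * N * N)"
      have e1: "e1 > 0" using e N by (simp add: e1_def)
      obtain d where d: "d > 0" "\<And>y. norm (y - x) < d \<Longrightarrow> norm (a y - a x - a' x (y - x)) \<le> e1 * norm (y - x)"
        using a'(1)[OF x] e1 unfolding has_derivative_at_alt by blast
      define r where "r = min (min d \<delta>) (e / (2 * C * C * N))"
      have "norm (i y - i x - - (i x o\<^sub>L a' x (y - x) o\<^sub>L i x)) \<le> e * norm (y - x)" if y: "norm (y - x) < r" for y
      proof -
        have yb: "y \<in> ball x \<delta>" "y \<in> U" "norm (y - x) < d" "norm (y - x) \<le> e / (2 * C * C * N)"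
          using y C by (auto simp: r_def dist_norm norm_minus_commute)
        have "i y - i x - - (i x o\<^sub>L a' x (y - x) o\<^sub>L i x)
            = - ((i y - i x) o\<^sub>L (a y - a x) o\<^sub>L i x) - (i x o\<^sub>L (a y - a x - a' x (y - x)) o\<^sub>L i x)"
        proof -
          have "i y - i x - - (i x o\<^sub>L a' x (y - x) o\<^sub>L i x)
              = - (i y o\<^sub>L (a y - a x) o\<^sub>L i x) + (i x o\<^sub>L a' x (y - x) o\<^sub>L i x)"
            using resolvent[OF x yb(2)] by simp
          also have "\<dots> = - ((i y - i x) o\<^sub>L (a y - a x) o\<^sub>L i x) - (i x o\<^sub>L (a y - a x - a' x (y - x)) o\<^sub>L i x)"
            by (rule blinfun_eqI) (simp add: blinfun.bilinear_simps)
          finally show ?thesis .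
        qed
        then have "norm (i y - i x - - (i x o\<^sub>L a' x (y - x) o\<^sub>L i x))
          \<le> norm (i y - i x) * norm (a y - a x) * norm (i x) + norm (i x) * norm (a y - a x - a' x (y - x)) * norm (i x)"
          using nc[of "i y - i x" "a y - a x" "i x"] nc[of "i x" "a y - a x - a' x (y - x)" "i x"]
          by (smt (verit) norm_minus_cancel norm_triangle_ineq4)
        also have "\<dots> \<le> (C * norm (y - x)) * (C * norm (y - x)) * N + N * (e1 * norm (y - x)) * N"
          by (intro add_mono mult_mono lipa lipi yb d(2)) (use C N e1 in \<open>auto simp: N_def\<close>)
        also have "\<dots> \<le> e / 2 * norm (y - x) + e / 2 * norm (y - x)"
        proof (rule add_mono)
          have "(C * norm (y - x)) * (C * norm (y - x)) * N = (C * C * N * norm (y - x)) * norm (y - x)"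
            by (simp add: algebra_simps)
          also have "\<dots> \<le> e / 2 * norm (y - x)"
            by (intro mult_right_mono) (use yb(4) C N in \<open>simp_all add: field_simps\<close>)
          finally show "(C * norm (y - x)) * (C * norm (y - x)) * N \<le> e / 2 * norm (y - x)" .
          show "N * (e1 * norm (y - x)) * N \<le> e / 2 * norm (y - x)"
            using N by (simp add: e1_def field_simps)
        qed
        finally show ?thesis by simp
      qed
      moreover have "r > 0" using d C e N by (simp add: r_def)
      ultimately show "\<exists>d>0. \<forall>y. norm (y - x) < d \<longrightarrow> norm (i y - i x - - (i x o\<^sub>L a' x (y - x) o\<^sub>L i x)) \<le> e * norm (y - x)"
        by blast
    qed
  next
    fix v
    have "continuous_on U i"
    proof (rule continuous_at_imp_continuous_on, rule ballI)
      fix x assume x: "x \<in> U"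
      obtain C \<delta> where C: "C > 0" "\<delta> > 0" "\<And>y. y \<in> ball x \<delta> \<Longrightarrow> norm (i y - i x) \<le> C * norm (y - x)"
        using lip[OF x] by blast
      show "isCont i x"
        unfolding continuous_at_eps_delta
      proof (intro allI impI)
        fix e :: real assume e: "e > 0"
        have "dist (i y) (i x) < e" if "dist y x < min \<delta> (e / C)" for y
        proof -
          have "norm (i y - i x) \<le> C * norm (y - x)" "norm (y - x) < e / C"
            using C(3)[of y] that by (auto simp: dist_norm norm_minus_commute)
          then show ?thesis using C by (simp add: dist_norm field_simps)
        qed
        then show "\<exists>d>0. \<forall>y. dist y x < d \<longrightarrow> dist (i y) (i x) < e"
          using C e by (intro exI[of _ "min \<delta> (e / C)"]) auto
      qed
    qed
    then show "continuous_on U (\<lambda>x. - (i x o\<^sub>L a' x v o\<^sub>L i x))"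
      by (intro continuous_intros a'(2))
  qed
qed

section \<open>Defining maps, tangential projections and charts of a submanifold\<close>

section \<open>Local structure of submanifolds\<close>

lemma closest_point_subspace:
  fixes S :: "'a::euclidean_space set"
  assumes "subspace S" "a \<in> S" "\<And>s. s \<in> S \<Longrightarrow> (x - a) \<bullet> s = 0"
  shows "closest_point S x = a"
proof -
  have "dist x a \<le> dist x z" if "z \<in> S" for z
  proof -
    have "(x - a) \<bullet> (a - z) = 0" using assms that by (simp add: subspace_diff)
    then have "(norm ((x - a) + (a - z)))\<^sup>2 = (norm (x - a))\<^sup>2 + (norm (a - z))\<^sup>2"
      using norm_add_Pythagorean[of "x - a" "a - z"] by (simp add: orthogonal_def)
    then have "(norm (x - a))\<^sup>2 \<le> (norm (x - z))\<^sup>2" by simp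
    then show ?thesis by (simp add: dist_norm)
  qed
  then show ?thesis
    using closest_point_unique[of S a x] assms subspace_imp_convex closed_subspace by metis
qed

lemma blinfun_adjoint:
  fixes L :: "'a::euclidean_space \<Rightarrow>\<^sub>L 'b::euclidean_space"
  shows "blinfun_apply (Blinfun (adjoint (blinfun_apply L))) v \<bullet> w = v \<bullet> blinfun_apply L w"
proof -
  have l: "linear (blinfun_apply L)"
    using blinfun.bounded_linear_right bounded_linear.linear by blast
  have "bounded_linear (adjoint (blinfun_apply L))"
    using adjoint_linear[OF l] linear_linear by blast
  then show ?thesis
    using adjoint_works[OF l] by (simp add: bounded_linear_Blinfun_apply inner_commute)
qed

text \<open>Makes the adjoint of a C1 operator field C1 again. The norm bound follows because the
  squared norm of the adjoint's value at \<open>v\<close> is the inner product of \<open>v\<close>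
  with \<open>L\<close> applied to that value.\<close>

lemma bounded_linear_adjoint_blinfun:
  "bounded_linear (\<lambda>L :: 'a::euclidean_space \<Rightarrow>\<^sub>L 'b::euclidean_space. Blinfun (adjoint (blinfun_apply L)))"
    (is "bounded_linear ?A")
proof (rule bounded_linear_intro[where K = 1])
  fix L L' :: "'a \<Rightarrow>\<^sub>L 'b" and r :: real
  show "?A (L + L') = ?A L + ?A L'"
    by (rule blinfun_eqI, subst vector_eq_rdot[symmetric])
      (simp add: blinfun_adjoint blinfun.bilinear_simps inner_add_left inner_add_right)
  show "?A (r *\<^sub>R L) = r *\<^sub>R ?A L"
    by (rule blinfun_eqI, subst vector_eq_rdot[symmetric])
      (simp add: blinfun_adjoint blinfun.bilinear_simps)
  show "norm (?A L) \<le> norm L * 1"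
  proof (rule norm_blinfun_bound)
    fix v
    have "(norm (?A L v))\<^sup>2 = v \<bullet> L (?A L v)"
      by (simp add: power2_norm_eq_inner blinfun_adjoint)
    also have "\<dots> \<le> norm v * norm (L (?A L v))" by (rule norm_cauchy_schwarz)
    also have "\<dots> \<le> norm v * (norm L * norm (?A L v))"
      by (intro mult_left_mono norm_blinfun) auto
    finally have "norm (?A L v) * norm (?A L v) \<le> (norm L * norm v) * norm (?A L v)"
      by (simp add: power2_eq_square algebra_simps)
    then show "norm (?A L v) \<le> norm L * 1 * norm v"
      by (cases "norm (?A L v) = 0") (auto simp: mult_le_cancel_right)
  qed simp
qed

lemma blinfun_inverse_exists:
  fixes L :: "'a::euclidean_space \<Rightarrow>\<^sub>L 'a"
  assumes "bij (blinfun_apply L)"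
  obtains L' where "L o\<^sub>L L' = id_blinfun" "L' o\<^sub>L L = id_blinfun" "blinfun_apply L' = inv (blinfun_apply L)"
proof -
  have l: "linear (blinfun_apply L)"
    using blinfun.bounded_linear_right bounded_linear.linear by blast
  have "linear (inv (blinfun_apply L))"
    using inj_linear_imp_inv_linear[OF l] assms by (simp add: bij_is_inj)
  then have eq: "blinfun_apply (Blinfun (inv (blinfun_apply L))) = inv (blinfun_apply L)"
    using bounded_linear_Blinfun_apply linear_linear by blast
  have 1: "L o\<^sub>L Blinfun (inv (blinfun_apply L)) = id_blinfun"
    by (rule blinfun_eqI) (use assms in \<open>simp add: eq bij_is_surj surj_f_inv_f\<close>)
  have 2: "Blinfun (inv (blinfun_apply L)) o\<^sub>L L = id_blinfun"
    by (rule blinfun_eqI) (use assms in \<open>simp add: eq bij_is_inj inv_f_f\<close>)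
  show ?thesis using that[OF 1 2 eq] .
qed

text \<open>Composing \<open>\<Phi>\<close> with a left inverse \<open>A\<close> of
  \<open>\<Phi>'\<close> on the orthogonal complement of its kernel moves the arbitrary target space
  \<open>W\<close> to that complement. The derivative at \<open>xs\<close> then is the orthogonal
  projection \<open>Q\<close> onto it, so that the operators built later are perturbations of
  \<open>Q\<close> or of the identity.\<close>

lemma submanifold_normal_form:
  fixes M :: "'a::euclidean_space set"
  assumes "submanifold_around M xs"
  obtains Q :: "'a \<Rightarrow>\<^sub>L 'a" and U \<Theta> B where "open U" "xs \<in> U" "xs \<in> M"
    "\<And>z. z \<in> U \<Longrightarrow> (\<Theta> has_derivative blinfun_apply (B z)) (at z)" "C1_on U B" "B xs = Q"
    "\<And>z. z \<in> U \<Longrightarrow> Q (\<Theta> z) = \<Theta> z" "\<And>z v. z \<in> U \<Longrightarrow> Q (B z v) = B z v"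
    "\<And>v. Q (Q v) = Q v" "\<And>v w. Q v \<bullet> w = v \<bullet> Q w"
    "M \<inter> U = {z \<in> U. \<Theta> z = 0}"
proof -
  obtain U W and \<Phi> :: "'a \<Rightarrow> 'a" and \<Phi>' where U: "open U" "xs \<in> U" "xs \<in> M" and W: "subspace W" and C2: "C2_on U \<Phi>"
    and im: "\<Phi> ` U \<subseteq> W" and der: "(\<Phi> has_derivative \<Phi>') (at xs)" and rng: "range \<Phi>' = W"
    and MU: "M \<inter> U = {x \<in> U. \<Phi> x = 0}"
    using assms unfolding submanifold_around_def by (elim conjE exE) (rule that; assumption)
  obtain D where D: "\<And>z. z \<in> U \<Longrightarrow> (\<Phi> has_derivative blinfun_apply (D z)) (at z)" "C1_on U D"
    using C2 unfolding C2_on_def by blast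
  have Dxs: "blinfun_apply (D xs) = \<Phi>'" using D(1)[OF U(2)] der has_derivative_unique by blast
  have lin: "linear \<Phi>'" using der has_derivative_linear by blast
  define T where "T = {v. \<Phi>' v = 0}"
  have sT: "subspace T" unfolding T_def by (rule linear_subspace_kernel[OF lin])
  define N where "N = T\<^sup>\<bottom>"
  have sN: "subspace N" unfolding N_def by (rule subspace_orthogonal_comp)
  have TN: "t \<bullet> n = 0" if "t \<in> T" "n \<in> N" for t n
    using that unfolding N_def orthogonal_comp_def orthogonal_def by auto
  have inj: "inj_on \<Phi>' N"
  proof (rule inj_onI)
    fix a b assume ab: "a \<in> N" "b \<in> N" "\<Phi>' a = \<Phi>' b"
    then have "a - b \<in> T" "a - b \<in> N" by (auto simp: T_def linear_diff[OF lin] subspace_diff[OF sN])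
    then show "a = b" using TN by (metis inner_eq_zero_iff right_minus_eq)
  qed
  obtain A where A: "range A \<subseteq> N" "linear A" "\<And>n. n \<in> N \<Longrightarrow> A (\<Phi>' n) = n"
    using linear_exists_left_inverse_on[OF lin sN inj] by blast
  have blA: "bounded_linear A" using A(2) linear_linear by blast
  define AL where "AL = Blinfun A"
  have AL: "blinfun_apply AL = A" unfolding AL_def using blA by (rule bounded_linear_Blinfun_apply)
  define Q where "Q = AL o\<^sub>L D xs"
  have Q: "blinfun_apply Q v = A (\<Phi>' v)" for v by (simp add: Q_def AL Dxs)
  have dec: "v - Q v \<in> T \<and> Q v \<in> N" for v
  proof -
    obtain t n where tn: "t \<in> T" "n \<in> N" "v = t + n"
    proof -
      obtain t n where "t \<in> span T" "\<And>w. w \<in> span T \<Longrightarrow> orthogonal n w" "v = t + n"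
        using orthogonal_subspace_decomp_exists[of T v] by blast
      moreover have "span T = T" using sT by (simp add: span_eq_iff)
      ultimately show ?thesis using that[of t n]
        by (simp add: N_def orthogonal_comp_def orthogonal_commute)
    qed
    have "Q v = n" using tn A(3) by (simp add: Q linear_add[OF lin] T_def)
    then show ?thesis using tn by simp
  qed
  have Qn: "Q n = n" if "n \<in> N" for n using A(3)[OF that] by (simp add: Q)
  have Q\<Phi>: "\<Phi> z = \<Phi>' v \<Longrightarrow> A (\<Phi> z) = Q v" for z v by (simp add: Q)
  have \<Phi>Q: "\<Phi>' (Q v) = \<Phi>' v" for v
    using dec[of v] by (simp add: T_def linear_diff[OF lin])
  have ex: "\<exists>v. \<Phi> z = \<Phi>' v" if "z \<in> U" for z using im rng that by blast
  show ?thesis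
  proof (rule that[of U "\<lambda>z. A (\<Phi> z)" "\<lambda>z. AL o\<^sub>L D z" Q])
    show "((\<lambda>z. A (\<Phi> z)) has_derivative blinfun_apply (AL o\<^sub>L D z)) (at z)" if "z \<in> U" for z
      using bounded_linear.has_derivative[OF blA D(1)[OF that]]
      by (simp add: AL comp_def has_derivative_def blinfun_compose.rep_eq)
    show "C1_on U (\<lambda>z. AL o\<^sub>L D z)"
      by (rule C1_on_bilinear[OF bounded_bilinear_blinfun_compose C1_on_const D(2)])
    show "Q (Q v) = Q v" for v using Qn dec by blast
    show "Q v \<bullet> w = v \<bullet> Q w" for v w
    proof -
      have "(w - Q w) \<bullet> Q v = 0" "(v - Q v) \<bullet> Q w = 0" using TN dec by blast+
      then show ?thesis by (simp add: inner_diff_left inner_diff_right inner_commute)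
    qed
    show "Q (A (\<Phi> z)) = A (\<Phi> z)" if "z \<in> U" for z using A(1) Qn by blast
    show "Q ((AL o\<^sub>L D z) v) = (AL o\<^sub>L D z) v" if "z \<in> U" for z v
      using A(1) Qn by (simp add: AL range_subsetD)
    \<comment> \<open>\<open>A\<close> is injective on \<open>W\<close>: each element of
      \<open>W\<close> is some \<open>\<Phi>' v\<close>, and
      \<open>\<Phi>' v = \<Phi>' (Q v)\<close> with \<open>Q v = A (\<Phi>' v)\<close>. Hence the
      zero set does not grow.\<close>
    have "A (\<Phi> z) = 0 \<longleftrightarrow> \<Phi> z = 0" if z: "z \<in> U" for z
    proof
      assume "A (\<Phi> z) = 0"
      obtain v where v: "\<Phi> z = \<Phi>' v" using ex[OF z] by blast
      have "Q v = 0" using Q\<Phi>[OF v] \<open>A (\<Phi> z) = 0\<close> by simp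
      then show "\<Phi> z = 0" using v \<Phi>Q[of v] lin by (simp add: linear_0)
    qed (simp add: linear_0[OF A(2)])
    then show "M \<inter> U = {z \<in> U. A (\<Phi> z) = 0}" using MU by auto
  qed (use U in \<open>simp_all add: Q_def\<close>)
qed

text \<open>A kernel vector \<open>v\<close> would satisfy
  \<open>norm v \<le> norm (L - id_blinfun) * norm v\<close>, so it vanishes; in finite dimension
  injectivity suffices.\<close>

lemma bij_near_id_blinfun:
  fixes L :: "'a::euclidean_space \<Rightarrow>\<^sub>L 'a"
  assumes "norm (L - id_blinfun) < 1"
  shows "bij (blinfun_apply L)"
proof -
  have l: "linear (blinfun_apply L)"
    using blinfun.bounded_linear_right bounded_linear.linear by blast
  have "inj (blinfun_apply L)"
  proof (rule linear_injective_0[OF l, THEN iffD2], intro allI impI)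
    fix v assume "blinfun_apply L v = 0"
    then have "norm v = norm ((L - id_blinfun) v)" by (simp add: blinfun.bilinear_simps)
    also have "\<dots> \<le> norm (L - id_blinfun) * norm v" by (rule norm_blinfun)
    finally have "(1 - norm (L - id_blinfun)) * norm v \<le> 0" by (simp add: algebra_simps)
    then show "v = 0" using assms by (simp add: mult_le_0_iff)
  qed
  then show ?thesis using linear_injective_imp_surjective[OF l] by (simp add: bij_def)
qed

text \<open>The orthogonal projection onto \<open>ker B\<close> is \<open>I - B\<^sup>T K\<^sup>-\<^sup>1 B\<close> with \<open>K = I - Q + B B\<^sup>T\<close>: adding
  \<open>I - Q\<close> to the Gram operator makes it invertible on the whole space.\<close>

lemma C1_kernel_projection:
  fixes B :: "'a::euclidean_space \<Rightarrow> 'a \<Rightarrow>\<^sub>L 'a" and Q :: "'a \<Rightarrow>\<^sub>L 'a"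
  assumes U: "open U" "xs \<in> U" and C1: "C1_on U B" and Bx: "B xs = Q"
    and QB: "\<And>z v. z \<in> U \<Longrightarrow> Q (B z v) = B z v"
    and QQ: "\<And>v. Q (Q v) = Q v" and Qs: "\<And>v w. Q v \<bullet> w = v \<bullet> Q w"
  obtains V and P :: "'a \<Rightarrow> 'a \<Rightarrow>\<^sub>L 'a" where "open V" "V \<subseteq> U" "xs \<in> V" "C1_on V P"
    "\<And>z w. z \<in> V \<Longrightarrow> B z (P z w) = 0"
    "\<And>z w s. z \<in> V \<Longrightarrow> B z s = 0 \<Longrightarrow> (w - P z w) \<bullet> s = 0"
proof -
  define Bt where "Bt = (\<lambda>z. Blinfun (adjoint (blinfun_apply (B z))))"
  have Bt: "Bt z v \<bullet> w = v \<bullet> B z w" for z v w by (simp add: Bt_def blinfun_adjoint)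
  have C1t: "C1_on U Bt" unfolding Bt_def by (rule C1_on_linear[OF bounded_linear_adjoint_blinfun C1])
  define K where "K = (\<lambda>z. (id_blinfun - Q) + (B z o\<^sub>L Bt z))"
  have C1K: "C1_on U K" unfolding K_def
    by (intro C1_on_add C1_on_const C1_on_bilinear[OF bounded_bilinear_blinfun_compose] C1 C1t)
  have "Bt xs = Q"
  proof (rule blinfun_eqI)
    fix v
    have "Bt xs v \<bullet> w = Q v \<bullet> w" for w by (simp add: Bt Bx Qs)
    then show "Bt xs v = Q v" using vector_eq_rdot by blast
  qed
  then have Kx: "K xs = id_blinfun"
    by (intro blinfun_eqI) (simp add: K_def Bx blinfun.bilinear_simps QQ)
  define V where "V = U \<inter> K -` ball id_blinfun 1"
  have V: "open V" "V \<subseteq> U" "xs \<in> V"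
    using continuous_open_preimage[OF C1_on_continuous[OF C1K] U(1), of "ball id_blinfun 1"] U Kx
    by (auto simp: V_def)
  have bij: "bij (blinfun_apply (K z))" if "z \<in> V" for z
    by (rule bij_near_id_blinfun) (use that in \<open>auto simp: V_def dist_norm norm_minus_commute\<close>)
  have "\<forall>z\<in>V. \<exists>L'. K z o\<^sub>L L' = id_blinfun \<and> L' o\<^sub>L K z = id_blinfun"
    using blinfun_inverse_exists[OF bij] by metis
  then obtain Ki where Ki: "\<And>z. z \<in> V \<Longrightarrow> K z o\<^sub>L Ki z = id_blinfun" "\<And>z. z \<in> V \<Longrightarrow> Ki z o\<^sub>L K z = id_blinfun"
    by metis
  have C1Ki: "C1_on V Ki"
    using C1_on_inverse[OF C1_on_subset[OF C1K V(2)] V(1) Ki] .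
  define P where "P = (\<lambda>z. id_blinfun - (Bt z o\<^sub>L (Ki z o\<^sub>L B z)))"
  have "C1_on V P" unfolding P_def
    by (intro C1_on_diff C1_on_const C1_on_bilinear[OF bounded_bilinear_blinfun_compose]
        C1_on_subset[OF C1 V(2)] C1_on_subset[OF C1t V(2)] C1Ki)
  moreover have "(w - P z w) \<bullet> s = 0" if "B z s = 0" for z w s
    using that by (simp add: P_def blinfun.bilinear_simps Bt)
  moreover have "B z (P z w) = 0" if z: "z \<in> V" for z w
  proof -
    have zU: "z \<in> U" using z V by blast
    define n where "n = Ki z (B z w)"
    have Kn: "n - Q n + B z (Bt z n) = B z w"
    proof -
      have "K z n = B z w"
        using Ki(1)[OF z] unfolding n_def
        by (metis blinfun_apply_blinfun_compose blinfun_apply_id_blinfun)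
      then show ?thesis by (simp add: K_def blinfun.bilinear_simps)
    qed
    \<comment> \<open>\<open>Q\<close> kills \<open>n - Q n\<close> and fixes the range of
      \<open>B z\<close>. Applied to \<open>Kn\<close> it isolates the Gram part,
      \<open>B z (Bt z n) = B z w\<close>, which says that \<open>P z w\<close> is in the kernel of
      \<open>B z\<close>.\<close>
    have "Q (n - Q n + B z (Bt z n)) = B z (Bt z n)"
      by (simp add: blinfun.bilinear_simps QQ QB[OF zU])
    then have "B z (Bt z n) = B z w" using Kn QB[OF zU] by simp
    then show ?thesis by (simp add: P_def n_def blinfun.bilinear_simps)
  qed
  ultimately show ?thesis using that V by blast
qed

section \<open>Curves in a submanifold and derivatives along them\<close>

lemma curve_in_eventually:
  fixes M :: "'a::euclidean_space set"
  assumes c: "curve_in M p v c" and U: "open U" "p \<in> U"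
  shows "\<forall>\<^sub>F t in at 0. c t \<in> M \<inter> U"
proof -
  obtain e where c: "c 0 = p" "(c has_vector_derivative v) (at 0)" "e > 0" "c ` {-e<..<e} \<subseteq> M"
    using c unfolding curve_in_def by blast
  have "isCont c 0" using c(2) has_vector_derivative_continuous by blast
  then have "\<forall>\<^sub>F t in at 0. c t \<in> U"
    using c(1) U by (auto simp: isCont_def dest: topological_tendstoD)
  moreover have "\<forall>\<^sub>F t in at 0. t \<in> {-e<..<e}"
    using c(3) by (intro eventually_at_in_open') auto
  ultimately show ?thesis by eventually_elim (use c(4) in auto)
qed

lemma curve_in_start: "curve_in M p v c \<Longrightarrow> c 0 = p \<and> p \<in> M"
  unfolding curve_in_def by force

lemma curve_in_compose_derivative:
  fixes M :: "'a::euclidean_space set"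
  assumes c: "curve_in M p v c" and der: "(H has_derivative H') (at p)"
  shows "((H \<circ> c) has_vector_derivative H' v) (at 0)"
proof -
  have "((H \<circ> c) has_derivative H' \<circ> (\<lambda>h. h *\<^sub>R v)) (at 0)"
    by (rule diff_chain_at) (use c der in \<open>auto simp: curve_in_def has_vector_derivative_def\<close>)
  moreover have "H' \<circ> (\<lambda>h. h *\<^sub>R v) = (\<lambda>h. h *\<^sub>R H' v)"
    using linear_scale[OF has_derivative_linear[OF der]] by auto
  ultimately show ?thesis by (simp add: has_vector_derivative_def)
qed

text \<open>Resolves the definite description: near parameter 0 every curve in \<open>M\<close> sees
  only the extension \<open>H\<close>, and tangency of \<open>v\<close> supplies one curve, without
  which uniqueness would fail.\<close>

lemma mfd_deriv_eqI:
  fixes M :: "'a::euclidean_space set" and H :: "'a \<Rightarrow> 'b::real_normed_vector"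
  assumes v: "v \<in> tangent_space M p" and U: "open U" "p \<in> U"
    and eq: "\<And>z. z \<in> M \<inter> U \<Longrightarrow> \<phi> z = H z" and der: "(H has_derivative H') (at p)"
  shows "mfd_deriv M \<phi> p v = H' v"
proof -
  have main: "((\<phi> \<circ> c) has_vector_derivative H' v) (at 0)" if c: "curve_in M p v c" for c
  proof -
    have "\<forall>\<^sub>F t in at 0. (H \<circ> c) t = (\<phi> \<circ> c) t"
      using curve_in_eventually[OF c U] by eventually_elim (use eq in simp)
    moreover have "(H \<circ> c) 0 = (\<phi> \<circ> c) 0" using curve_in_start[OF c] eq U by simp
    ultimately show ?thesis
      using has_derivative_transform_eventually curve_in_compose_derivative[OF c der]
      unfolding has_vector_derivative_def by blast
  qed
  obtain c where c: "curve_in M p v c" using v unfolding tangent_space_def by blast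
  show ?thesis
    unfolding mfd_deriv_def
    by (rule the_equality) (use main c vector_derivative_unique_at in blast)+
qed

text \<open>The restriction of \<open>\<Theta>\<close> to \<open>M\<close> has two ambient
  extensions, the constant 0 and \<open>\<Theta>\<close> itself; they must have the same derivative
  along \<open>M\<close>.\<close>

lemma tangent_space_normal_form:
  fixes M :: "'a::euclidean_space set" and Q :: "'a \<Rightarrow>\<^sub>L 'a"
  assumes U: "open U"
    and \<Theta>: "\<And>z. z \<in> U \<Longrightarrow> (\<Theta> has_derivative blinfun_apply (B z)) (at z)"
    and MU: "M \<inter> U = {z \<in> U. \<Theta> z = 0}"
    and p: "p \<in> U" and v: "v \<in> tangent_space M p"
  shows "B p v = 0"
proof -
  have "\<Theta> z = 0" if "z \<in> M \<inter> U" for z using that unfolding MU by simp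
  then have "mfd_deriv M \<Theta> p v = 0" by (rule mfd_deriv_eqI[OF v U p _ has_derivative_const])
  moreover have "mfd_deriv M \<Theta> p v = B p v" by (rule mfd_deriv_eqI[OF v U p refl \<Theta>[OF p]])
  ultimately show ?thesis by simp
qed

text \<open>The mean value inequality for \<open>c t - t *\<^sub>R w\<close>. It takes the place of
  integration in all Taylor estimates along curves and rays below.\<close>

lemma vector_derivative_deviation_bound:
  fixes c :: "real \<Rightarrow> 'a::real_normed_vector"
  assumes der: "\<And>t. t \<in> {0..1} \<Longrightarrow> (c has_vector_derivative c' t) (at t)"
    and B: "\<And>t. t \<in> {0..1} \<Longrightarrow> norm (c' t - w) \<le> B"
    and s: "s \<in> {0..1}"
  shows "norm (c s - c 0 - s *\<^sub>R w) \<le> B"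
proof -
  have "norm ((c s - s *\<^sub>R w) - (c 0 - 0 *\<^sub>R w)) \<le> B * norm (s - 0)"
  proof (rule differentiable_bound[of "{0..1}" "\<lambda>t. c t - t *\<^sub>R w" "\<lambda>t h. h *\<^sub>R (c' t - w)"])
    fix t :: real assume t: "t \<in> {0..1}"
    have "((\<lambda>t. c t - t *\<^sub>R w) has_vector_derivative c' t - w) (at t within {0..1})"
      by (rule derivative_eq_intros has_vector_derivative_at_within[OF der[OF t]] refl)+ simp
    then show "((\<lambda>t. c t - t *\<^sub>R w) has_derivative (\<lambda>h. h *\<^sub>R (c' t - w))) (at t within {0..1})"
      by (simp add: has_vector_derivative_def)
    show "onorm (\<lambda>h. h *\<^sub>R (c' t - w)) \<le> B"
      by (rule onorm_le) (use B[OF t] in \<open>simp add: mult.commute[of B] mult_left_mono\<close>)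
  qed (use s in auto)
  also have "\<dots> \<le> B" using s order_trans[OF norm_ge_zero B[OF s]] by (intro mult_left_le) auto
  finally show ?thesis by (simp add: algebra_simps)
qed

text \<open>A submanifold is only locally closed; this gives a compact piece around
  \<open>xs\<close> on which nearest points exist.\<close>

lemma compact_submanifold_cball:
  fixes M :: "'a::euclidean_space set"
  assumes "submanifold_around M xs"
  obtains \<rho> where "\<rho> > 0" "compact (M \<inter> cball xs \<rho>)"
proof -
  obtain U W and \<Phi> :: "'a \<Rightarrow> 'a" and \<Phi>' where U: "open U" "xs \<in> U" and C2: "C2_on U \<Phi>" and "\<Phi> ` U \<subseteq> W"
    "(\<Phi> has_derivative \<Phi>') (at xs)" "range \<Phi>' = W" and MU: "M \<inter> U = {x \<in> U. \<Phi> x = 0}"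
    using assms unfolding submanifold_around_def by (elim conjE exE) (rule that)
  obtain \<rho> where \<rho>: "\<rho> > 0" "cball xs \<rho> \<subseteq> U" using U open_contains_cball by blast
  have "M \<inter> cball xs \<rho> = {x \<in> cball xs \<rho>. \<Phi> x = 0}" using \<rho> MU by auto
  moreover have "closed {x \<in> cball xs \<rho>. \<Phi> x = 0}"
    using C1_on_continuous[OF C2_on_imp_C1_on[OF C2]] \<rho>
    by (intro continuous_closed_preimage_constant closed_cball) (rule continuous_on_subset)
  ultimately have "compact (M \<inter> cball xs \<rho>)"
    by (metis (no_types, lifting) bounded_cball bounded_subset compact_eq_bounded_closed inf_le2)
  then show ?thesis using that \<rho> by blast
qed

text \<open>Near \<open>xs\<close>, the map \<open>\<Psi> z = (I - Q) (z - xs) + \<Theta> z\<close> straightens \<open>M\<close> to the subspace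
  \<open>ker Q\<close>, and its derivative at \<open>xs\<close> is the identity.\<close>

lemma submanifold_straightening:
  fixes M :: "'a::euclidean_space set" and Q :: "'a \<Rightarrow>\<^sub>L 'a"
  assumes U: "open U" "xs \<in> U" "xs \<in> M"
    and \<Theta>: "\<And>z. z \<in> U \<Longrightarrow> (\<Theta> has_derivative blinfun_apply (B z)) (at z)"
    and C1: "C1_on U B" and Bx: "B xs = Q"
    and Q\<Theta>: "\<And>z. z \<in> U \<Longrightarrow> Q (\<Theta> z) = \<Theta> z" and QB: "\<And>z v. z \<in> U \<Longrightarrow> Q (B z v) = B z v"
    and QQ: "\<And>v. Q (Q v) = Q v"
    and MU: "M \<inter> U = {z \<in> U. \<Theta> z = 0}"
  obtains V \<rho> \<Psi> \<phi> and Ei :: "'a \<Rightarrow> 'a \<Rightarrow>\<^sub>L 'a" where "open V" "V \<subseteq> U" "xs \<in> V" "\<rho> > 0"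
    "C1_on V Ei" "Ei xs = id_blinfun"
    "\<And>z. z \<in> V \<Longrightarrow> \<Psi> z \<in> ball 0 \<rho> \<and> \<phi> (\<Psi> z) = z \<and> (z \<in> M \<longrightarrow> Q (\<Psi> z) = 0)"
    "\<And>y. y \<in> ball 0 \<rho> \<Longrightarrow> \<phi> y \<in> V \<and> (\<phi> has_derivative Ei (\<phi> y)) (at y) \<and> (Q y = 0 \<longrightarrow> \<phi> y \<in> M)"
    "\<Psi> xs = 0" "(\<Psi> has_derivative id) (at xs)"
    "\<And>z v. z \<in> V \<Longrightarrow> Q v = 0 \<Longrightarrow> B z (Ei z v) = 0"
    "\<And>z v. z \<in> V \<Longrightarrow> B z v = 0 \<Longrightarrow> (\<exists>w. Q w = 0 \<and> Ei z w = v)"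
proof -
  define \<Psi> where "\<Psi> = (\<lambda>z. (id_blinfun - Q) (z - xs) + \<Theta> z)"
  define E where "E = (\<lambda>z. (id_blinfun - Q) + B z)"
  have \<Theta>xs: "\<Theta> xs = 0" using U MU by blast
  have \<Psi>xs: "\<Psi> xs = 0" by (simp add: \<Psi>_def \<Theta>xs)
  have Exs: "E xs = id_blinfun" by (simp add: E_def Bx)
  have Q\<Psi>: "Q (\<Psi> z) = \<Theta> z" if "z \<in> U" for z
    using Q\<Theta>[OF that] by (simp add: \<Psi>_def blinfun.bilinear_simps QQ)
  have QE: "Q (E z v) = B z v" if "z \<in> U" for z v
    using QB[OF that] by (simp add: E_def blinfun.bilinear_simps QQ)
  have d\<Psi>: "(\<Psi> has_derivative blinfun_apply (E z)) (at z)" if "z \<in> U" for z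
    unfolding \<Psi>_def E_def
    by (rule derivative_eq_intros \<Theta>[OF that] refl)+ (auto simp: blinfun.bilinear_simps)
  have C1E: "C1_on U E" unfolding E_def by (intro C1_on_add C1_on_const C1)
  have invE: "id_blinfun o\<^sub>L E xs = id_blinfun" by (rule blinfun_eqI) (simp add: Exs)
  obtain U' V' \<phi> \<phi>' where ift: "open U'" "U' \<subseteq> U" "xs \<in> U'" "open V'" "\<Psi> xs \<in> V'" "homeomorphism U' V' \<Psi> \<phi>"
    and d\<phi>: "\<And>y. y \<in> V' \<Longrightarrow> (\<phi> has_derivative (\<phi>' y)) (at y)"
    and \<phi>': "\<And>y. y \<in> V' \<Longrightarrow> \<phi>' y = inv (blinfun_apply (E (\<phi> y)))"
    and bij: "\<And>y. y \<in> V' \<Longrightarrow> bij (blinfun_apply (E (\<phi> y)))"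
  proof (rule inverse_function_theorem[OF U(1) d\<Psi> C1_on_continuous[OF C1E] U(2) invE], goal_cases)
    case (2 U' V' \<phi> \<phi>')
    from 2(2-) show ?case by (rule that)
  qed
  have hom: "\<And>z. z \<in> U' \<Longrightarrow> \<Psi> z \<in> V' \<and> \<phi> (\<Psi> z) = z" "\<And>y. y \<in> V' \<Longrightarrow> \<phi> y \<in> U' \<and> \<Psi> (\<phi> y) = y"
    using ift(6) unfolding homeomorphism_def by blast+
  have "\<forall>z\<in>U'. \<exists>L'. E z o\<^sub>L L' = id_blinfun \<and> L' o\<^sub>L E z = id_blinfun \<and> blinfun_apply L' = inv (blinfun_apply (E z))"
  proof
    fix z assume "z \<in> U'"
    then have "bij (blinfun_apply (E z))" using bij[of "\<Psi> z"] hom by simp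
    then show "\<exists>L'. E z o\<^sub>L L' = id_blinfun \<and> L' o\<^sub>L E z = id_blinfun \<and> blinfun_apply L' = inv (blinfun_apply (E z))"
      by (rule blinfun_inverse_exists) blast
  qed
  then obtain Ei where Ei: "\<And>z. z \<in> U' \<Longrightarrow> E z o\<^sub>L Ei z = id_blinfun" "\<And>z. z \<in> U' \<Longrightarrow> Ei z o\<^sub>L E z = id_blinfun"
    "\<And>z. z \<in> U' \<Longrightarrow> blinfun_apply (Ei z) = inv (blinfun_apply (E z))"
    by metis
  have C1Ei: "C1_on U' Ei" by (rule C1_on_inverse[OF C1_on_subset[OF C1E ift(2)] ift(1) Ei(1,2)])
  \<comment> \<open>Cutting the chart back to a ball in straightened coordinates keeps segments from
    the origin inside its range; these segments become curves in \<open>M\<close>.\<close>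
  obtain \<rho> where \<rho>: "\<rho> > 0" "ball 0 \<rho> \<subseteq> V'" using ift(4,5) \<Psi>xs open_contains_ball by metis
  define V where "V = U' \<inter> \<Psi> -` ball 0 \<rho>"
  have "continuous_on U' \<Psi>" using ift(6) by (simp add: homeomorphism_def)
  then have oV: "open V" unfolding V_def using ift(1) by (intro continuous_open_preimage) auto
  have VU: "V \<subseteq> U'" "V \<subseteq> U" using ift(2) by (auto simp: V_def)
  show ?thesis
  proof (rule that[of V \<rho> Ei \<Psi> \<phi>])
    show "C1_on V Ei" using C1Ei VU(1) by (rule C1_on_subset)
    show "Ei xs = id_blinfun"
    proof (rule blinfun_eqI)
      fix v show "Ei xs v = id_blinfun v"
        using arg_cong[OF Ei(1)[OF ift(3)], of "\<lambda>L. blinfun_apply L v"] by (simp add: Exs)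
    qed
    show "\<Psi> z \<in> ball 0 \<rho> \<and> \<phi> (\<Psi> z) = z \<and> (z \<in> M \<longrightarrow> Q (\<Psi> z) = 0)" if "z \<in> V" for z
    proof -
      have "z \<in> U" using that VU by blast
      then have "z \<in> M \<longrightarrow> Q (\<Psi> z) = 0" using Q\<Psi> MU by auto
      then show ?thesis using that hom(1) by (simp add: V_def)
    qed
    show "\<phi> y \<in> V \<and> (\<phi> has_derivative Ei (\<phi> y)) (at y) \<and> (Q y = 0 \<longrightarrow> \<phi> y \<in> M)" if y: "y \<in> ball 0 \<rho>" for y
    proof -
      have y': "y \<in> V'" using y \<rho> by blast
      have 1: "\<phi> y \<in> V" using hom(2)[OF y'] y by (simp add: V_def)
      have 2: "(\<phi> has_derivative Ei (\<phi> y)) (at y)"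
        using d\<phi>[OF y'] \<phi>'[OF y'] Ei(3) hom(2)[OF y'] by simp
      have "\<phi> y \<in> M" if "Q y = 0"
      proof -
        have "\<phi> y \<in> U" using 1 VU by blast
        then have "\<Theta> (\<phi> y) = 0" using Q\<Psi>[of "\<phi> y"] hom(2)[OF y'] that by simp
        then show ?thesis using MU \<open>\<phi> y \<in> U\<close> by blast
      qed
      then show ?thesis using 1 2 by blast
    qed
    show "(\<Psi> has_derivative id) (at xs)" using d\<Psi>[OF U(2)] by (simp add: Exs id_def id_blinfun.rep_eq)
    show "B z (Ei z v) = 0" if "z \<in> V" "Q v = 0" for z v
    proof -
      have z: "z \<in> U'" "z \<in> U" using that VU by auto
      have "B z (Ei z v) = Q (E z (Ei z v))" using QE z by simp
      also have "E z (Ei z v) = v" using Ei(1)[OF z(1)]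
        by (metis blinfun_apply_blinfun_compose blinfun_apply_id_blinfun)
      finally show ?thesis using that by simp
    qed
    show "\<exists>w. Q w = 0 \<and> Ei z w = v" if "z \<in> V" "B z v = 0" for z v
    proof (intro exI conjI)
      have z: "z \<in> U'" "z \<in> U" using that VU by auto
      show "Q (E z v) = 0" using QE z that by simp
      show "Ei z (E z v) = v" using Ei(2)[OF z(1)]
        by (metis blinfun_apply_blinfun_compose blinfun_apply_id_blinfun)
    qed
  qed (use oV VU \<rho> \<Psi>xs ift(3) in \<open>auto simp: V_def\<close>)
qed

text \<open>A substitute for a geodesic from \<open>xs\<close> to \<open>x\<close>, directly
  available from a chart: a C1 curve in \<open>M\<close> with nearly the constant velocity of the
  chord.\<close>

definition near_segment :: "'a::euclidean_space set \<Rightarrow> 'a \<Rightarrow> real \<Rightarrow> 'a \<Rightarrow> bool" where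
  "near_segment M xs C x \<longleftrightarrow> (\<exists>c c'. c 0 = xs \<and> c 1 = x \<and> continuous_on {0..1} c' \<and>
     (\<forall>t\<in>{0..1}. c t \<in> M \<and> (c has_vector_derivative c' t) (at t) \<and> c' t \<in> tangent_space M (c t) \<and>
        norm (c' t - (x - xs)) \<le> C * (norm (x - xs))\<^sup>2))"

lemma near_segment_mono:
  assumes "near_segment M xs C x" "C \<le> C'"
  shows "near_segment M xs C' x"
proof -
  have "C * (norm (x - xs))\<^sup>2 \<le> C' * (norm (x - xs))\<^sup>2" using assms(2) by (simp add: mult_right_mono)
  then have le: "a \<le> C * (norm (x - xs))\<^sup>2 \<Longrightarrow> a \<le> C' * (norm (x - xs))\<^sup>2" for a by linarith
  obtain c c' where c: "c 0 = xs" "c 1 = x" "continuous_on {0..1} c'"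
    "\<And>t. t \<in> {0..1} \<Longrightarrow> c t \<in> M \<and> (c has_vector_derivative c' t) (at t) \<and> c' t \<in> tangent_space M (c t) \<and>
        norm (c' t - (x - xs)) \<le> C * (norm (x - xs))\<^sup>2"
    using assms(1) unfolding near_segment_def by blast
  then show ?thesis unfolding near_segment_def using le by (intro exI[of _ c] exI[of _ c']) blast
qed

text \<open>Once tangent spaces are identified with the kernels of \<open>B\<close>, the kernel
  projection becomes the tangential one. The near segments are chart images of the straight segment
  from 0 to \<open>\<Psi> x\<close>.\<close>

lemma submanifold_local_structure:
  fixes M :: "'a::euclidean_space set"
  assumes "submanifold_around M xs"
  obtains V and P :: "'a \<Rightarrow> 'a \<Rightarrow>\<^sub>L 'a" and C \<delta> where "open V" "xs \<in> V" "C1_on V P"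
    "\<And>p. p \<in> M \<inter> V \<Longrightarrow> subspace (tangent_space M p)"
    "\<And>p w. p \<in> M \<inter> V \<Longrightarrow> P p w \<in> tangent_space M p"
    "\<And>p w s. p \<in> M \<inter> V \<Longrightarrow> s \<in> tangent_space M p \<Longrightarrow> (w - P p w) \<bullet> s = 0"
    "\<And>p. p \<in> M \<inter> V \<Longrightarrow> tangent_proj M p = blinfun_apply (P p)"
    "C > 0" "\<delta> > 0"
    "\<And>x. x \<in> M \<Longrightarrow> norm (x - xs) < \<delta> \<Longrightarrow> near_segment M xs C x"
proof -
  obtain Q :: "'a \<Rightarrow>\<^sub>L 'a" and U \<Theta> B where U: "open U" "xs \<in> U" "xs \<in> M"
    and \<Theta>: "\<And>z. z \<in> U \<Longrightarrow> (\<Theta> has_derivative blinfun_apply (B z)) (at z)"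
    and C1: "C1_on U B" and Bx: "B xs = Q"
    and Q\<Theta>: "\<And>z. z \<in> U \<Longrightarrow> Q (\<Theta> z) = \<Theta> z" and QB: "\<And>z v. z \<in> U \<Longrightarrow> Q (B z v) = B z v"
    and QQ: "\<And>v. Q (Q v) = Q v" and Qs: "\<And>v w. Q v \<bullet> w = v \<bullet> Q w"
    and MU: "M \<inter> U = {z \<in> U. \<Theta> z = 0}"
  proof (rule submanifold_normal_form[OF assms], goal_cases)
    case (1 Q U \<Theta> B)
    from 1(2-) show ?case by (rule that)
  qed
  obtain V1 and P :: "'a \<Rightarrow> 'a \<Rightarrow>\<^sub>L 'a" where V1: "open V1" "V1 \<subseteq> U" "xs \<in> V1" "C1_on V1 P"
    and P: "\<And>z w. z \<in> V1 \<Longrightarrow> B z (P z w) = 0"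
      "\<And>z w s. z \<in> V1 \<Longrightarrow> B z s = 0 \<Longrightarrow> (w - P z w) \<bullet> s = 0"
  proof (rule C1_kernel_projection[OF U(1,2) C1 Bx QB QQ Qs], goal_cases)
    case (2 V1 P)
    from 2(2-) show ?case by (rule that)
  qed
  have r: "\<And>z. z \<in> V1 \<Longrightarrow> (\<Theta> has_derivative blinfun_apply (B z)) (at z)"
    "C1_on V1 B" "\<And>z. z \<in> V1 \<Longrightarrow> Q (\<Theta> z) = \<Theta> z" "\<And>z v. z \<in> V1 \<Longrightarrow> Q (B z v) = B z v"
    "M \<inter> V1 = {z \<in> V1. \<Theta> z = 0}"
    using \<Theta> C1_on_subset[OF C1 V1(2)] Q\<Theta> QB MU V1(2) by blast+
  obtain V \<rho> \<Psi> \<phi> and Ei :: "'a \<Rightarrow> 'a \<Rightarrow>\<^sub>L 'a" where V: "open V" "V \<subseteq> V1" "xs \<in> V" "\<rho> > 0"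
    and Ei: "C1_on V Ei" "Ei xs = id_blinfun"
    and \<Psi>: "\<And>z. z \<in> V \<Longrightarrow> \<Psi> z \<in> ball 0 \<rho> \<and> \<phi> (\<Psi> z) = z \<and> (z \<in> M \<longrightarrow> Q (\<Psi> z) = 0)"
    and \<phi>: "\<And>y. y \<in> ball 0 \<rho> \<Longrightarrow> \<phi> y \<in> V \<and> (\<phi> has_derivative Ei (\<phi> y)) (at y) \<and> (Q y = 0 \<longrightarrow> \<phi> y \<in> M)"
    and \<Psi>0: "\<Psi> xs = 0" "(\<Psi> has_derivative id) (at xs)"
    and BE: "\<And>z v. z \<in> V \<Longrightarrow> Q v = 0 \<Longrightarrow> B z (Ei z v) = 0"
      "\<And>z v. z \<in> V \<Longrightarrow> B z v = 0 \<Longrightarrow> (\<exists>w. Q w = 0 \<and> Ei z w = v)"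
  proof (rule submanifold_straightening[OF V1(1,3) U(3) r(1,2) Bx r(3,4) QQ r(5)], goal_cases)
    case (4 V \<rho> \<Psi> \<phi> Ei)
    from 4(2-) show ?case by (rule that)
  qed
  have line: "((\<lambda>t. \<phi> (y + t *\<^sub>R w)) has_vector_derivative Ei (\<phi> (y + t *\<^sub>R w)) w) (at t)"
    if "y + t *\<^sub>R w \<in> ball 0 \<rho>" for y w t
  proof -
    have "((\<lambda>t. y + t *\<^sub>R w) has_derivative (\<lambda>h. h *\<^sub>R w)) (at t)"
      by (auto intro!: derivative_eq_intros)
    from diff_chain_at[OF this, of \<phi> "Ei (\<phi> (y + t *\<^sub>R w))"] \<phi>[OF that]
    show ?thesis by (simp add: has_vector_derivative_def comp_def blinfun.bilinear_simps)
  qed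
  have line_cont: "continuous_on S (\<lambda>t. Ei (\<phi> (y + t *\<^sub>R w)) w)"
    if "\<And>t. t \<in> S \<Longrightarrow> y + t *\<^sub>R w \<in> ball 0 \<rho>" for S and y w :: 'a
  proof -
    have "continuous_on S (\<lambda>t. \<phi> (y + t *\<^sub>R w))"
      by (rule continuous_at_imp_continuous_on) (use line[OF that] has_vector_derivative_continuous in blast)
    then have "continuous_on S (\<lambda>t. Ei (\<phi> (y + t *\<^sub>R w)))"
      by (rule continuous_on_compose2[OF C1_on_continuous[OF Ei(1)]]) (use \<phi> that in blast)
    then show ?thesis by (intro continuous_intros)
  qed
  have tangent: "tangent_space M p = {v. B p v = 0}" if p: "p \<in> M \<inter> V" for p
  proof (intro equalityI subsetI)
    fix v assume "v \<in> tangent_space M p"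
    then show "v \<in> {v. B p v = 0}"
      using tangent_space_normal_form[OF V1(1) r(1) r(5), of p v] p V(2) by auto
  next
    fix v assume "v \<in> {v. B p v = 0}"
    then obtain w where w: "Q w = 0" "Ei p w = v" using BE(2) p by blast
    \<comment> \<open>A line in direction \<open>w\<close> of \<open>ker Q\<close> stays in the
      straightened image of \<open>M\<close>; the chart carries it to a curve with initial velocity
      \<open>Ei p w = v\<close>.\<close>
    define c where "c = (\<lambda>t. \<phi> (\<Psi> p + t *\<^sub>R w))"
    have "open ((\<lambda>t. \<Psi> p + t *\<^sub>R w) -` ball 0 \<rho>)"
      by (intro open_vimage continuous_intros) auto
    moreover have "0 \<in> (\<lambda>t. \<Psi> p + t *\<^sub>R w) -` ball 0 \<rho>" using \<Psi> p by auto
    ultimately obtain e where "e > 0" and sub: "ball 0 e \<subseteq> (\<lambda>t. \<Psi> p + t *\<^sub>R w) -` ball 0 \<rho>"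
      using open_contains_ball by (metis (no_types))
    then have e: "e > 0" "\<And>t. t \<in> {-e<..<e} \<Longrightarrow> \<Psi> p + t *\<^sub>R w \<in> ball 0 \<rho>"
      by (auto simp: dist_real_def subset_iff)
    have "curve_in M p v c"
      unfolding curve_in_def
    proof (intro conjI exI[of _ e])
      show c0: "c 0 = p" using \<Psi> p by (simp add: c_def)
      show "(c has_vector_derivative v) (at 0)"
        using line[of "\<Psi> p" 0 w] e(2)[of 0] e(1) c0 w(2) by (simp add: c_def)
      show "c C1_differentiable_on {-e<..<e}"
        unfolding C1_differentiable_on_def c_def
        by (intro exI[of _ "\<lambda>t. Ei (\<phi> (\<Psi> p + t *\<^sub>R w)) w"] conjI ballI line line_cont e(2))
      show "c ` {-e<..<e} \<subseteq> M"
      proof clarify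
        fix t assume t: "t \<in> {-e<..<e}"
        have "Q (\<Psi> p + t *\<^sub>R w) = 0" using \<Psi> p w(1) by (simp add: blinfun.bilinear_simps)
        then show "c t \<in> M" using \<phi>[OF e(2)[OF t]] by (simp add: c_def)
      qed
    qed (use e in auto)
    then show "v \<in> tangent_space M p" by (auto simp: tangent_space_def)
  qed
  have tsub: "subspace (tangent_space M p)" if "p \<in> M \<inter> V" for p
    unfolding tangent[OF that]
    by (rule linear_subspace_kernel) (use blinfun.bounded_linear_right bounded_linear.linear in blast)
  have Pin: "P p w \<in> tangent_space M p" if "p \<in> M \<inter> V" for p w
    unfolding tangent[OF that] using P(1) that V(2) by blast
  have Porth: "(w - P p w) \<bullet> s = 0" if "p \<in> M \<inter> V" "s \<in> tangent_space M p" for p w s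
    using that P(2) V(2) tangent[OF that(1)] by blast
  have proj: "tangent_proj M p = blinfun_apply (P p)" if "p \<in> M \<inter> V" for p
    unfolding tangent_proj_def
    using closest_point_subspace[OF tsub[OF that] Pin[OF that] Porth[OF that]] by auto

  obtain E' where "(Ei has_derivative E') (at xs)" using Ei(1) V(3) unfolding C1_on_def by blast
  then obtain C1 d1 where C1: "C1 > 0" "d1 > 0" "\<And>z. norm (z - xs) < d1 \<Longrightarrow> norm (Ei z - Ei xs) \<le> C1 * norm (z - xs)"
    using has_derivative_imp_lipschitz_at by blast
  have \<phi>0: "\<phi> 0 = xs" using \<Psi>[OF V(3)] \<Psi>0 by simp
  obtain C2 d2 where C2: "C2 > 0" "d2 > 0" "\<And>y. norm y < d2 \<Longrightarrow> norm (\<phi> y - xs) \<le> C2 * norm y"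
    using has_derivative_imp_lipschitz_at[of \<phi> "Ei xs" 0] \<phi>[of 0] V(4) \<phi>0 by (auto simp: dist_norm)
  obtain C3 d3 where C3: "C3 > 0" "d3 > 0" "\<And>z. norm (z - xs) < d3 \<Longrightarrow> norm (\<Psi> z) \<le> C3 * norm (z - xs)"
    using has_derivative_imp_lipschitz_at[OF \<Psi>0(2)] \<Psi>0(1) by auto
  obtain d4 where d4: "d4 > 0" "ball xs d4 \<subseteq> V" using V open_contains_ball by blast
  \<comment> \<open>If the norm of \<open>\<xi>\<close> is below \<open>m\<close>, the segment from
    0 to \<open>\<xi>\<close> stays in the chart's range and in the Lipschitz range of
    \<open>\<phi>\<close>, and its image stays in the Lipschitz range of \<open>Ei\<close>.\<close>
  define m where "m = min (min d2 \<rho>) (d1 / C2)"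
  have m: "m > 0" using C1 C2 V(4) by (simp add: m_def)
  define \<delta> where "\<delta> = min (min d3 d4) (m / C3)"
  have \<delta>: "\<delta> > 0" using C3 d4 m by (simp add: \<delta>_def)
  have "near_segment M xs (2 * C1 * C2 * C3\<^sup>2) x"
    if x: "x \<in> M" "norm (x - xs) < \<delta>" for x
  proof -
    have xV: "x \<in> V" using x(2) d4 by (auto simp: \<delta>_def dist_norm norm_minus_commute)
    define \<xi> where "\<xi> = \<Psi> x"
    have \<xi>: "norm \<xi> \<le> C3 * norm (x - xs)" "Q \<xi> = 0" "\<phi> \<xi> = x"
      using C3 x \<Psi>[OF xV] by (auto simp: \<xi>_def \<delta>_def)
    have "C3 * norm (x - xs) < m" using x(2) C3(1) by (simp add: \<delta>_def field_simps)
    then have \<xi>m: "norm \<xi> < m" using \<xi> by linarith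
    have tn: "norm (t *\<^sub>R \<xi>) \<le> norm \<xi>" if "t \<in> {0..1}" for t
      using that by (simp add: mult_left_le_one_le)
    have tb: "0 + t *\<^sub>R \<xi> \<in> ball 0 \<rho>" if "t \<in> {0..1}" for t
      using tn[OF that] \<xi>m by (simp add: m_def)
    define c where "c = (\<lambda>t. \<phi> (0 + t *\<^sub>R \<xi>))"
    define c' where "c' = (\<lambda>t. Ei (\<phi> (0 + t *\<^sub>R \<xi>)) \<xi>)"
    have der: "(c has_vector_derivative c' t) (at t)" if "t \<in> {0..1}" for t
      unfolding c_def c'_def by (rule line[OF tb[OF that]])
    have cV: "c t \<in> M \<inter> V" if "t \<in> {0..1}" for t
      using \<phi>[OF tb[OF that]] \<xi>(2) by (simp add: c_def blinfun.bilinear_simps)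
    have c'\<xi>: "norm (c' t - \<xi>) \<le> C1 * C2 * (norm \<xi>)\<^sup>2" if t: "t \<in> {0..1}" for t
    proof -
      have "norm (t *\<^sub>R \<xi>) < d2" using tn[OF t] \<xi>m by (simp add: m_def)
      from C2(3)[OF this] have 1: "norm (c t - xs) \<le> C2 * norm \<xi>"
        using order_trans[OF _ mult_left_mono[OF tn[OF t], of C2]] C2(1) by (simp add: c_def del: norm_scaleR)
      moreover have "C2 * norm \<xi> < d1" using \<xi>m C2(1) by (simp add: m_def field_simps)
      ultimately have 2: "norm (Ei (c t) - Ei xs) \<le> C1 * norm (c t - xs)" using C1(3) by simp
      have "norm (c' t - \<xi>) = norm ((Ei (c t) - Ei xs) \<xi>)"
        by (simp add: c'_def c_def Ei(2) blinfun.bilinear_simps)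
      also have "\<dots> \<le> norm (Ei (c t) - Ei xs) * norm \<xi>" by (rule norm_blinfun)
      also have "\<dots> \<le> (C1 * (C2 * norm \<xi>)) * norm \<xi>"
        using order_trans[OF 2 mult_left_mono[OF 1, of C1]] C1(1) by (intro mult_right_mono) auto
      finally show ?thesis by (simp add: power2_eq_square algebra_simps)
    qed
    \<comment> \<open>The velocity is close to \<open>\<xi>\<close>, not yet to the chord. Its
      deviation bound at the endpoint shows that the chord is equally close to \<open>\<xi>\<close>;
      the exchange costs the factor 2 in the constant.\<close>
    have e\<xi>: "norm ((x - xs) - \<xi>) \<le> C1 * C2 * (norm \<xi>)\<^sup>2"
      using vector_derivative_deviation_bound[of c c' \<xi> _ 1, OF der c'\<xi>] \<xi>(3) \<phi>0 by (simp add: c_def)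
    have bound: "norm (c' t - (x - xs)) \<le> (2 * C1 * C2 * C3\<^sup>2) * (norm (x - xs))\<^sup>2" if t: "t \<in> {0..1}" for t
    proof -
      have "norm (c' t - (x - xs)) \<le> norm (c' t - \<xi>) + norm ((x - xs) - \<xi>)"
        using norm_triangle_ineq4[of "c' t - \<xi>" "(x - xs) - \<xi>"] by simp
      also have "\<dots> \<le> 2 * (C1 * C2) * (norm \<xi>)\<^sup>2" using c'\<xi>[OF t] e\<xi> by simp
      also have "\<dots> \<le> 2 * (C1 * C2) * (C3 * norm (x - xs))\<^sup>2"
        using C1 C2 \<xi>(1) by (intro mult_left_mono power_mono) auto
      finally show ?thesis by (simp add: power_mult_distrib algebra_simps)
    qed
    have "c' t \<in> tangent_space M (c t)" if "t \<in> {0..1}" for t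
      unfolding tangent[OF cV[OF that]] using BE(1)[OF _ \<xi>(2)] cV[OF that] by (simp add: c_def c'_def)
    moreover have "continuous_on {0..1} c'" unfolding c'_def by (rule line_cont) (rule tb)
    moreover have "c 0 = xs" "c 1 = x" using \<phi>0 \<xi>(3) by (simp_all add: c_def)
    ultimately show ?thesis unfolding near_segment_def
      using cV der bound by (intro exI[of _ c] exI[of _ c']) blast
  qed
  moreover have "2 * C1 * C2 * C3\<^sup>2 > 0" using C1 C2 C3 by simp
  moreover have "C1_on V P" using V1(4) V(2) by (rule C1_on_subset)
  ultimately show ?thesis using that[of V P "2 * C1 * C2 * C3\<^sup>2" \<delta>] V(1,3) tsub Pin Porth proj \<delta> by blast
qed

section \<open>Ambient extensions of gradient and Hessian, and Taylor expansions at a critical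
  point\<close>

section \<open>Gradient and Hessian in a local model\<close>

text \<open>\<open>h\<close> and \<open>G\<close> extend the restriction of \<open>F\<close> and its
  gradient to an ambient ball, so that ambient derivatives exist; only their values and tangential
  derivatives on \<open>M\<close> carry Riemannian meaning.\<close>

locale local_model =
  fixes M :: "'a::euclidean_space set" and F :: "'a \<Rightarrow> ereal" and xs :: 'a
    and P :: "'a \<Rightarrow> 'a \<Rightarrow>\<^sub>L 'a" and h :: "'a \<Rightarrow> real" and h' :: "'a \<Rightarrow> 'a \<Rightarrow> real"
    and G :: "'a \<Rightarrow> 'a" and G' :: "'a \<Rightarrow> 'a \<Rightarrow>\<^sub>L 'a" and A \<delta> :: real
  assumes A: "1 \<le> A" and \<delta>: "0 < \<delta>" and xs: "xs \<in> M"
    and subspace_tangent: "\<And>x. x \<in> M \<Longrightarrow> norm (x - xs) < \<delta> \<Longrightarrow> subspace (tangent_space M x)"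
    and P_in: "\<And>x w. x \<in> M \<Longrightarrow> norm (x - xs) < \<delta> \<Longrightarrow> P x w \<in> tangent_space M x"
    and P_orth: "\<And>x w s. x \<in> M \<Longrightarrow> norm (x - xs) < \<delta> \<Longrightarrow> s \<in> tangent_space M x \<Longrightarrow> (w - P x w) \<bullet> s = 0"
    and proj_eq: "\<And>x. x \<in> M \<Longrightarrow> norm (x - xs) < \<delta> \<Longrightarrow> tangent_proj M x = blinfun_apply (P x)"
    and P_lip: "\<And>x. norm (x - xs) < \<delta> \<Longrightarrow> norm (P x - P xs) \<le> A * norm (x - xs)"
    and P_bound: "\<And>x. norm (x - xs) < \<delta> \<Longrightarrow> norm (P x) \<le> A"
    and F_eq: "\<And>x. x \<in> M \<Longrightarrow> norm (x - xs) < \<delta> \<Longrightarrow> F x = ereal (h x)"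
    and h_deriv: "\<And>x. norm (x - xs) < \<delta> \<Longrightarrow> (h has_derivative h' x) (at x)"
    and h'_eq: "\<And>x v. x \<in> M \<Longrightarrow> norm (x - xs) < \<delta> \<Longrightarrow> v \<in> tangent_space M x \<Longrightarrow> h' x v = G x \<bullet> v"
    and grad_eq: "\<And>x. x \<in> M \<Longrightarrow> norm (x - xs) < \<delta> \<Longrightarrow> riem_grad M F x = G x"
    and G_in: "\<And>x. x \<in> M \<Longrightarrow> norm (x - xs) < \<delta> \<Longrightarrow> G x \<in> tangent_space M x"
    and G_deriv: "\<And>x. norm (x - xs) < \<delta> \<Longrightarrow> (G has_derivative G' x) (at x)"
    and G'_bound: "\<And>x. norm (x - xs) < \<delta> \<Longrightarrow> norm (G' x) \<le> A"
    and G_lip: "\<And>x. norm (x - xs) < \<delta> \<Longrightarrow> norm (G x - G xs) \<le> A * norm (x - xs)"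
    and hess_eq: "\<And>x v. x \<in> M \<Longrightarrow> norm (x - xs) < \<delta> \<Longrightarrow> v \<in> tangent_space M x \<Longrightarrow> riem_hess M F x v = P x (G' x v)"
    and curve: "\<And>x. x \<in> M \<Longrightarrow> norm (x - xs) < \<delta> \<Longrightarrow> near_segment M xs A x"

lemma (in local_model) P_id:
  assumes "x \<in> M" "norm (x - xs) < \<delta>" "v \<in> tangent_space M x"
  shows "P x v = v"
proof -
  have "v - P x v \<in> tangent_space M x"
    using assms P_in subspace_tangent subspace_diff by blast
  then show ?thesis using P_orth[OF assms(1,2)] by (metis inner_eq_zero_iff right_minus_eq)
qed

text \<open>The extension of the gradient is \<open>G p = P p (u p)\<close>, the projected ambient
  gradient of \<open>h\<close>. Both factors are C1, so the Hessian is obtained by differentiating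
  \<open>G\<close> and projecting again.\<close>

lemma local_model_exists:
  fixes M :: "'a::euclidean_space set"
  assumes sub: "submanifold_around M xs" and C2: "C2_restricted_near M F xs"
  shows "\<exists>P h h' G G' A \<delta>. local_model M F xs P h h' G G' A \<delta>"
proof -
  obtain V and P :: "'a \<Rightarrow> 'a \<Rightarrow>\<^sub>L 'a" and C \<delta>1 where V: "open V" "xs \<in> V" "C1_on V P"
    and tsub: "\<And>p. p \<in> M \<inter> V \<Longrightarrow> subspace (tangent_space M p)"
    and Pin: "\<And>p w. p \<in> M \<inter> V \<Longrightarrow> P p w \<in> tangent_space M p"
    and Porth: "\<And>p w s. p \<in> M \<inter> V \<Longrightarrow> s \<in> tangent_space M p \<Longrightarrow> (w - P p w) \<bullet> s = 0"
    and proj: "\<And>p. p \<in> M \<inter> V \<Longrightarrow> tangent_proj M p = blinfun_apply (P p)"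
    and C: "C > 0" "\<delta>1 > 0"
    and curves: "\<And>x. x \<in> M \<Longrightarrow> norm (x - xs) < \<delta>1 \<Longrightarrow> near_segment M xs C x"
  proof (rule submanifold_local_structure[OF sub], goal_cases)
    case (1 V P C \<delta>)
    from 1(2-) show ?case by (rule that)
  qed
  have xsM: "xs \<in> M" using sub by (simp add: submanifold_around_def)
  obtain U h where U: "open U" "xs \<in> U" "C2_on U h" and Fh: "\<And>z. z \<in> M \<inter> U \<Longrightarrow> F z = ereal (h z)"
    using C2 unfolding C2_restricted_near_def by blast
  obtain Dh where Dh: "\<And>x. x \<in> U \<Longrightarrow> (h has_derivative blinfun_apply (Dh x)) (at x)" "C1_on U Dh"
    using U(3) unfolding C2_on_def by (metis (no_types))
  define u where "u = (\<lambda>p. blinfun_apply (Blinfun (adjoint (blinfun_apply (Dh p)))) 1)"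
  have u: "u p \<bullet> v = Dh p v" for p v by (simp add: u_def blinfun_adjoint)
  define W where "W = V \<inter> U"
  have W: "open W" "xs \<in> W" using U(1,2) V(1,2) unfolding W_def by blast+
  define G where "G = (\<lambda>p. P p (u p))"
  have "C1_on U u" unfolding u_def
    by (intro C1_on_bilinear[OF blinfun.bounded_bilinear_axioms] C1_on_const
        C1_on_linear[OF bounded_linear_adjoint_blinfun Dh(2)])
  then have "C1_on W u" "C1_on W P"
    using C1_on_subset[of U u W] C1_on_subset[OF V(3), of W] by (auto simp: W_def)
  then have C1G: "C1_on W G"
    using C1_on_bilinear[OF blinfun.bounded_bilinear_axioms, of W P u] by (simp add: G_def)
  obtain G' C2 \<delta>2 where 2: "C2 > 0" "\<delta>2 > 0" "ball xs \<delta>2 \<subseteq> W"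
    "\<And>y. y \<in> ball xs \<delta>2 \<Longrightarrow> (G has_derivative blinfun_apply (G' y)) (at y)"
    "\<And>y. y \<in> ball xs \<delta>2 \<Longrightarrow> norm (G' y) \<le> C2"
    "\<And>y z. y \<in> ball xs \<delta>2 \<Longrightarrow> z \<in> ball xs \<delta>2 \<Longrightarrow> norm (G y - G z) \<le> C2 * norm (y - z)"
  proof (rule C1_on_local_bounds[OF C1G W], goal_cases)
    case (1 C \<delta> h')
    from 1(2-) show ?case by (rule that)
  qed
  obtain P' C3 \<delta>3 where 3: "C3 > 0" "\<delta>3 > 0" "ball xs \<delta>3 \<subseteq> V"
    "\<And>y. y \<in> ball xs \<delta>3 \<Longrightarrow> (P has_derivative blinfun_apply (P' y)) (at y)"
    "\<And>y. y \<in> ball xs \<delta>3 \<Longrightarrow> norm (P' y) \<le> C3"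
    "\<And>y z. y \<in> ball xs \<delta>3 \<Longrightarrow> z \<in> ball xs \<delta>3 \<Longrightarrow> norm (P y - P z) \<le> C3 * norm (y - z)"
  proof (rule C1_on_local_bounds[OF V(3,1,2)], goal_cases)
    case (1 C \<delta> h')
    from 1(2-) show ?case by (rule that)
  qed
  have Gv: "G p \<bullet> v = Dh p v" if p: "p \<in> M \<inter> V" "v \<in> tangent_space M p" for p v
    using Porth[OF p, of "u p"] u[of p v] by (simp add: G_def inner_diff_left)
  have grad: "riem_grad M F p = G p" if p: "p \<in> M \<inter> W" for p
    unfolding riem_grad_def
  proof (rule the_equality)
    have pV: "p \<in> M \<inter> V" using p by (simp add: W_def)
    have md: "mfd_deriv M (\<lambda>z. real_of_ereal (F z)) p v = G p \<bullet> v" if v: "v \<in> tangent_space M p" for v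
      unfolding Gv[OF pV v]
      by (rule mfd_deriv_eqI[OF v U(1)]) (use p Fh Dh(1) in \<open>auto simp: W_def\<close>)
    have Gin: "G p \<in> tangent_space M p" using Pin pV by (simp add: G_def)
    show "G p \<in> tangent_space M p \<and> (\<forall>v\<in>tangent_space M p. mfd_deriv M (\<lambda>z. real_of_ereal (F z)) p v = G p \<bullet> v)"
      using md Gin by blast
    fix w assume w: "w \<in> tangent_space M p \<and> (\<forall>v\<in>tangent_space M p. mfd_deriv M (\<lambda>z. real_of_ereal (F z)) p v = w \<bullet> v)"
    then have "w - G p \<in> tangent_space M p" using Gin tsub[OF pV] subspace_diff by blast
    then have "(w - G p) \<bullet> (w - G p) = 0" using w md by (simp add: inner_diff_left)
    then show "w = G p" by simp
  qed
  have hess: "riem_hess M F p v = P p (G' p v)" if p: "p \<in> M" "p \<in> ball xs \<delta>2" "v \<in> tangent_space M p" for p v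
  proof -
    have pW: "p \<in> M \<inter> W" using p 2(3) by blast
    have "mfd_deriv M (riem_grad M F) p v = G' p v"
      by (rule mfd_deriv_eqI[OF p(3) W(1)]) (use pW grad 2(4) p in auto)
    then show ?thesis using proj pW by (simp add: riem_hess_def W_def)
  qed
  define \<delta> where "\<delta> = min (min \<delta>1 \<delta>2) (min \<delta>3 1)"
  have \<delta>: "\<delta> > 0" using C 2 3 by (simp add: \<delta>_def)
  have in2: "x \<in> ball xs \<delta>2" and in3: "x \<in> ball xs \<delta>3" and in1: "norm (x - xs) < \<delta>1" and le1: "norm (x - xs) < 1"
    if "norm (x - xs) < \<delta>" for x
    using that by (auto simp: \<delta>_def dist_norm norm_minus_commute)
  define A where "A = 1 + C + C2 + C3 + norm (P xs)"
  have A: "1 \<le> A" "C \<le> A" "C2 \<le> A" "C3 \<le> A" "norm (P xs) + C3 \<le> A"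
    using C 2 3 by (auto simp: A_def)
  have inW: "x \<in> W" "x \<in> V" "x \<in> U" if "norm (x - xs) < \<delta>" for x
    using in2[OF that] 2(3) by (auto simp: W_def)
  have mono: "a \<le> b * norm w \<Longrightarrow> b \<le> A \<Longrightarrow> a \<le> A * norm w" for a b and w :: 'a
    by (meson mult_right_mono norm_ge_zero order_trans)
  have "local_model M F xs P h (\<lambda>x. Dh x) G G' A \<delta>"
  proof
    fix x assume x: "norm (x - xs) < \<delta>"
    show Pl: "norm (P x - P xs) \<le> A * norm (x - xs)"
      using mono[OF 3(6)[OF in3[OF x]] A(4)] 3(2) by simp
    show "norm (P x) \<le> A"
    proof -
      have "norm (P x - P xs) \<le> C3 * norm (x - xs)" using 3(6)[OF in3[OF x]] 3(2) by simp
      also have "\<dots> \<le> C3" using le1[OF x] 3(1) by (simp add: mult_left_le)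
      finally show ?thesis using A(5) norm_triangle_sub[of "P x" "P xs"] by linarith
    qed
    show "(h has_derivative blinfun_apply (Dh x)) (at x)" using Dh(1) inW[OF x] by blast
    show "(G has_derivative blinfun_apply (G' x)) (at x)" using 2(4)[OF in2[OF x]] .
    show "norm (G' x) \<le> A" using 2(5)[OF in2[OF x]] A(3) by linarith
    show "norm (G x - G xs) \<le> A * norm (x - xs)"
      using mono[OF 2(6)[OF in2[OF x]] A(3)] 2(2) by simp
  next
    fix x assume x: "x \<in> M" "norm (x - xs) < \<delta>"
    have xV: "x \<in> M \<inter> V" using x inW by blast
    show "subspace (tangent_space M x)" using tsub xV .
    show "P x w \<in> tangent_space M x" for w using Pin xV .
    show "tangent_proj M x = blinfun_apply (P x)" using proj xV .
    show "F x = ereal (h x)" using Fh x inW by blast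
    show "riem_grad M F x = G x" using grad x inW by blast
    show "G x \<in> tangent_space M x" using Pin xV by (simp add: G_def)
    show "near_segment M xs A x" using near_segment_mono[OF curves[OF x(1) in1[OF x(2)]] A(2)] .
    fix v assume v: "v \<in> tangent_space M x"
    show "(w - P x w) \<bullet> v = 0" for w using Porth[OF xV v] .
    show "Dh x v = G x \<bullet> v" using Gv[OF xV v] by simp
    show "riem_hess M F x v = P x (G' x v)" using hess x(1) in2[OF x(2)] v by blast
  qed (use A \<delta> xsM in auto)
  then show ?thesis by blast
qed

text \<open>Uniformity in \<open>x\<close> comes from a C2 extension of the retraction around
  \<open>(xs, 0)\<close>: its derivative is Lipschitz there, and along the ray in direction
  \<open>d\<close> it starts with velocity \<open>d\<close>.\<close>

lemma second_order_retraction_expansion: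
  fixes M :: "'a::euclidean_space set"
  assumes R: "second_order_retraction M R" and xs: "xs \<in> M"
    and sub: "\<And>x. x \<in> M \<Longrightarrow> norm (x - xs) < \<delta> \<Longrightarrow> subspace (tangent_space M x)" and \<delta>: "\<delta> > 0"
  obtains \<rho> C where "\<rho> > 0" "C > 0"
    "\<And>x d. x \<in> M \<Longrightarrow> d \<in> tangent_space M x \<Longrightarrow> norm (x - xs) < \<rho> \<Longrightarrow> norm d < \<rho> \<Longrightarrow>
       R x d \<in> M \<and> norm (R x d - x - d) \<le> C * (norm d)\<^sup>2"
proof -
  have RM: "\<And>x v. x \<in> M \<Longrightarrow> v \<in> tangent_space M x \<Longrightarrow> R x v \<in> M"
    and ext: "\<And>p. p \<in> tangent_bundle M \<Longrightarrow> \<exists>U G. open U \<and> p \<in> U \<and> C2_on U G \<and>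
        (\<forall>(x, v) \<in> tangent_bundle M \<inter> U. R x v = G (x, v))"
    and R0: "\<And>x. x \<in> M \<Longrightarrow> R x 0 = x"
    and DR0: "\<And>x. x \<in> M \<Longrightarrow> (R x has_derivative (\<lambda>v. v)) (at 0 within tangent_space M x)"
    using R unfolding second_order_retraction_def tangent_bundle_def by auto
  have "(xs, 0) \<in> tangent_bundle M"
    using sub[OF xs] xs \<delta> subspace_0 by (auto simp: tangent_bundle_def)
  then obtain U and G :: "'a \<times> 'a \<Rightarrow> 'a" where U: "open U" "(xs, 0) \<in> U" "C2_on U G"
    and RG: "\<And>x v. x \<in> M \<Longrightarrow> v \<in> tangent_space M x \<Longrightarrow> (x, v) \<in> U \<Longrightarrow> R x v = G (x, v)"
    using ext[of "(xs, 0)"] by (force simp: tangent_bundle_def)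
  obtain G' where G': "\<And>z. z \<in> U \<Longrightarrow> (G has_derivative blinfun_apply (G' z)) (at z)" "C1_on U G'"
    using U(3) unfolding C2_on_def by (metis (no_types))
  obtain G'' C r where C: "C > 0" "r > 0" "ball (xs, 0) r \<subseteq> U"
    "\<And>y. y \<in> ball (xs, 0) r \<Longrightarrow> (G' has_derivative blinfun_apply (G'' y)) (at y)"
    "\<And>y. y \<in> ball (xs, 0) r \<Longrightarrow> norm (G'' y) \<le> C"
    and lip: "\<And>y z. y \<in> ball (xs, 0) r \<Longrightarrow> z \<in> ball (xs, 0) r \<Longrightarrow> norm (G' y - G' z) \<le> C * norm (y - z)"
  proof (rule C1_on_local_bounds[OF G'(2) U(1,2)], goal_cases)
    case (1 C \<delta> h')
    from 1(2-) show ?case by (rule that)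
  qed
  define \<rho> where "\<rho> = min (r / 2) \<delta>"
  have \<rho>: "\<rho> > 0" using C \<delta> by (simp add: \<rho>_def)
  have inb: "(x, v) \<in> ball (xs, 0) r" if "norm (x - xs) < \<rho>" "norm v < \<rho>" for x v :: 'a
  proof -
    have "norm ((x - xs, v)) \<le> norm (x - xs) + norm v" by (rule norm_Pair_le)
    also have "\<dots> < r" using that by (simp add: \<rho>_def)
    finally show ?thesis by (simp add: dist_commute dist_norm)
  qed
  have line: "((\<lambda>t. G (x, t *\<^sub>R d)) has_vector_derivative G' (x, t *\<^sub>R d) (0, d)) (at t)"
    if "(x, t *\<^sub>R d) \<in> U" for x d t
  proof -
    have "((\<lambda>t. (x, t *\<^sub>R d)) has_derivative (\<lambda>h. (0, h *\<^sub>R d))) (at t)"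
      by (auto intro!: derivative_eq_intros)
    from diff_chain_at[OF this G'(1)[OF that]]
    have "((\<lambda>t. G (x, t *\<^sub>R d)) has_derivative (\<lambda>h. G' (x, t *\<^sub>R d) (0, h *\<^sub>R d))) (at t)"
      by (simp add: comp_def)
    moreover have "(0, h *\<^sub>R d) = h *\<^sub>R ((0, d) :: 'a \<times> 'a)" for h by simp
    ultimately show ?thesis by (simp only: has_vector_derivative_def blinfun.scaleR_right)
  qed
  have main: "R x d \<in> M \<and> norm (R x d - x - d) \<le> C * (norm d)\<^sup>2"
    if x: "x \<in> M" and d: "d \<in> tangent_space M x" and small: "norm (x - xs) < \<rho>" "norm d < \<rho>" for x d
  proof -
    have sT: "subspace (tangent_space M x)" using sub[OF x] small by (simp add: \<rho>_def)
    have td: "t *\<^sub>R d \<in> tangent_space M x" for t using sT d subspace_scale by blast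
    have inb': "(x, t *\<^sub>R d) \<in> ball (xs, 0) r" if "t \<in> {0..1}" for t
    proof (rule inb[OF small(1)])
      have "norm (t *\<^sub>R d) \<le> norm d" using that by (simp add: mult_left_le_one_le)
      then show "norm (t *\<^sub>R d) < \<rho>" using small(2) by linarith
    qed
    have inU: "(x, t *\<^sub>R d) \<in> U" if "t \<in> {0..1}" for t using inb'[OF that] C(3) by blast
    \<comment> \<open>The derivative of \<open>R x\<close> at 0 is prescribed only within the
      tangent space. The ray through \<open>d\<close> stays there, so the prescription passes to the
      extension in this one direction.\<close>
    have G0: "G' (x, 0) (0, d) = d"
    proof -
      have "((\<lambda>t. G (x, t *\<^sub>R d)) has_vector_derivative G' (x, 0) (0, d)) (at 0)"
        using line[of x 0 d] inU[of 0] by simp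
      moreover have "((\<lambda>t. G (x, t *\<^sub>R d)) has_vector_derivative d) (at 0)"
      proof -
        have 1: "((\<lambda>t. t *\<^sub>R d) has_derivative (\<lambda>h. h *\<^sub>R d)) (at (0::real) within UNIV)"
          by (auto intro!: derivative_eq_intros)
        have 2: "(R x has_derivative (\<lambda>v. v)) (at (0 *\<^sub>R d) within (\<lambda>t::real. t *\<^sub>R d) ` UNIV)"
          using has_derivative_subset[OF DR0[OF x]] td by (simp add: image_subset_iff)
        have 3: "((\<lambda>t. R x (t *\<^sub>R d)) has_derivative (\<lambda>h. h *\<^sub>R d)) (at 0)"
          using diff_chain_within[OF 1 2] by (simp add: comp_def)
        have "open ((\<lambda>t. (x, t *\<^sub>R d)) -` U)" using U(1) by (intro open_vimage continuous_intros)
        moreover have "(0::real) \<in> (\<lambda>t. (x, t *\<^sub>R d)) -` U" using inU[of 0] by simp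
        ultimately have "\<forall>\<^sub>F t in at 0. t \<in> (\<lambda>t. (x, t *\<^sub>R d)) -` U"
          by (rule eventually_at_in_open')
        then have ev: "\<forall>\<^sub>F t in at 0. R x (t *\<^sub>R d) = G (x, t *\<^sub>R d)"
          by eventually_elim (use RG[OF x td] in simp)
        have z: "R x (0 *\<^sub>R d) = G (x, 0 *\<^sub>R d)" using RG[OF x td[of 0]] inU[of 0] by simp
        show ?thesis
          using has_derivative_transform_eventually[OF 3 ev z] by (simp add: has_vector_derivative_def)
      qed
      ultimately show ?thesis by (rule vector_derivative_unique_at)
    qed
    have "norm (G (x, 1 *\<^sub>R d) - G (x, 0 *\<^sub>R d) - 1 *\<^sub>R d) \<le> C * (norm d)\<^sup>2"
    proof (rule vector_derivative_deviation_bound[where c' = "\<lambda>t. G' (x, t *\<^sub>R d) (0, d)"])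
      fix t :: real assume t: "t \<in> {0..1}"
      show "((\<lambda>t. G (x, t *\<^sub>R d)) has_vector_derivative G' (x, t *\<^sub>R d) (0, d)) (at t)"
        by (rule line[OF inU[OF t]])
      have "norm (G' (x, t *\<^sub>R d) (0, d) - d) = norm ((G' (x, t *\<^sub>R d) - G' (x, 0)) (0, d))"
        by (simp add: G0 blinfun.bilinear_simps)
      also have "\<dots> \<le> norm (G' (x, t *\<^sub>R d) - G' (x, 0)) * norm ((0, d) :: 'a \<times> 'a)" by (rule norm_blinfun)
      also have "\<dots> \<le> (C * norm d) * norm d"
      proof (rule mult_mono)
        have "norm (G' (x, t *\<^sub>R d) - G' (x, 0 *\<^sub>R d)) \<le> C * norm ((x, t *\<^sub>R d) - (x, 0 *\<^sub>R d))"
          by (rule lip) (use inb'[OF t] inb'[of 0] in auto)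
        also have "\<dots> = C * norm (t *\<^sub>R d)" by (simp add: norm_Pair)
        also have "\<dots> \<le> C * norm d" using t C(1) by (intro mult_left_mono) (auto simp: mult_left_le_one_le)
        finally show "norm (G' (x, t *\<^sub>R d) - G' (x, 0)) \<le> C * norm d" by simp
      qed (use C in \<open>auto simp: norm_Pair\<close>)
      finally show "norm (G' (x, t *\<^sub>R d) (0, d) - d) \<le> C * (norm d)\<^sup>2"
        by (simp add: power2_eq_square mult.assoc)
    qed auto
    moreover have "G (x, 0 *\<^sub>R d) = x" using RG[OF x td inU[of 0]] R0[OF x] by simp
    moreover have "G (x, 1 *\<^sub>R d) = R x d" using RG[OF x td inU[of 1]] by simp
    ultimately show ?thesis using RM[OF x d] by simp
  qed
  show ?thesis using that[OF \<rho> C(1) main] .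
qed

text \<open>By \<open>small\<close>, the quadratic deviation of a near segment is at most the length
  of its chord, which gives speed at most \<open>2 * norm (x - xs)\<close>.\<close>

locale newton_model = local_model +
  fixes \<mu> :: real
  assumes crit: "G xs = 0"
    and hess_lip: "\<And>x v. x \<in> M \<Longrightarrow> norm (x - xs) < \<delta> \<Longrightarrow>
      norm (riem_hess M F x (P x v) - riem_hess M F xs (P xs v)) \<le> A * norm (x - xs) * norm v"
    and small: "A * \<delta> \<le> 1"
    and \<mu>: "0 < \<mu>"
    and hess_pos: "\<And>v. v \<in> tangent_space M xs \<Longrightarrow> \<mu> * (norm v)\<^sup>2 \<le> riem_hess M F xs v \<bullet> v"
begin

text \<open>The projection extends the Hessian at \<open>xs\<close> to ambient vectors, since chords
  and steps taken at other points are not tangent at \<open>xs\<close>.\<close>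

definition H where "H v = riem_hess M F xs (P xs v)"

lemma H_eq: "H v = P xs (G' xs (P xs v))"
  using hess_eq[OF xs _ P_in[OF xs]] \<delta> by (simp add: H_def)

lemma H_diff: "H (v - w) = H v - H w" and H_add: "H (v + w) = H v + H w"
  and H_scale: "H (t *\<^sub>R v) = t *\<^sub>R H v"
  by (simp_all add: H_eq blinfun.bilinear_simps)

lemma norm_P: "norm (x - xs) < \<delta> \<Longrightarrow> norm (P x v) \<le> A * norm v"
  using norm_blinfun[of "P x" v] P_bound[of x] by (meson mult_right_mono norm_ge_zero order_trans)

lemma norm_G': "norm (x - xs) < \<delta> \<Longrightarrow> norm (G' x v) \<le> A * norm v"
  using norm_blinfun[of "G' x" v] G'_bound[of x] by (meson mult_right_mono norm_ge_zero order_trans)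

lemma P_diff: "norm (x - xs) < \<delta> \<Longrightarrow> norm (P x v - P xs v) \<le> A * norm (x - xs) * norm v"
  using norm_blinfun[of "P x - P xs" v] P_lip[of x]
  by (simp add: blinfun.bilinear_simps) (meson mult_right_mono norm_ge_zero order_trans)

lemma norm_H: "norm (H v) \<le> A ^ 3 * norm v"
proof -
  have x0: "norm (xs - xs) < \<delta>" using \<delta> by simp
  have "norm (H v) \<le> A * (A * (A * norm v))"
    unfolding H_eq
    by (rule order_trans[OF norm_P[OF x0]], rule mult_left_mono, rule order_trans[OF norm_G'[OF x0]], rule mult_left_mono[OF norm_P[OF x0]])
      (use A in auto)
  then show ?thesis by (simp add: power3_eq_cube)
qed

lemma hess_diff:
  assumes "x \<in> M" "norm (x - xs) < \<delta>" "v \<in> tangent_space M x"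
  shows "norm (riem_hess M F x v - H v) \<le> A * norm (x - xs) * norm v"
  using hess_lip[OF assms(1,2), of v] P_id[OF assms] by (simp add: H_def)

lemma norm_G: "norm (x - xs) < \<delta> \<Longrightarrow> norm (G x) \<le> A * norm (x - xs)"
  using G_lip[of x] crit by simp

lemma A_mult_le:
  assumes "norm (x - xs) < \<delta>"
  shows "A * (norm (x - xs))\<^sup>2 \<le> norm (x - xs)"
proof -
  have "A * norm (x - xs) \<le> 1"
    using mult_left_mono[of "norm (x - xs)" \<delta> A] assms A small by linarith
  then show ?thesis
    using mult_right_mono[of "A * norm (x - xs)" 1 "norm (x - xs)"] by (simp add: power2_eq_square)
qed

text \<open>The curve may reach twice the distance of its endpoint. This is why the radius is halved
  here, and again in \<open>value_expansion\<close>, where the gradient is expanded at every point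
  of the curve.\<close>

lemma short_curve:
  assumes x: "x \<in> M" "norm (x - xs) < \<delta> / 2"
  obtains c c' where "c 0 = xs" "c 1 = x" "continuous_on {0..1} c'"
    "\<And>t. t \<in> {0..1} \<Longrightarrow> c t \<in> M" "\<And>t. t \<in> {0..1} \<Longrightarrow> (c has_vector_derivative c' t) (at t)"
    "\<And>t. t \<in> {0..1} \<Longrightarrow> c' t \<in> tangent_space M (c t)"
    "\<And>t. t \<in> {0..1} \<Longrightarrow> norm (c' t - (x - xs)) \<le> A * (norm (x - xs))\<^sup>2"
    "\<And>t. t \<in> {0..1} \<Longrightarrow> norm (c' t) \<le> 2 * norm (x - xs)"
    "\<And>t. t \<in> {0..1} \<Longrightarrow> norm (c t - xs - t *\<^sub>R (x - xs)) \<le> A * (norm (x - xs))\<^sup>2"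
    "\<And>t. t \<in> {0..1} \<Longrightarrow> norm (c t - xs) \<le> 2 * norm (x - xs)"
proof -
  have x': "norm (x - xs) < \<delta>" using x \<delta> by linarith
  obtain c c' where c: "c 0 = xs" "c 1 = x" "continuous_on {0..1} c'"
    "\<And>t. t \<in> {0..1} \<Longrightarrow> c t \<in> M" "\<And>t. t \<in> {0..1} \<Longrightarrow> (c has_vector_derivative c' t) (at t)"
    "\<And>t. t \<in> {0..1} \<Longrightarrow> c' t \<in> tangent_space M (c t)"
    "\<And>t. t \<in> {0..1} \<Longrightarrow> norm (c' t - (x - xs)) \<le> A * (norm (x - xs))\<^sup>2"
    using curve[OF x(1) x'] unfolding near_segment_def by blast
  have 1: "norm (c' t) \<le> 2 * norm (x - xs)" if "t \<in> {0..1}" for t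
    using c(7)[OF that] A_mult_le[OF x'] norm_triangle_sub[of "c' t" "x - xs"] by linarith
  have 2: "norm (c t - xs - t *\<^sub>R (x - xs)) \<le> A * (norm (x - xs))\<^sup>2" if "t \<in> {0..1}" for t
    using vector_derivative_deviation_bound[OF c(5,7) that] c(1) by simp
  have 3: "norm (c t - xs) \<le> 2 * norm (x - xs)" if t: "t \<in> {0..1}" for t
  proof -
    have "norm (t *\<^sub>R (x - xs)) \<le> norm (x - xs)" using t by (simp add: mult_left_le_one_le)
    then show ?thesis
      using 2[OF t] A_mult_le[OF x'] norm_triangle_sub[of "c t - xs" "t *\<^sub>R (x - xs)"] by linarith
  qed
  show ?thesis using that[OF c 1 2 3] .
qed

text \<open>Along the near segment, the derivative of \<open>P xs (G (c t))\<close> is compared with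
  \<open>H (x - xs)\<close> in three moves: the projection at \<open>xs\<close> is exchanged for the
  one at \<open>c t\<close>, the Hessian at \<open>c t\<close> for the one at \<open>xs\<close>, and
  the velocity for the chord.\<close>

lemma gradient_expansion:
  assumes x: "x \<in> M" "norm (x - xs) < \<delta> / 2"
  shows "norm (G x - H (x - xs)) \<le> 10 * A ^ 4 * (norm (x - xs))\<^sup>2"
proof -
  define n where "n = norm (x - xs)"
  have x': "norm (x - xs) < \<delta>" using x \<delta> by linarith
  obtain c c' where c: "c 0 = xs" "c 1 = x"
    "\<And>t. t \<in> {0..1} \<Longrightarrow> c t \<in> M" "\<And>t. t \<in> {0..1} \<Longrightarrow> (c has_vector_derivative c' t) (at t)"
    "\<And>t. t \<in> {0..1} \<Longrightarrow> c' t \<in> tangent_space M (c t)"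
    "\<And>t. t \<in> {0..1} \<Longrightarrow> norm (c' t - (x - xs)) \<le> A * n\<^sup>2"
    "\<And>t. t \<in> {0..1} \<Longrightarrow> norm (c' t) \<le> 2 * n"
    "\<And>t. t \<in> {0..1} \<Longrightarrow> norm (c t - xs) \<le> 2 * n"
  proof (rule short_curve[OF x], goal_cases)
    case (1 c c')
    show ?case by (rule that[of c c']) (use 1(2-) in \<open>simp_all add: n_def\<close>)
  qed
  have c\<delta>: "norm (c t - xs) < \<delta>" if "t \<in> {0..1}" for t
    using c(8)[OF that] x(2) by (simp add: n_def)
  have n0: "0 \<le> n" by (simp add: n_def)
  have powers: "A \<le> A ^ 4" "A ^ 2 \<le> A ^ 4"
    using power_increasing[of 1 4 A] power_increasing[of 2 4 A] A by simp_all
  have "norm (P xs (G (c 1)) - P xs (G (c 0)) - 1 *\<^sub>R H (x - xs)) \<le> 9 * A ^ 4 * n\<^sup>2"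
  proof (rule vector_derivative_deviation_bound[where c = "\<lambda>t. P xs (G (c t))" and c' = "\<lambda>t. P xs (G' (c t) (c' t))"])
    fix t :: real assume t: "t \<in> {0..1}"
    have "((G \<circ> c) has_derivative G' (c t) \<circ> (\<lambda>h. h *\<^sub>R c' t)) (at t)"
      by (rule diff_chain_at) (use c(4)[OF t] G_deriv[OF c\<delta>[OF t]] in \<open>auto simp: has_vector_derivative_def\<close>)
    then have "((\<lambda>t. P xs (G (c t))) has_derivative (\<lambda>h. P xs (G' (c t) (h *\<^sub>R c' t)))) (at t)"
      by (intro bounded_linear.has_derivative[OF blinfun.bounded_linear_right]) (simp add: comp_def)
    then show "((\<lambda>t. P xs (G (c t))) has_vector_derivative P xs (G' (c t) (c' t))) (at t)"
      by (simp add: has_vector_derivative_def blinfun.bilinear_simps)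
    let ?g = "G' (c t) (c' t)"
    have g: "norm ?g \<le> A * (2 * n)"
      using norm_G'[OF c\<delta>[OF t], of "c' t"] mult_left_mono[OF c(7)[OF t], of A] A by linarith
    have 1: "norm (P (c t) ?g - P xs ?g) \<le> (A * (2 * n)) * (A * (2 * n))"
      by (rule order_trans[OF P_diff[OF c\<delta>[OF t]]], intro mult_mono g c(8) t) (use A n0 in auto)
    have 2: "norm (P (c t) ?g - H (c' t)) \<le> (A * (2 * n)) * (2 * n)"
      using hess_diff[OF c(3)[OF t] c\<delta>[OF t] c(5)[OF t]]
      unfolding hess_eq[OF c(3)[OF t] c\<delta>[OF t] c(5)[OF t]]
      by (rule order_trans) (intro mult_mono c(7,8) t, use A n0 in auto)
    have 3: "norm (H (c' t) - H (x - xs)) \<le> A ^ 3 * (A * n\<^sup>2)"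
      unfolding H_diff[symmetric]
      by (rule order_trans[OF norm_H], intro mult_left_mono c(6) t) (use A in auto)
    have "norm (P xs ?g - H (x - xs)) \<le> norm (P (c t) ?g - P xs ?g) + norm (P (c t) ?g - H (c' t)) + norm (H (c' t) - H (x - xs))"
      using norm_triangle_ineq[of "P xs ?g - P (c t) ?g" "P (c t) ?g - H (c' t)"]
        norm_triangle_ineq[of "P xs ?g - H (c' t)" "H (c' t) - H (x - xs)"] norm_minus_commute[of "P xs ?g" "P (c t) ?g"]
      by simp
    \<comment> \<open>The three moves contribute 4, 4 and 1, all raised to the power
      \<open>A ^ 4\<close>; the normal part of \<open>G x\<close> adds the tenth unit of the final
      constant.\<close>
    also have "\<dots> \<le> (4 * A ^ 2 + 4 * A + A ^ 4) * n\<^sup>2"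
      using 1 2 3 by (simp add: algebra_simps power2_eq_square eval_nat_numeral)
    also have "\<dots> \<le> (9 * A ^ 4) * n\<^sup>2"
      by (rule mult_right_mono) (use powers in auto)
    finally show "norm (P xs ?g - H (x - xs)) \<le> 9 * A ^ 4 * n\<^sup>2" .
  qed auto
  then have 4: "norm (P xs (G x) - H (x - xs)) \<le> 9 * A ^ 4 * n\<^sup>2" using c(1,2) crit by simp
  have "norm (G x - P xs (G x)) \<le> (A * n) * norm (G x)"
    using P_diff[OF x', of "G x"] P_id[OF x(1) x' G_in[OF x(1) x']] by (simp add: n_def)
  also have "\<dots> \<le> (A * n) * (A * n)"
    using norm_G[OF x'] A n0 unfolding n_def by (intro mult_left_mono) auto
  also have "\<dots> \<le> A ^ 4 * n\<^sup>2"
    using mult_right_mono[OF powers(2), of "n\<^sup>2"] by (simp add: power2_eq_square algebra_simps)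
  finally show ?thesis
    using 4 norm_triangle_ineq[of "G x - P xs (G x)" "P xs (G x) - H (x - xs)"] by (simp add: n_def)
qed

text \<open>The initial velocity of the near segment is tangent at \<open>xs\<close> and
  quadratically close to the chord; it cancels in the difference because \<open>P xs\<close> fixes
  it.\<close>

lemma tangential_displacement:
  assumes x: "x \<in> M" "norm (x - xs) < \<delta> / 2"
  shows "norm (x - xs - P xs (x - xs)) \<le> 2 * A\<^sup>2 * (norm (x - xs))\<^sup>2"
proof -
  obtain c c' :: "real \<Rightarrow> 'a" where c: "c 0 = xs" "c' 0 \<in> tangent_space M (c 0)" "norm (c' 0 - (x - xs)) \<le> A * (norm (x - xs))\<^sup>2"
  proof (rule short_curve[OF x], goal_cases)
    case (1 c c')
    show ?case by (rule that[of c c']) (use 1(2-) 1(7)[of 0] in simp_all)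
  qed
  have x0: "norm (xs - xs) < \<delta>" using \<delta> by simp
  let ?w = "x - xs - c' 0"
  have eq: "x - xs - P xs (x - xs) = ?w - P xs ?w"
    using P_id[OF xs x0] c(1,2) by (simp add: blinfun.bilinear_simps)
  have "norm (x - xs - P xs (x - xs)) \<le> norm ?w + A * norm ?w"
    unfolding eq by (rule order_trans[OF norm_triangle_ineq4 add_left_mono[OF norm_P[OF x0]]])
  also have "\<dots> = (1 + A) * norm (c' 0 - (x - xs))" by (simp add: algebra_simps norm_minus_commute)
  also have "\<dots> \<le> (1 + A) * (A * (norm (x - xs))\<^sup>2)" using c(3) A by (intro mult_left_mono) auto
  also have "\<dots> \<le> (2 * A) * (A * (norm (x - xs))\<^sup>2)" using A by (intro mult_right_mono) auto
  finally show ?thesis by (simp add: power2_eq_square)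
qed

text \<open>The deviation bound is applied to \<open>h (c t) - t\<^sup>2 / 2 * q\<close> with
  \<open>q\<close> the quadratic form at the chord. The gradient error at distance up to
  \<open>2 * n\<close> gives 40, replacing \<open>c t - xs\<close> by
  \<open>t *\<^sub>R (x - xs)\<close> gives 1; the speed doubles these 41, and the velocity error
  adds 1.\<close>

lemma value_expansion:
  assumes x: "x \<in> M" "norm (x - xs) < \<delta> / 4"
  shows "\<bar>h x - h xs - H (x - xs) \<bullet> (x - xs) / 2\<bar> \<le> 83 * A ^ 4 * (norm (x - xs)) ^ 3"
proof -
  define n where "n = norm (x - xs)"
  have x': "norm (x - xs) < \<delta> / 2" using x \<delta> by linarith
  obtain c c' where c: "c 0 = xs" "c 1 = x"
    "\<And>t. t \<in> {0..1} \<Longrightarrow> c t \<in> M" "\<And>t. t \<in> {0..1} \<Longrightarrow> (c has_vector_derivative c' t) (at t)"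
    "\<And>t. t \<in> {0..1} \<Longrightarrow> c' t \<in> tangent_space M (c t)"
    "\<And>t. t \<in> {0..1} \<Longrightarrow> norm (c' t - (x - xs)) \<le> A * n\<^sup>2"
    "\<And>t. t \<in> {0..1} \<Longrightarrow> norm (c' t) \<le> 2 * n"
    "\<And>t. t \<in> {0..1} \<Longrightarrow> norm (c t - xs - t *\<^sub>R (x - xs)) \<le> A * n\<^sup>2"
    "\<And>t. t \<in> {0..1} \<Longrightarrow> norm (c t - xs) \<le> 2 * n"
  proof (rule short_curve[OF x(1) x'], goal_cases)
    case (1 c c')
    show ?case by (rule that[of c c']) (use 1(2-) in \<open>simp_all add: n_def\<close>)
  qed
  have c\<delta>2: "norm (c t - xs) < \<delta> / 2" if "t \<in> {0..1}" for t
    using c(9)[OF that] x(2) by (simp add: n_def)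
  have c\<delta>: "norm (c t - xs) < \<delta>" if "t \<in> {0..1}" for t
    using c\<delta>2[OF that] \<delta> by linarith
  have n0: "0 \<le> n" by (simp add: n_def)
  let ?q = "H (x - xs) \<bullet> (x - xs)"
  have "norm ((h (c 1) - 1\<^sup>2 / 2 * ?q) - (h (c 0) - 0\<^sup>2 / 2 * ?q) - 1 *\<^sub>R 0) \<le> 83 * A ^ 4 * n ^ 3"
  proof (rule vector_derivative_deviation_bound[where c = "\<lambda>t. h (c t) - t\<^sup>2 / 2 * ?q" and c' = "\<lambda>t. G (c t) \<bullet> c' t - t * ?q"])
    fix t :: real assume t: "t \<in> {0..1}"
    have "((h \<circ> c) has_derivative h' (c t) \<circ> (\<lambda>h. h *\<^sub>R c' t)) (at t)"
      by (rule diff_chain_at) (use c(4)[OF t] h_deriv[OF c\<delta>[OF t]] in \<open>auto simp: has_vector_derivative_def\<close>)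
    moreover have "h' (c t) (s *\<^sub>R c' t) = s * (G (c t) \<bullet> c' t)" for s
      using linear_scale[OF has_derivative_linear[OF h_deriv[OF c\<delta>[OF t]]]] h'_eq[OF c(3)[OF t] c\<delta>[OF t] c(5)[OF t]]
      by simp
    ultimately have "((\<lambda>t. h (c t)) has_vector_derivative G (c t) \<bullet> c' t) (at t)"
      by (simp add: has_vector_derivative_def comp_def)
    moreover have "((\<lambda>t. t\<^sup>2 / 2 * ?q) has_vector_derivative t * ?q) (at t)"
      unfolding has_real_derivative_iff_has_vector_derivative[symmetric]
      by (auto intro!: derivative_eq_intros)
    ultimately show "((\<lambda>t. h (c t) - t\<^sup>2 / 2 * ?q) has_vector_derivative G (c t) \<bullet> c' t - t * ?q) (at t)"
      by (rule has_vector_derivative_diff)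
    have 1: "norm (G (c t) - H (c t - xs)) \<le> 10 * A ^ 4 * (2 * n)\<^sup>2"
      by (rule order_trans[OF gradient_expansion[OF c(3)[OF t] c\<delta>2[OF t]]], intro mult_left_mono power_mono c(9) t)
        (use A in auto)
    have 2: "norm (H (c t - xs) - t *\<^sub>R H (x - xs)) \<le> A ^ 3 * (A * n\<^sup>2)"
      unfolding H_scale[symmetric] H_diff[symmetric]
      by (rule order_trans[OF norm_H], intro mult_left_mono c(8) t) (use A in auto)
    have 3: "norm (G (c t) - t *\<^sub>R H (x - xs)) \<le> 41 * A ^ 4 * n\<^sup>2"
      using 1 2 norm_triangle_ineq[of "G (c t) - H (c t - xs)" "H (c t - xs) - t *\<^sub>R H (x - xs)"]
      by (simp add: power2_eq_square algebra_simps eval_nat_numeral)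
    have 4: "\<bar>(G (c t) - t *\<^sub>R H (x - xs)) \<bullet> c' t\<bar> \<le> (41 * A ^ 4 * n\<^sup>2) * (2 * n)"
      by (rule order_trans[OF Cauchy_Schwarz_ineq2], intro mult_mono 3 c(7) t) (use A in auto)
    have "norm (t *\<^sub>R H (x - xs)) \<le> norm (H (x - xs))" using t by (simp add: mult_left_le_one_le)
    then have "norm (t *\<^sub>R H (x - xs)) \<le> A ^ 3 * n" using norm_H[of "x - xs"] by (simp add: n_def)
    then have 5: "\<bar>(t *\<^sub>R H (x - xs)) \<bullet> (c' t - (x - xs))\<bar> \<le> (A ^ 3 * n) * (A * n\<^sup>2)"
      by (intro order_trans[OF Cauchy_Schwarz_ineq2] mult_mono c(6) t) (use A n0 in auto)
    have "G (c t) \<bullet> c' t - t * ?q = (G (c t) - t *\<^sub>R H (x - xs)) \<bullet> c' t + (t *\<^sub>R H (x - xs)) \<bullet> (c' t - (x - xs))"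
      by (simp add: algebra_simps)
    then have "\<bar>G (c t) \<bullet> c' t - t * ?q\<bar> \<le> (41 * A ^ 4 * n\<^sup>2) * (2 * n) + (A ^ 3 * n) * (A * n\<^sup>2)"
      using 4 5 by linarith
    also have "\<dots> = 83 * A ^ 4 * n ^ 3" by (simp add: algebra_simps eval_nat_numeral)
    finally show "norm (G (c t) \<bullet> c' t - t * ?q - 0) \<le> 83 * A ^ 4 * n ^ 3" by simp
  qed auto
  then show ?thesis using c(1,2) by (simp add: n_def)
qed

end

section \<open>Inexact Newton directions and acceptance of the unit step\<close>

section \<open>The Newton step\<close>

text \<open>Compactness of the unit sphere of the tangent space makes positivity uniform; if that
  sphere is empty, the tangent space is zero and any positive constant serves.\<close>

lemma (in local_model) riem_hess_pos_def_uniform: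
  assumes pos: "riem_hess_pos_def M F xs"
  obtains \<mu> where "\<mu> > 0" "\<And>v. v \<in> tangent_space M xs \<Longrightarrow> \<mu> * (norm v)\<^sup>2 \<le> riem_hess M F xs v \<bullet> v"
proof -
  define T where "T = tangent_space M xs"
  have x0: "norm (xs - xs) < \<delta>" using \<delta> by simp
  have sT: "subspace T" using subspace_tangent[OF xs x0] by (simp add: T_def)
  define q where "q = (\<lambda>v. P xs (G' xs v) \<bullet> v)"
  have q: "riem_hess M F xs v \<bullet> v = q v" if "v \<in> T" for v
    using hess_eq[OF xs x0] that by (simp add: q_def T_def)
  have q_scale: "q (t *\<^sub>R v) = t\<^sup>2 * q v" for t v
    by (simp add: q_def blinfun.bilinear_simps power2_eq_square)
  have "compact (T \<inter> sphere 0 1)" using closed_subspace[OF sT] by (intro closed_Int_compact) auto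
  moreover have "continuous_on (T \<inter> sphere 0 1) q" unfolding q_def by (intro continuous_intros)
  ultimately have "\<exists>\<mu>>0. \<forall>v\<in>T \<inter> sphere 0 1. \<mu> \<le> q v"
  proof (cases "T \<inter> sphere 0 1 = {}")
    case False
    assume "compact (T \<inter> sphere 0 1)" "continuous_on (T \<inter> sphere 0 1) q"
    then obtain w where w: "w \<in> T \<inter> sphere 0 1" "\<forall>v\<in>T \<inter> sphere 0 1. q w \<le> q v"
      using continuous_attains_inf False by blast
    then have "w \<noteq> 0" by auto
    then have "q w > 0" using pos q w(1) by (auto simp: riem_hess_pos_def_def T_def)
    then show ?thesis using w(2) by blast
  qed (auto intro: exI[of _ 1])
  then obtain \<mu> where \<mu>: "\<mu> > 0" "\<And>v. v \<in> T \<Longrightarrow> norm v = 1 \<Longrightarrow> \<mu> \<le> q v" by auto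
  have "\<mu> * (norm v)\<^sup>2 \<le> q v" if "v \<in> T" for v
  proof (cases "v = 0")
    case False
    have "\<mu> \<le> q ((1 / norm v) *\<^sub>R v)"
      by (rule \<mu>(2)) (use False that sT subspace_scale in auto)
    then show ?thesis using False by (simp add: q_scale field_simps power_divide)
  qed (simp add: q_def)
  then show ?thesis using that[OF \<mu>(1)] q by (simp add: T_def)
qed

lemma (in local_model) local_model_mono:
  assumes "A \<le> A'" "0 < \<delta>'" "\<delta>' \<le> \<delta>"
  shows "local_model M F xs P h h' G G' A' \<delta>'"
proof -
  have lt: "norm (x - xs) < \<delta>" if "norm (x - xs) < \<delta>'" for x using that assms by linarith
  have mono: "a \<le> A * b \<Longrightarrow> 0 \<le> b \<Longrightarrow> a \<le> A' * b" for a b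
    using mult_right_mono[OF assms(1), of b] by linarith
  show ?thesis
  proof
    fix x assume x: "x \<in> M" "norm (x - xs) < \<delta>'"
    show "near_segment M xs A' x" using near_segment_mono[OF curve[OF x(1) lt[OF x(2)]] assms(1)] .
  next
    fix x assume x: "norm (x - xs) < \<delta>'"
    show "norm (P x) \<le> A'" "norm (G' x) \<le> A'"
      using P_bound[OF lt[OF x]] G'_bound[OF lt[OF x]] assms(1) by linarith+
    show "norm (P x - P xs) \<le> A' * norm (x - xs)" "norm (G x - G xs) \<le> A' * norm (x - xs)"
      using mono P_lip[OF lt[OF x]] G_lip[OF lt[OF x]] by simp_all
  qed (use assms A xs lt subspace_tangent P_in P_orth proj_eq F_eq h_deriv h'_eq grad_eq G_in G_deriv hess_eq
      in auto)
qed

lemma (in local_model) newton_model_exists: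
  assumes crit: "G xs = 0" and pos: "riem_hess_pos_def M F xs" and lip: "riem_hess_loc_lipschitz M F xs"
  obtains A' \<delta>' \<mu> where "newton_model M F xs P h h' G G' A' \<delta>' \<mu>"
proof -
  obtain \<mu> where \<mu>: "\<mu> > 0" "\<And>v. v \<in> tangent_space M xs \<Longrightarrow> \<mu> * (norm v)\<^sup>2 \<le> riem_hess M F xs v \<bullet> v"
    using riem_hess_pos_def_uniform[OF pos] by blast
  obtain \<epsilon> K where \<epsilon>: "\<epsilon> > 0" and K: "\<And>x x' v. x \<in> M \<inter> ball xs \<epsilon> \<Longrightarrow> x' \<in> M \<inter> ball xs \<epsilon> \<Longrightarrow>
     norm (riem_hess M F x (tangent_proj M x v) - riem_hess M F x' (tangent_proj M x' v)) \<le> K * norm (x - x') * norm v"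
    using lip unfolding riem_hess_loc_lipschitz_def by blast
  define A' where "A' = max A K"
  define \<delta>' where "\<delta>' = min (min \<delta> \<epsilon>) (1 / A')"
  have A': "A \<le> A'" "K \<le> A'" "0 < A'" using A by (auto simp: A'_def)
  have \<delta>': "0 < \<delta>'" "\<delta>' \<le> \<delta>" using \<delta> \<epsilon> A' by (auto simp: \<delta>'_def)
  interpret m: local_model M F xs P h h' G G' A' \<delta>' by (rule local_model_mono[OF A'(1) \<delta>'])
  have "newton_model M F xs P h h' G G' A' \<delta>' \<mu>"
  proof
    fix x v assume x: "x \<in> M" "norm (x - xs) < \<delta>'"
    have "norm (riem_hess M F x (P x v) - riem_hess M F xs (P xs v)) \<le> K * norm (x - xs) * norm v"
      using K[of x xs v] x xs \<epsilon> m.proj_eq[OF x] m.proj_eq[OF xs] \<delta>'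
      by (simp add: \<delta>'_def dist_norm norm_minus_commute)
    also have "\<dots> \<le> A' * norm (x - xs) * norm v" using A' by (simp add: mult_right_mono)
    finally show "norm (riem_hess M F x (P x v) - riem_hess M F xs (P xs v)) \<le> A' * norm (x - xs) * norm v" .
  next
    have "\<delta>' \<le> 1 / A'" by (simp add: \<delta>'_def)
    then show "A' * \<delta>' \<le> 1" using A' by (simp add: field_simps)
  qed (use crit \<mu> in auto)
  then show ?thesis by (rule that)
qed

context newton_model
begin

text \<open>\<open>H\<close> factors through \<open>P xs\<close> and has tangent values, so
  positivity controls the tangential component alone; normal components of chords and steps are
  bounded separately.\<close>

lemma H_coercive:
  shows "\<mu> * norm (P xs v) \<le> norm (H v)" and "\<mu> * (norm (P xs v))\<^sup>2 \<le> H v \<bullet> v"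
proof -
  have x0: "norm (xs - xs) < \<delta>" using \<delta> by simp
  have 1: "\<mu> * (norm (P xs v))\<^sup>2 \<le> H v \<bullet> P xs v"
    using hess_pos[OF P_in[OF xs x0]] by (simp add: H_def)
  have "H v \<in> tangent_space M xs" unfolding H_eq by (rule P_in[OF xs x0])
  from P_orth[OF xs x0 this] have "H v \<bullet> P xs v = H v \<bullet> v"
    by (simp add: inner_diff_left inner_commute)
  then show "\<mu> * (norm (P xs v))\<^sup>2 \<le> H v \<bullet> v" using 1 by simp
  have "\<mu> * norm (P xs v) * norm (P xs v) \<le> norm (H v) * norm (P xs v)"
    using 1 norm_cauchy_schwarz[of "H v" "P xs v"] by (simp add: power2_eq_square mult.assoc)
  then show "\<mu> * norm (P xs v) \<le> norm (H v)"
    by (cases "norm (P xs v) = 0") (auto simp: mult_le_cancel_right)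
qed

text \<open>In the estimates below \<open>s\<close> stands for \<open>(norm (x - xs)) powr \<theta>\<close>, which dominates
  \<open>norm (x - xs)\<close>; this keeps real powers out of the computation.\<close>

lemma newton_direction:
  assumes x: "x \<in> M" "norm (x - xs) < \<delta> / 4" and d: "d \<in> tangent_space M x"
    and s: "norm (x - xs) \<le> s" and C: "0 \<le> C"
    and forcing: "\<eta> * norm (G x) \<le> C * s * norm (x - xs)"
    and residual: "norm (G x + riem_hess M F x d) \<le> \<eta> * norm (G x)"
    and tiny: "(1 / \<mu> + 1) * A * norm (x - xs) \<le> 1 / 2"
  shows "norm (d + (x - xs)) \<le> 2 * (1 / \<mu> + 1) * (C + 13 * A ^ 4) * s * norm (x - xs)"
proof -
  define n where "n = norm (x - xs)"
  have n0: "0 \<le> n" by (simp add: n_def)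
  have x2: "norm (x - xs) < \<delta> / 2" and x': "norm (x - xs) < \<delta>" using x \<delta> by linarith+
  have B1: "1 / \<mu> + 1 \<ge> 1" and B\<mu>: "1 / \<mu> > 0" using \<mu> by simp_all
  have powers: "A \<le> A ^ 4" "A ^ 2 \<le> A ^ 4"
    using power_increasing[of 1 4 A] power_increasing[of 2 4 A] A by simp_all
  have ns: "n\<^sup>2 \<le> s * n" using s n0 by (simp add: n_def power2_eq_square mult_right_mono)
  let ?e = "x - xs"
  \<comment> \<open>A common majorant: 12 is 10 from the gradient expansion plus 2 from the normal
    part of the chord. It becomes 13 when \<open>norm d\<close> is replaced by \<open>n\<close> plus
    an error.\<close>
  define r where "r = A * n * norm d + C * s * n + 12 * A ^ 4 * n\<^sup>2"
  have 1: "norm (H (d + ?e)) \<le> A * n * norm d + C * s * n + 10 * A ^ 4 * n\<^sup>2"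
  proof -
    have eq: "H (d + ?e) = (G x + riem_hess M F x d) - ((riem_hess M F x d - H d) + (G x - H ?e))"
      by (simp add: H_add)
    have "norm (H (d + ?e)) \<le> norm (G x + riem_hess M F x d) + (norm (riem_hess M F x d - H d) + norm (G x - H ?e))"
      unfolding eq by (rule order_trans[OF norm_triangle_ineq4 add_left_mono[OF norm_triangle_ineq]])
    then show ?thesis
      using residual forcing hess_diff[OF x(1) x' d] gradient_expansion[OF x(1) x2] by (simp add: n_def)
  qed
  have "norm (P xs (d + ?e)) \<le> (1 / \<mu>) * norm (H (d + ?e))"
    using H_coercive(1)[of "d + ?e"] \<mu> by (simp add: field_simps)
  then have 2: "norm (P xs (d + ?e)) \<le> (1 / \<mu>) * (A * n * norm d + C * s * n + 10 * A ^ 4 * n\<^sup>2)"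
    using mult_left_mono[OF 1, of "1 / \<mu>"] B\<mu> by linarith
  have 3: "norm (d - P xs d) \<le> A * n * norm d"
    using P_diff[OF x', of d] P_id[OF x(1) x' d] by (simp add: n_def)
  have 4: "norm (?e - P xs ?e) \<le> 2 * A ^ 4 * n\<^sup>2"
    using tangential_displacement[OF x(1) x2] mult_right_mono[OF powers(2), of "2 * n\<^sup>2"]
    by (simp add: n_def)
  have "0 \<le> s" using order_trans[OF norm_ge_zero s] .
  then have Cs: "0 \<le> C * s * n" using C n0 by simp
  \<comment> \<open>Coercivity reaches only the first summand. The other two are small because
    \<open>d\<close> is tangent at the nearby point \<open>x\<close>, and because chords of
    \<open>M\<close> are tangent to first order.\<close>
  have eq: "P xs (d + ?e) + ((d - P xs d) + (?e - P xs ?e)) = d + ?e" by (simp add: blinfun.bilinear_simps)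
  have "norm (d + ?e) \<le> norm (P xs (d + ?e)) + (norm (d - P xs d) + norm (?e - P xs ?e))"
    using order_trans[OF norm_triangle_ineq add_left_mono[OF norm_triangle_ineq],
        of "P xs (d + ?e)" "d - P xs d" "?e - P xs ?e"]
    unfolding eq .
  also have "\<dots> \<le> (1 / \<mu>) * r + r"
  proof -
    have "(1 / \<mu>) * (A * n * norm d + C * s * n + 10 * A ^ 4 * n\<^sup>2) \<le> (1 / \<mu>) * r"
      using B\<mu> by (intro mult_left_mono) (auto simp: r_def)
    moreover have "A * n * norm d + 2 * A ^ 4 * n\<^sup>2 \<le> r" using Cs by (simp add: r_def)
    ultimately show ?thesis using 2 3 4 by linarith
  qed
  also have "\<dots> = (1 / \<mu> + 1) * r" by (simp add: algebra_simps)
  finally have 5: "norm (d + ?e) \<le> (1 / \<mu> + 1) * r" .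
  \<comment> \<open>The bound on \<open>norm (d + ?e)\<close> contains \<open>norm d\<close>, hence
    itself again; \<open>tiny\<close> gives this occurrence weight at most 1/2, and absorbing it
    produces the factor 2 of the conclusion.\<close>
  have "norm d \<le> n + norm (d + ?e)"
    using norm_triangle_ineq4[of "d + ?e" ?e] by (simp add: n_def)
  then have 6: "A * n * norm d \<le> A * n * (n + norm (d + ?e))"
    using A n0 by (intro mult_left_mono) auto
  have "A * n\<^sup>2 \<le> A ^ 4 * n\<^sup>2" using powers(1) by (simp add: mult_right_mono)
  then have "r \<le> A * n * norm (d + ?e) + (C * s * n + 13 * A ^ 4 * n\<^sup>2)"
    using 6 by (simp add: r_def algebra_simps power2_eq_square)
  also have "\<dots> \<le> A * n * norm (d + ?e) + (C + 13 * A ^ 4) * (s * n)"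
    using mult_left_mono[OF ns, of "13 * A ^ 4"] A by (simp add: algebra_simps)
  finally have "norm (d + ?e) \<le> (1 / \<mu> + 1) * (A * n * norm (d + ?e) + (C + 13 * A ^ 4) * (s * n))"
    using 5 mult_left_mono[of r _ "1 / \<mu> + 1"] B1 by (meson order_trans zero_le_one)
  also have "\<dots> = ((1 / \<mu> + 1) * A * n) * norm (d + ?e) + (1 / \<mu> + 1) * (C + 13 * A ^ 4) * s * n"
    by (simp add: algebra_simps)
  also have "\<dots> \<le> (1 / 2) * norm (d + ?e) + (1 / \<mu> + 1) * (C + 13 * A ^ 4) * s * n"
    using mult_right_mono[OF tiny, of "norm (d + ?e)"] by (simp add: n_def)
  finally have "norm (d + ?e) \<le> 2 * ((1 / \<mu> + 1) * (C + 13 * A ^ 4) * s * n)" by linarith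
  then show ?thesis by (simp only: mult.assoc n_def)
qed

text \<open>With \<open>q\<close> the Hessian form at the chord, the model values are
  \<open>h x - h xs = q / 2\<close>, \<open>G x \<bullet> d = - q\<close> and
  \<open>h y - h xs = 0\<close>. The surplus \<open>(1 / 2 - m) * q\<close> is at least a multiple
  of \<open>n\<^sup>2\<close>, while all errors are multiples of \<open>s * n\<^sup>2\<close>; the
  second bound in \<open>tiny\<close> adds up their coefficients.\<close>

lemma armijo_unit_step:
  assumes x: "x \<in> M" "norm (x - xs) < \<delta> / 4" and y: "y \<in> M" "norm (y - xs) < \<delta> / 4"
    and s: "norm (x - xs) \<le> s" "s \<le> 1" and m: "0 < m" "m < 1 / 2"
    and de: "norm (d + (x - xs)) \<le> C5 * s * norm (x - xs)" and D: "norm d \<le> D * norm (x - xs)" "0 \<le> D"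
    and yb: "norm (y - xs) \<le> C6 * s * norm (x - xs)" "norm (y - xs) \<le> 1"
    and C: "0 \<le> C5" "0 \<le> C6"
    and tiny: "4 * A\<^sup>2 * norm (x - xs) \<le> 1"
      "(84 * A ^ 4 * C6\<^sup>2 + 83 * A ^ 4 + A ^ 3 * C5 + 10 * A ^ 4 * D) * s \<le> (1 / 2 - m) * \<mu> / 4"
  shows "h y \<le> h x + m * (G x \<bullet> d)"
proof -
  define n where "n = norm (x - xs)"
  have n0: "0 \<le> n" and s0: "0 \<le> s" and ns: "n \<le> s" using s order_trans[OF norm_ge_zero s(1)] by (auto simp: n_def)
  have x2: "norm (x - xs) < \<delta> / 2" using x \<delta> by linarith
  have A0: "0 \<le> A" using A by simp
  let ?e = "x - xs"
  let ?f = "y - xs"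
  define q where "q = H ?e \<bullet> ?e"
  have sq: "a * n ^ 3 \<le> a * (s * n\<^sup>2)" if "0 \<le> a" for a
    using that mult_right_mono[OF ns, of "n\<^sup>2"] by (intro mult_left_mono) (simp_all add: eval_nat_numeral)
  have hy: "h y - h xs \<le> 84 * A ^ 4 * C6\<^sup>2 * (s * n\<^sup>2)"
  proof -
    have "H ?f \<bullet> ?f \<le> (A ^ 3 * norm ?f) * norm ?f"
      by (rule order_trans[OF norm_cauchy_schwarz mult_right_mono[OF norm_H]]) simp
    also have "\<dots> \<le> A ^ 4 * (norm ?f)\<^sup>2"
      using mult_right_mono[OF power_increasing[of 3 4 A], of "(norm ?f)\<^sup>2"] A
      by (simp add: power2_eq_square mult.assoc)
    finally have "H ?f \<bullet> ?f \<le> A ^ 4 * (norm ?f)\<^sup>2" .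
    moreover have "0 \<le> A ^ 4 * (norm ?f)\<^sup>2" by simp
    ultimately have "H ?f \<bullet> ?f / 2 \<le> A ^ 4 * (norm ?f)\<^sup>2" by linarith
    moreover have "83 * A ^ 4 * (norm ?f) ^ 3 \<le> 83 * A ^ 4 * (norm ?f)\<^sup>2"
      using power_decreasing[of 2 3 "norm ?f"] yb(2) A by (intro mult_left_mono) auto
    ultimately have "h y - h xs \<le> 84 * A ^ 4 * (norm ?f)\<^sup>2"
      using value_expansion[OF y] by linarith
    also have "\<dots> \<le> 84 * A ^ 4 * (C6 * s * n)\<^sup>2"
      using yb(1) A by (intro mult_left_mono power_mono) (auto simp: n_def)
    also have "\<dots> = (84 * A ^ 4 * C6\<^sup>2) * (s\<^sup>2 * n\<^sup>2)" by (simp add: power_mult_distrib)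
    also have "\<dots> \<le> (84 * A ^ 4 * C6\<^sup>2) * (s * n\<^sup>2)"
      using s(2) s0 A by (intro mult_left_mono mult_right_mono) (auto simp: power2_eq_square mult_left_le)
    finally show ?thesis .
  qed
  have hx: "h x - h xs \<ge> q / 2 - 83 * A ^ 4 * (s * n\<^sup>2)"
  proof -
    have "83 * A ^ 4 * n ^ 3 \<le> 83 * A ^ 4 * (s * n\<^sup>2)" by (rule sq) (use A in simp)
    then show ?thesis using value_expansion[OF x] unfolding q_def n_def by linarith
  qed
  have gd: "G x \<bullet> d \<ge> - q - (A ^ 3 * C5 + 10 * A ^ 4 * D) * (s * n\<^sup>2)"
  proof -
    have "\<bar>H ?e \<bullet> (d + ?e)\<bar> \<le> (A ^ 3 * n) * (C5 * s * n)"
      by (rule order_trans[OF Cauchy_Schwarz_ineq2], rule mult_mono)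
        (use norm_H[of ?e] de A n0 in \<open>auto simp: n_def\<close>)
    then have 1: "\<bar>H ?e \<bullet> (d + ?e)\<bar> \<le> (A ^ 3 * C5) * (s * n\<^sup>2)" by (simp add: power2_eq_square algebra_simps)
    have "\<bar>(G x - H ?e) \<bullet> d\<bar> \<le> (10 * A ^ 4 * n\<^sup>2) * (D * n)"
      by (rule order_trans[OF Cauchy_Schwarz_ineq2], rule mult_mono)
        (use gradient_expansion[OF x(1) x2] D A in \<open>auto simp: n_def\<close>)
    also have "\<dots> = (10 * A ^ 4 * D) * n ^ 3" by (simp add: eval_nat_numeral)
    also have "\<dots> \<le> (10 * A ^ 4 * D) * (s * n\<^sup>2)" by (rule sq) (use D(2) A in simp)
    finally have 2: "\<bar>(G x - H ?e) \<bullet> d\<bar> \<le> (10 * A ^ 4 * D) * (s * n\<^sup>2)" .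
    have "G x \<bullet> d = - q + H ?e \<bullet> (d + ?e) + (G x - H ?e) \<bullet> d"
      by (simp add: q_def algebra_simps)
    then show ?thesis using 1 2 by (simp add: algebra_simps)
  qed
  \<comment> \<open>The normal part of the chord is at most \<open>n / 2\<close>, so at least half
    of the chord is seen by the coercivity estimate; squaring gives 1/4.\<close>
  have q: "q \<ge> \<mu> * n\<^sup>2 / 4"
  proof -
    have "2 * A\<^sup>2 * n\<^sup>2 \<le> n / 2"
      using mult_right_mono[OF tiny(1), of n] n0 by (simp add: n_def power2_eq_square)
    then have "norm (P xs ?e) \<ge> n / 2"
      using tangential_displacement[OF x(1) x2] norm_triangle_sub[of ?e "P xs ?e"] by (simp add: n_def)
    then have "(norm (P xs ?e))\<^sup>2 \<ge> (n / 2)\<^sup>2" using n0 by (intro power_mono) auto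
    then have "\<mu> * (norm (P xs ?e))\<^sup>2 \<ge> \<mu> * (n / 2)\<^sup>2" using \<mu> by simp
    then show ?thesis using H_coercive(2)[of ?e] by (simp add: q_def power_divide)
  qed
  define w where "w = s * n\<^sup>2"
  have w0: "0 \<le> w" using s0 by (simp add: w_def)
  have md: "m * (G x \<bullet> d) \<ge> - m * q - (A ^ 3 * C5 + 10 * A ^ 4 * D) * w"
  proof -
    have "m * (G x \<bullet> d) \<ge> m * (- q - (A ^ 3 * C5 + 10 * A ^ 4 * D) * w)"
      using gd m by (intro mult_left_mono) (auto simp: w_def)
    moreover have "m * ((A ^ 3 * C5 + 10 * A ^ 4 * D) * w) \<le> 1 * ((A ^ 3 * C5 + 10 * A ^ 4 * D) * w)"
      using m A C D w0 by (intro mult_right_mono) auto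
    ultimately show ?thesis by (simp add: algebra_simps)
  qed
  have "(84 * A ^ 4 * C6\<^sup>2 + 83 * A ^ 4 + A ^ 3 * C5 + 10 * A ^ 4 * D) * w \<le> (1 / 2 - m) * \<mu> / 4 * n\<^sup>2"
    using mult_right_mono[OF tiny(2), of "n\<^sup>2"] by (simp add: w_def mult.assoc)
  also have "\<dots> \<le> (1 / 2 - m) * q" using mult_left_mono[OF q, of "1 / 2 - m"] m by (simp add: algebra_simps)
  finally have "h y - h x \<le> m * (G x \<bullet> d)"
    using hy hx md unfolding w_def[symmetric] by (simp add: algebra_simps)
  then show ?thesis by simp
qed

lemma newton_step:
  assumes R: "second_order_retraction M R" and C: "0 \<le> C" and m: "0 < m" "m < 1 / 2"
  obtains s0 C6 where "0 < s0" "0 < C6"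
    "\<And>x d s \<eta>. x \<in> M \<Longrightarrow> norm (x - xs) \<le> s \<Longrightarrow> s \<le> s0 \<Longrightarrow> d \<in> tangent_space M x \<Longrightarrow>
       \<eta> * norm (G x) \<le> C * s * norm (x - xs) \<Longrightarrow>
       norm (G x + riem_hess M F x d) \<le> \<eta> * norm (G x) \<Longrightarrow>
       norm (x - xs) < \<delta> \<and> norm (R x d - xs) \<le> C6 * s * norm (x - xs) \<and> F (R x d) \<le> F x + ereal (m * (G x \<bullet> d))"
proof -
  obtain \<rho> CR where \<rho>: "\<rho> > 0" "CR > 0"
    and Rexp: "\<And>x d. x \<in> M \<Longrightarrow> d \<in> tangent_space M x \<Longrightarrow> norm (x - xs) < \<rho> \<Longrightarrow> norm d < \<rho> \<Longrightarrow>
       R x d \<in> M \<and> norm (R x d - x - d) \<le> CR * (norm d)\<^sup>2"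
    by (rule second_order_retraction_expansion[OF R xs subspace_tangent \<delta>]) blast+
  define B where "B = 1 / \<mu> + 1"
  define C5 where "C5 = 2 * B * (C + 13 * A ^ 4)"
  define D where "D = 1 + C5"
  \<comment> \<open>Error of the direction plus quadratic error of the retraction, using
    \<open>norm d \<le> D * n\<close>.\<close>
  define C6 where "C6 = C5 + CR * D\<^sup>2"
  define C8 where "C8 = 84 * A ^ 4 * C6\<^sup>2 + 83 * A ^ 4 + A ^ 3 * C5 + 10 * A ^ 4 * D"
  have B: "B > 0" using \<mu> by (simp add: B_def add_pos_pos)
  have A0: "A > 0" using A by simp
  have C5: "C5 > 0" using B C A0 by (simp add: C5_def add_nonneg_pos)
  have D: "D \<ge> 1" using C5 by (simp add: D_def)
  have C6: "C6 > 0" using C5 \<rho> by (simp add: C6_def add_pos_nonneg)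
  have C8: "C8 > 0" using A0 C5 C6 D unfolding C8_def by (intro add_pos_pos mult_pos_pos) auto
  \<comment> \<open>In order: \<open>s \<le> 1\<close>; absorption in
    \<open>newton_direction\<close>; the radius of the retraction; the radius
    \<open>\<delta> / 4\<close>, made strict; the new point no farther from \<open>xs\<close> than
    \<open>x\<close>; the two smallness conditions of \<open>armijo_unit_step\<close>.\<close>
  define S where "S = {1, 1 / (2 * B * A), \<rho> / (2 * D), \<delta> / 5, 1 / C6, 1 / (4 * A\<^sup>2), (1 / 2 - m) * \<mu> / (4 * C8)}"
  define s0 where "s0 = Min S"
  have fin: "finite S" "S \<noteq> {}" by (simp_all add: S_def)
  have "\<forall>a\<in>S. 0 < a"
    unfolding S_def using B A0 \<rho> D \<delta> C6 C8 m \<mu> by (auto intro!: divide_pos_pos mult_pos_pos)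
  then have "0 < s0" unfolding s0_def using fin by (simp add: Min_gr_iff)
  have s0_le: "s0 \<le> a" if "a \<in> S" for a unfolding s0_def using that fin by (simp add: Min_le)
  show ?thesis
  proof (rule that[OF \<open>0 < s0\<close> C6])
    fix x d s \<eta>
    assume x: "x \<in> M" "norm (x - xs) \<le> s" "s \<le> s0" and d: "d \<in> tangent_space M x"
      and f: "\<eta> * norm (G x) \<le> C * s * norm (x - xs)"
      and r: "norm (G x + riem_hess M F x d) \<le> \<eta> * norm (G x)"
    define n where "n = norm (x - xs)"
    have n: "0 \<le> n" "n \<le> s" using x by (auto simp: n_def)
    have s: "0 \<le> s" using n by linarith
    have sle: "s \<le> a" if "a \<in> S" for a using s0_le[OF that] x(3) by linarith
    have s1: "s \<le> 1" using sle by (simp add: S_def)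
    have sB: "B * A * n \<le> 1 / 2"
    proof -
      have "n \<le> 1 / (2 * B * A)" using sle[of "1 / (2 * B * A)"] n by (simp add: S_def)
      then show ?thesis using B A0 by (simp add: field_simps)
    qed
    have sD: "D * n < \<rho>"
    proof -
      have "n \<le> \<rho> / (2 * D)" using sle[of "\<rho> / (2 * D)"] n by (simp add: S_def)
      then have "D * n \<le> \<rho> / 2" using D by (simp add: field_simps)
      then show ?thesis using \<rho> by linarith
    qed
    have s\<delta>: "n < \<delta> / 4" using sle[of "\<delta> / 5"] n \<delta> by (simp add: S_def)
    have sC6: "C6 * s \<le> 1" using sle[of "1 / C6"] C6 by (simp add: S_def field_simps)
    have sA: "4 * A\<^sup>2 * n \<le> 1"
    proof -
      have "n \<le> 1 / (4 * A\<^sup>2)" using sle[of "1 / (4 * A\<^sup>2)"] n by (simp add: S_def)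
      then show ?thesis using A0 by (simp add: field_simps)
    qed
    have sC8: "C8 * s \<le> (1 / 2 - m) * \<mu> / 4"
      using sle[of "(1 / 2 - m) * \<mu> / (4 * C8)"] C8 by (simp add: S_def field_simps)
    have de: "norm (d + (x - xs)) \<le> C5 * s * norm (x - xs)"
      using newton_direction[OF x(1) _ d x(2) C f r] s\<delta> sB by (simp add: n_def B_def C5_def)
    have dD: "norm d \<le> D * n"
    proof -
      have "norm d \<le> norm (d + (x - xs)) + n"
        using norm_triangle_ineq4[of "d + (x - xs)" "x - xs"] by (simp add: n_def)
      moreover have "C5 * s * n \<le> C5 * 1 * n"
        using C5 s1 n by (intro mult_right_mono mult_left_mono) auto
      ultimately show ?thesis using de by (simp add: D_def n_def algebra_simps)
    qed
    have nD: "n \<le> D * n" using D n mult_right_mono[of 1 D n] by simp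
    have Rx: "R x d \<in> M" "norm (R x d - x - d) \<le> CR * (norm d)\<^sup>2"
      using Rexp[OF x(1) d] dD sD nD by (auto simp: n_def)
    have "(norm d)\<^sup>2 \<le> (D * n)\<^sup>2" using dD by (intro power_mono) auto
    also have "\<dots> \<le> D\<^sup>2 * (s * n)"
      using mult_left_mono[OF mult_right_mono[OF n(2,1)], of "D\<^sup>2"]
      by (simp add: power_mult_distrib) (simp add: power2_eq_square)
    finally have "CR * (norm d)\<^sup>2 \<le> CR * (D\<^sup>2 * (s * n))" using \<rho> by (intro mult_left_mono) auto
    moreover have "norm (R x d - xs) \<le> norm (R x d - x - d) + norm (d + (x - xs))"
      using norm_triangle_ineq[of "R x d - x - d" "d + (x - xs)"] by simp
    ultimately have yb: "norm (R x d - xs) \<le> C6 * s * norm (x - xs)"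
      using Rx(2) de by (simp add: C6_def n_def algebra_simps)
    then have yn: "norm (R x d - xs) \<le> n"
      using mult_right_mono[OF sC6, of n] n by (simp add: n_def)
    have "h (R x d) \<le> h x + m * (G x \<bullet> d)"
      by (rule armijo_unit_step[OF x(1) _ Rx(1) _ x(2) s1 m de _ _ yb])
        (use s\<delta> yn dD D n s1 C5 C6 sA sC8 in \<open>auto simp: n_def C8_def\<close>)
    moreover have "F x = ereal (h x)" "F (R x d) = ereal (h (R x d))"
      by (rule F_eq; use x(1) Rx(1) s\<delta> yn \<delta> in \<open>simp add: n_def\<close>)+
    ultimately show "norm (x - xs) < \<delta> \<and> norm (R x d - xs) \<le> C6 * s * norm (x - xs) \<and> F (R x d) \<le> F x + ereal (m * (G x \<bullet> d))"
      using yb s\<delta> \<delta> by (simp add: n_def)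
  qed
qed

end

section \<open>Proximal gradient steps, their subgradients and limits; comparison of
  distances\<close>

section \<open>Proximal steps\<close>

lemma has_derivative_nabla:
  fixes f :: "'a::euclidean_space \<Rightarrow> real"
  assumes "C2_on UNIV f"
  shows "(f has_derivative (\<lambda>v. nabla f x \<bullet> v)) (at x)"
proof -
  obtain f' where f': "(f has_derivative blinfun_apply (f' x)) (at x)"
    using assms unfolding C2_on_def by blast
  define D where "D = blinfun_apply (Blinfun (adjoint (blinfun_apply (f' x)))) 1"
  have "v \<bullet> D = f' x v" for v using blinfun_adjoint[of "f' x" 1 v] by (simp add: D_def inner_commute)
  then have D: "GDERIV f x :> D" using f' by (simp add: gderiv_def)
  have "nabla f x = D"
    unfolding nabla_def
  proof (rule the_equality, rule D)
    fix E assume "GDERIV f x :> E"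
    then have "(\<lambda>v. v \<bullet> E) = (\<lambda>v. v \<bullet> D)"
      using D unfolding gderiv_def by (rule has_derivative_unique)
    then show "E = D" by (metis vector_eq_ldot inner_commute)
  qed
  then show ?thesis using D by (simp add: gderiv_def inner_commute)
qed

lemma descent_lemma:
  fixes f :: "'a::euclidean_space \<Rightarrow> real"
  assumes f: "C2_on UNIV f" and lip: "L-lipschitz_on UNIV (nabla f)"
  shows "f y \<le> f x + nabla f x \<bullet> (y - x) + L / 2 * (norm (y - x))\<^sup>2"
proof -
  define v where "v = y - x"
  define k where "k t = f (x + t *\<^sub>R v) - t * (nabla f x \<bullet> v) - L * t\<^sup>2 / 2 * (norm v)\<^sup>2" for t
  define k' where "k' t = nabla f (x + t *\<^sub>R v) \<bullet> v - nabla f x \<bullet> v - L * t * (norm v)\<^sup>2" for t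
  have k': "(k has_real_derivative k' t) (at t)" for t
  proof -
    have "((\<lambda>t. x + t *\<^sub>R v) has_derivative (\<lambda>h. h *\<^sub>R v)) (at t)"
      by (auto intro!: derivative_eq_intros)
    from diff_chain_at[OF this has_derivative_nabla[OF f]]
    have "((\<lambda>t. f (x + t *\<^sub>R v)) has_real_derivative nabla f (x + t *\<^sub>R v) \<bullet> v) (at t)"
      by (simp add: comp_def has_field_derivative_def mult_commute_abs)
    then show ?thesis unfolding k_def[abs_def] k'_def
      by (auto intro!: derivative_eq_intros)
  qed
  have "k' t \<le> 0" if t: "0 \<le> t" for t
  proof -
    have "nabla f (x + t *\<^sub>R v) \<bullet> v - nabla f x \<bullet> v \<le> norm (nabla f (x + t *\<^sub>R v) - nabla f x) * norm v"
      using norm_cauchy_schwarz[of "nabla f (x + t *\<^sub>R v) - nabla f x" v] by (simp add: inner_diff_left)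
    also have "\<dots> \<le> (L * norm (t *\<^sub>R v)) * norm v"
      using lipschitz_onD[OF lip, of "x + t *\<^sub>R v" x] by (intro mult_right_mono) (auto simp: dist_norm)
    also have "\<dots> = L * t * (norm v)\<^sup>2" using t by (simp add: power2_eq_square)
    finally show ?thesis by (simp add: k'_def)
  qed
  then have "k 1 \<le> k 0"
    by (intro DERIV_nonpos_imp_nonincreasing[of 0 1 k]) (use k' in auto)
  then show ?thesis by (simp add: k_def v_def)
qed

lemma prox_le:
  assumes "x \<in> prox \<gamma> g w"
  shows "g x + ereal (1 / (2 * \<gamma>) * (norm (x - w))\<^sup>2) \<le> g u + ereal (1 / (2 * \<gamma>) * (norm (u - w))\<^sup>2)"
  using assms by (simp add: prox_def is_arg_min_linorder)

lemma prox_finite: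
  assumes "proper_fun g" "x \<in> prox \<gamma> g w"
  shows "\<bar>g x\<bar> \<noteq> \<infinity>"
proof -
  obtain u where u: "g u \<noteq> \<infinity>" using assms by (auto simp: proper_fun_def)
  have "g x \<noteq> \<infinity>" using prox_le[OF assms(2), of u] u by (cases "g u") auto
  then show ?thesis using assms(1) by (auto simp: proper_fun_def)
qed

text \<open>Completing the square: up to the additive constant
  \<open>\<gamma> / 2 * (norm v)\<^sup>2\<close>, the proximal objective centred at
  \<open>y - \<gamma> *\<^sub>R v\<close> is the linear model with slope \<open>v\<close> at
  \<open>y\<close> plus a quadratic penalty.\<close>

lemma prox_step:
  fixes x y u v :: "'a::real_inner"
  assumes g: "proper_fun g" and \<gamma>: "0 < \<gamma>" and x: "x \<in> prox \<gamma> g (y - \<gamma> *\<^sub>R v)" and u: "g u \<noteq> \<infinity>"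
  shows "real_of_ereal (g x) + v \<bullet> (x - y) + 1 / (2 * \<gamma>) * (norm (x - y))\<^sup>2
    \<le> real_of_ereal (g u) + v \<bullet> (u - y) + 1 / (2 * \<gamma>) * (norm (u - y))\<^sup>2"
proof -
  have sq: "1 / (2 * \<gamma>) * (norm (z - (y - \<gamma> *\<^sub>R v)))\<^sup>2 = 1 / (2 * \<gamma>) * (norm (z - y))\<^sup>2 + v \<bullet> (z - y) + \<gamma> / 2 * (norm v)\<^sup>2" for z
  proof -
    have "z - (y - \<gamma> *\<^sub>R v) = (z - y) + \<gamma> *\<^sub>R v" by simp
    then have "(norm (z - (y - \<gamma> *\<^sub>R v)))\<^sup>2 = (norm (z - y))\<^sup>2 + 2 * \<gamma> * (v \<bullet> (z - y)) + \<gamma>\<^sup>2 * (norm v)\<^sup>2"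
      by (simp only: power2_norm_eq_inner) (simp add: inner_add_left inner_add_right inner_commute power2_eq_square)
    then show ?thesis using \<gamma> by (simp add: field_simps power2_eq_square)
  qed
  have "g u \<noteq> - \<infinity>" using g by (simp add: proper_fun_def)
  then obtain a b where ab: "g x = ereal a" "g u = ereal b"
    using prox_finite[OF g x] u by (cases "g x"; cases "g u") auto
  have "a + 1 / (2 * \<gamma>) * (norm (x - (y - \<gamma> *\<^sub>R v)))\<^sup>2 \<le> b + 1 / (2 * \<gamma>) * (norm (u - (y - \<gamma> *\<^sub>R v)))\<^sup>2"
    using prox_le[OF x, of u] ab by simp
  then show ?thesis unfolding sq ab by simp
qed

text \<open>The Fermat rule of the proximal step. Minimality is a global quadratic minorant of
  \<open>g\<close> touching at \<open>x\<close>, so the little-o remainder is explicit: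
  \<open>- (1 / (2 * \<gamma>)) * (norm (u - x))\<^sup>2\<close>.\<close>

lemma prox_regular_subdiff:
  fixes x y :: "'a::real_inner"
  assumes g: "proper_fun g" and \<gamma>: "0 < \<gamma>" and x: "x \<in> prox \<gamma> g (y - \<gamma> *\<^sub>R v)"
  shows "(1 / \<gamma>) *\<^sub>R (y - x) - v \<in> regular_subdiff g x"
proof -
  define w where "w = (1 / \<gamma>) *\<^sub>R (y - x) - v"
  define \<rho> where "\<rho> = (\<lambda>u. - (1 / (2 * \<gamma>)) * (norm (u - x))\<^sup>2)"
  have "((\<lambda>u. - (1 / (2 * \<gamma>)) * norm (u - x)) \<longlongrightarrow> - (1 / (2 * \<gamma>)) * norm (x - x)) (at x)"
    by (intro tendsto_intros)
  moreover have "(\<lambda>u. \<rho> u / norm (u - x)) = (\<lambda>u. - (1 / (2 * \<gamma>)) * norm (u - x))"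
    by (auto simp: fun_eq_iff \<rho>_def power2_eq_square)
  ultimately have "((\<lambda>u. \<rho> u / norm (u - x)) \<longlongrightarrow> 0) (at x)" by simp
  then have o: "\<rho> \<in> o[at x](\<lambda>u. norm (u - x))"
    by (rule smalloI_tendsto) (simp add: eventually_at_filter)
  have ineq: "g x + ereal (w \<bullet> (u - x) + \<rho> u) \<le> g u" for u
  proof (cases "g u = \<infinity>")
    case False
    have "g u \<noteq> - \<infinity>" using g by (simp add: proper_fun_def)
    then obtain a b where ab: "g x = ereal a" "g u = ereal b"
      using prox_finite[OF g x] False by (cases "g x"; cases "g u") auto
    have 1: "a + v \<bullet> (x - y) + 1 / (2 * \<gamma>) * (norm (x - y))\<^sup>2 \<le> b + v \<bullet> (u - y) + 1 / (2 * \<gamma>) * (norm (u - y))\<^sup>2"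
      using prox_step[OF g \<gamma> x False] ab by simp
    have "(norm (u - y))\<^sup>2 = (norm (u - x))\<^sup>2 - 2 * ((y - x) \<bullet> (u - x)) + (norm (x - y))\<^sup>2"
      unfolding power2_norm_eq_inner by (simp add: inner_diff_left inner_diff_right inner_commute)
    then have "1 / (2 * \<gamma>) * (norm (u - y))\<^sup>2
        = 1 / (2 * \<gamma>) * (norm (u - x))\<^sup>2 - 1 / \<gamma> * ((y - x) \<bullet> (u - x)) + 1 / (2 * \<gamma>) * (norm (x - y))\<^sup>2"
      using \<gamma> by (simp add: field_simps)
    moreover have "v \<bullet> (u - y) = v \<bullet> (u - x) + v \<bullet> (x - y)" by (simp add: inner_diff_right)
    moreover have "w \<bullet> (u - x) = 1 / \<gamma> * ((y - x) \<bullet> (u - x)) - v \<bullet> (u - x)"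
      by (simp add: w_def inner_diff_left)
    ultimately have "a + (w \<bullet> (u - x) + \<rho> u) \<le> b" using 1 by (simp add: \<rho>_def)
    then show ?thesis by (simp add: ab)
  qed simp
  show ?thesis
    unfolding w_def[symmetric] regular_subdiff_def
    using prox_finite[OF g x] o ineq by (auto intro!: exI[of _ \<rho>] always_eventually)
qed

lemma regular_subdiff_subset_limiting:
  "v \<in> regular_subdiff g x \<Longrightarrow> v \<in> limiting_subdiff g x"
  unfolding limiting_subdiff_def
  by (intro CollectI conjI exI[of _ "\<lambda>_. x"] exI[of _ "\<lambda>_. v"] allI tendsto_const)
    (simp_all add: regular_subdiff_def)

text \<open>The limes inferior at \<open>z\<close> leaves out \<open>z\<close> itself; indices with
  \<open>X j = z\<close> are covered by \<open>c < g z\<close>.\<close>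

lemma lower_semicont_sequentially:
  fixes X :: "nat \<Rightarrow> 'a::metric_space"
  assumes g: "lower_semicont g" and X: "X \<longlonglongrightarrow> z" and c: "c < g z"
  shows "\<forall>\<^sub>F j in sequentially. c < g (X j)"
proof -
  have "\<forall>\<^sub>F x in at z. c < g x"
    using g c unfolding lower_semicont_def le_Liminf_iff by blast
  then obtain d where d: "d > 0" "\<And>x. x \<noteq> z \<Longrightarrow> dist x z < d \<Longrightarrow> c < g x"
    unfolding eventually_at by blast
  have "\<forall>\<^sub>F j in sequentially. dist (X j) z < d" using X d(1) by (rule tendstoD)
  then show ?thesis by eventually_elim (use d(2) c in metis)
qed

text \<open>Limiting subgradients require convergence of the values of \<open>g\<close>, which is
  not continuous. Semicontinuity gives the lower half; comparing each proximal point with the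
  competitor \<open>z\<close> gives the upper half through \<open>U\<close>.\<close>

lemma prox_limit:
  fixes X Y V :: "nat \<Rightarrow> 'a::real_inner"
  assumes g: "proper_fun g" "lower_semicont g" and \<gamma>: "0 < \<gamma>"
    and X: "\<And>j. X j \<in> prox \<gamma> g (Y j - \<gamma> *\<^sub>R V j)"
    and lim: "X \<longlonglongrightarrow> z" "Y \<longlonglongrightarrow> z" "V \<longlonglongrightarrow> v" and fin: "g z \<noteq> \<infinity>"
  shows "(\<lambda>j. g (X j)) \<longlonglongrightarrow> g z" and "- v \<in> limiting_subdiff g z"
proof -
  have "g z \<noteq> - \<infinity>" using g by (simp add: proper_fun_def)
  then obtain b where b: "g z = ereal b" using fin by (cases "g z") auto
  define U where "U j = b + V j \<bullet> (z - Y j) + 1 / (2 * \<gamma>) * (norm (z - Y j))\<^sup>2 - V j \<bullet> (X j - Y j)" for j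
  have "U \<longlonglongrightarrow> b + v \<bullet> (z - z) + 1 / (2 * \<gamma>) * (norm (z - z))\<^sup>2 - v \<bullet> (z - z)"
    unfolding U_def by (intro tendsto_intros lim)
  then have U: "U \<longlonglongrightarrow> b" by simp
  have le: "g (X j) \<le> ereal (U j)" for j
  proof -
    obtain a where a: "g (X j) = ereal a" using prox_finite[OF g(1) X[of j]] by (cases "g (X j)") auto
    have "0 \<le> 1 / (2 * \<gamma>) * (norm (X j - Y j))\<^sup>2" using \<gamma> by simp
    then show ?thesis using prox_step[OF g(1) \<gamma> X fin, of j] by (simp add: a b U_def)
  qed
  show conv: "(\<lambda>j. g (X j)) \<longlonglongrightarrow> g z"
  proof (rule order_tendstoI)
    fix c assume "c < g z" then show "\<forall>\<^sub>F j in sequentially. c < g (X j)"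
      by (rule lower_semicont_sequentially[OF g(2) lim(1)])
  next
    fix c assume c: "g z < c"
    have "(\<lambda>j. ereal (U j)) \<longlonglongrightarrow> g z" unfolding b using U by simp
    then have "\<forall>\<^sub>F j in sequentially. ereal (U j) < c" using c by (rule order_tendstoD(2))
    then show "\<forall>\<^sub>F j in sequentially. g (X j) < c" by eventually_elim (use le order_le_less_trans in blast)
  qed
  have "(\<lambda>j. (1 / \<gamma>) *\<^sub>R (Y j - X j) - V j) \<longlonglongrightarrow> (1 / \<gamma>) *\<^sub>R (z - z) - v"
    by (intro tendsto_intros lim)
  then have "(\<lambda>j. (1 / \<gamma>) *\<^sub>R (Y j - X j) - V j) \<longlonglongrightarrow> - v" by simp
  then show "- v \<in> limiting_subdiff g z"
    unfolding limiting_subdiff_def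
    using fin \<open>g z \<noteq> - \<infinity>\<close>
    by (intro CollectI conjI exI[of _ X] exI[of _ "\<lambda>j. (1 / \<gamma>) *\<^sub>R (Y j - X j) - V j"] allI
        prox_regular_subdiff[OF g(1) \<gamma> X] lim(1) conv) auto
qed

lemma structured_critical_prox_bound:
  fixes xs :: "'a::euclidean_space"
  assumes st: "structured_critical_point r f g M xs" and g: "proper_fun g"
  shows "\<bar>g xs\<bar> \<noteq> \<infinity>"
    and "g u \<noteq> \<infinity> \<Longrightarrow> real_of_ereal (g xs) \<le> real_of_ereal (g u) + nabla f xs \<bullet> (u - xs) + r / 2 * (norm (u - xs))\<^sup>2"
proof -
  have r: "r > 0" and p: "xs \<in> prox (1 / r) g (xs - (1 / r) *\<^sub>R nabla f xs)"
    using st by (auto simp: structured_critical_point_def)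
  show "\<bar>g xs\<bar> \<noteq> \<infinity>" by (rule prox_finite[OF g p])
  show "real_of_ereal (g xs) \<le> real_of_ereal (g u) + nabla f xs \<bullet> (u - xs) + r / 2 * (norm (u - xs))\<^sup>2"
    if "g u \<noteq> \<infinity>"
    using prox_step[OF g _ p that] r by simp
qed

text \<open>The quadratic minorant of \<open>g\<close> provided by the proximal condition at \<open>xs\<close>, with \<open>r < 1 / \<gamma>\<close>,
  replaces the local Lipschitz continuity of the proximal gradient map.\<close>

lemma structured_critical_prox_lipschitz:
  fixes xs :: "'a::euclidean_space"
  assumes st: "structured_critical_point r f g M xs" and g: "proper_fun g"
    and lip: "L-lipschitz_on UNIV (nabla f)" and \<gamma>: "0 < \<gamma>" "r < 1 / \<gamma>"
    and x: "x \<in> prox \<gamma> g (y - \<gamma> *\<^sub>R nabla f y)"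
  shows "norm (x - xs) \<le> 2 * (L + 1 / \<gamma>) / (1 / \<gamma> - r) * norm (y - xs)"
proof -
  define a b where "a = real_of_ereal (g x)" and "b = real_of_ereal (g xs)"
  have fin: "g xs \<noteq> \<infinity>" "g x \<noteq> \<infinity>"
    using structured_critical_prox_bound(1)[OF st g] prox_finite[OF g x] by auto
  have 1: "b \<le> a + nabla f xs \<bullet> (x - xs) + r / 2 * (norm (x - xs))\<^sup>2"
    using structured_critical_prox_bound(2)[OF st g fin(2)] by (simp add: a_def b_def)
  have 2: "a + nabla f y \<bullet> (x - y) + 1 / (2 * \<gamma>) * (norm (x - y))\<^sup>2
      \<le> b + nabla f y \<bullet> (xs - y) + 1 / (2 * \<gamma>) * (norm (xs - y))\<^sup>2"
    using prox_step[OF g \<gamma>(1) x fin(1)] by (simp add: a_def b_def)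
  let ?n = "norm (x - xs)"
  have "(norm (x - y))\<^sup>2 - (norm (xs - y))\<^sup>2 = ?n\<^sup>2 + 2 * ((x - xs) \<bullet> (xs - y))"
    unfolding power2_norm_eq_inner by (simp add: inner_diff_left inner_diff_right inner_commute)
  then have 3: "1 / (2 * \<gamma>) * (norm (x - y))\<^sup>2 - 1 / (2 * \<gamma>) * (norm (xs - y))\<^sup>2
      = 1 / (2 * \<gamma>) * ?n\<^sup>2 + 1 / \<gamma> * ((x - xs) \<bullet> (xs - y))"
    using \<gamma> by (simp add: field_simps)
  have 4: "nabla f y \<bullet> (xs - y) - nabla f y \<bullet> (x - y) + nabla f xs \<bullet> (x - xs) = (nabla f xs - nabla f y) \<bullet> (x - xs)"
    by (simp add: inner_diff_left inner_diff_right)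
  have "(nabla f xs - nabla f y) \<bullet> (x - xs) \<le> norm (nabla f xs - nabla f y) * ?n" by (rule norm_cauchy_schwarz)
  also have "\<dots> \<le> (L * norm (y - xs)) * ?n"
    using lipschitz_onD[OF lip, of xs y] by (intro mult_right_mono) (auto simp: dist_norm norm_minus_commute)
  finally have 5: "(nabla f xs - nabla f y) \<bullet> (x - xs) \<le> (L * norm (y - xs)) * ?n" .
  have "- ((x - xs) \<bullet> (xs - y)) \<le> norm (y - xs) * ?n"
    using Cauchy_Schwarz_ineq2[of "x - xs" "xs - y"] by (simp add: norm_minus_commute mult.commute)
  then have 6: "- (1 / \<gamma> * ((x - xs) \<bullet> (xs - y))) \<le> 1 / \<gamma> * (norm (y - xs) * ?n)"
    using mult_left_mono[of "- ((x - xs) \<bullet> (xs - y))" "norm (y - xs) * ?n" "1 / \<gamma>"] \<gamma>(1) by simp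
  \<comment> \<open>In the sum of \<open>1\<close> and \<open>2\<close> the values \<open>a\<close>
    and \<open>b\<close> cancel; the square of \<open>?n\<close> keeps the coefficient
    \<open>(1 / \<gamma> - r) / 2\<close>, positive by assumption, and every other term is linear in
    \<open>?n\<close>.\<close>
  have "1 / (2 * \<gamma>) * ?n\<^sup>2 - r / 2 * ?n\<^sup>2 \<le> (L * norm (y - xs)) * ?n + 1 / \<gamma> * (norm (y - xs) * ?n)"
    using 1 2 3 4 5 6 by linarith
  then have "((1 / \<gamma> - r) * ?n) * ?n \<le> (2 * (L + 1 / \<gamma>) * norm (y - xs)) * ?n"
    by (simp add: power2_eq_square algebra_simps)
  moreover have "0 \<le> 2 * (L + 1 / \<gamma>) * norm (y - xs)"
    using lipschitz_on_nonneg[OF lip] \<gamma>(1) by simp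
  ultimately have "(1 / \<gamma> - r) * ?n \<le> 2 * (L + 1 / \<gamma>) * norm (y - xs)"
    by (cases "?n = 0") (auto simp: mult_le_cancel_right)
  then show ?thesis using \<gamma>(2) by (simp add: pos_le_divide_eq mult.commute)
qed

text \<open>The chord is the integral of the velocity; the form of the fundamental theorem that
  tolerates finitely many exceptional points fits \<open>valid_path\<close>.\<close>

lemma norm_le_riem_dist: "ereal (norm (a - b)) \<le> riem_dist M a b"
  unfolding riem_dist_def
proof (rule Inf_greatest, clarify)
  fix l c
  assume c: "valid_path c" "a = pathstart c" "b = pathfinish c"
    and l: "((\<lambda>t. norm (vector_derivative c (at t))) has_integral l) {0..1}"
  obtain S where S: "finite S" "continuous_on {0..1} c" "c C1_differentiable_on ({0..1} - S)"
    using c(1) by (auto simp: valid_path_def piecewise_C1_differentiable_on_def)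
  have "((\<lambda>t. vector_derivative c (at t)) has_integral (c 1 - c 0)) {0..1}"
  proof (rule fundamental_theorem_of_calculus_interior_strong[OF S(1) _ _ S(2)])
    fix t assume "t \<in> {0<..<1::real} - S"
    then have "c differentiable at t" using S(3) by (auto simp: C1_differentiable_on_eq)
    then show "(c has_vector_derivative vector_derivative c (at t)) (at t)" by (simp add: vector_derivative_works)
  qed simp
  then have "norm (c 1 - c 0) \<le> l"
    using l integral_norm_bound_integral[of "\<lambda>t. vector_derivative c (at t)" "{0..1}" "\<lambda>t. norm (vector_derivative c (at t))"]
    by (auto simp: has_integral_iff)
  then show "ereal (norm (pathstart c - pathfinish c)) \<le> ereal l"
    by (simp add: pathstart_def pathfinish_def norm_minus_commute)
qed

text \<open>The near segment, run backwards because it starts at \<open>xs\<close>, is an admissible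
  path. With \<open>norm_le_riem_dist\<close> the two distances to \<open>xs\<close> are equivalent
  near \<open>xs\<close>.\<close>

lemma (in newton_model) riem_dist_le:
  assumes x: "x \<in> M" "norm (x - xs) < \<delta> / 2"
  shows "riem_dist M x xs \<le> ereal (2 * norm (x - xs))"
proof -
  obtain c c' where c: "c 0 = xs" "c 1 = x" "continuous_on {0..1} c'"
    "\<And>t. t \<in> {0..1} \<Longrightarrow> c t \<in> M" "\<And>t. t \<in> {0..1} \<Longrightarrow> (c has_vector_derivative c' t) (at t)"
    "\<And>t. t \<in> {0..1} \<Longrightarrow> norm (c' t) \<le> 2 * norm (x - xs)"
  proof (rule short_curve[OF x], goal_cases)
    case (1 c c')
    show ?case by (rule that[of c c']) (use 1(2-) in simp_all)
  qed
  define p where "p = (\<lambda>t. c (1 - t))"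
  define p' where "p' = (\<lambda>t. - c' (1 - t))"
  have der: "(p has_vector_derivative p' t) (at t)" if t: "t \<in> {0..1}" for t
  proof -
    have "((\<lambda>t. 1 - t :: real) has_vector_derivative - 1) (at t)"
      by (auto intro!: derivative_eq_intros)
    moreover have "(c has_vector_derivative c' (1 - t)) (at (1 - t))" using t by (intro c(5)) auto
    ultimately have "((c \<circ> (\<lambda>t. 1 - t)) has_vector_derivative - 1 *\<^sub>R c' (1 - t)) (at t)"
      by (rule vector_diff_chain_at)
    then show ?thesis by (simp add: p_def p'_def comp_def)
  qed
  have cont: "continuous_on {0..1} p'"
    unfolding p'_def by (intro continuous_intros continuous_on_compose2[OF c(3)]) auto
  have "p C1_differentiable_on {0..1}" unfolding C1_differentiable_on_def using der cont by blast
  then have vp: "valid_path p" unfolding valid_path_def by (rule C1_differentiable_imp_piecewise)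
  have "((\<lambda>t. norm (p' t)) has_integral integral {0..1} (\<lambda>t. norm (p' t))) {0..1}"
    by (intro integrable_integral integrable_continuous_interval continuous_intros cont)
  then have I: "((\<lambda>t. norm (vector_derivative p (at t))) has_integral integral {0..1} (\<lambda>t. norm (p' t))) {0..1}"
    by (rule has_integral_eq[rotated]) (simp add: vector_derivative_at[OF der])
  have "integral {0..1} (\<lambda>t. norm (p' t)) \<le> integral {0..1} (\<lambda>t::real. 2 * norm (x - xs))"
    by (intro integral_le integrable_continuous_interval continuous_intros cont) (simp add: p'_def c(6))
  then have le: "integral {0..1} (\<lambda>t. norm (p' t)) \<le> 2 * norm (x - xs)" by simp
  have "riem_dist M x xs \<le> ereal (integral {0..1} (\<lambda>t. norm (p' t)))"
    unfolding riem_dist_def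
  proof (rule Inf_lower, intro CollectI exI conjI refl)
    show "path_image p \<subseteq> M" using c(4) by (auto simp: path_image_def p_def)
    show "pathstart p = x" "pathfinish p = xs" using c(1,2) by (simp_all add: p_def pathstart_def pathfinish_def)
  qed (rule refl, fact vp, fact I)
  then show ?thesis using le by (meson ereal_less_eq(3) order_trans)
qed

section \<open>Normal directions and finite identification\<close>

section \<open>Identification of the active manifold\<close>

lemma tangential_derivative_zero_at_min:
  fixes M :: "'a::euclidean_space set" and k :: "'a \<Rightarrow> real"
  assumes v: "v \<in> tangent_space M p" and U: "open U" "p \<in> U"
    and min: "\<And>z. z \<in> M \<inter> U \<Longrightarrow> k p \<le> k z" and der: "(k has_derivative k') (at p)"
  shows "k' v = 0"
proof -
  obtain c where c: "curve_in M p v c" using v unfolding tangent_space_def by blast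
  have D: "((k \<circ> c) has_real_derivative k' v) (at 0)"
    using curve_in_compose_derivative[OF c der] by (simp add: has_real_derivative_iff_has_vector_derivative)
  obtain d where d: "d > 0" "\<And>t. t \<noteq> 0 \<Longrightarrow> dist t 0 < d \<Longrightarrow> c t \<in> M \<inter> U"
    using curve_in_eventually[OF c U] unfolding eventually_at by blast
  have "(k \<circ> c) 0 \<le> (k \<circ> c) t" if "\<bar>0 - t\<bar> < d" for t
    using min[OF d(2)[of t]] that curve_in_start[OF c] by (cases "t = 0") auto
  then show ?thesis using DERIV_local_min[OF D d(1)] by blast
qed

lemma nearest_point_normal:
  fixes M :: "'a::euclidean_space set"
  assumes v: "v \<in> tangent_space M p" and U: "open U" "p \<in> U"
    and min: "\<And>z. z \<in> M \<inter> U \<Longrightarrow> dist x p \<le> dist x z"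
  shows "(x - p) \<bullet> v = 0"
proof -
  have "((\<lambda>z. (x - z) \<bullet> (x - z)) has_derivative (\<lambda>v. (x - p) \<bullet> (- v) + (- v) \<bullet> (x - p))) (at p)"
    by (auto intro!: derivative_eq_intros)
  moreover have "(x - p) \<bullet> (x - p) \<le> (x - z) \<bullet> (x - z)" if "z \<in> M \<inter> U" for z
    using min[OF that] by (simp add: dist_norm norm_le)
  ultimately have "(x - p) \<bullet> (- v) + (- v) \<bullet> (x - p) = 0"
    using tangential_derivative_zero_at_min[OF v U, of "\<lambda>z. (x - z) \<bullet> (x - z)"] by blast
  then show ?thesis by (simp add: inner_commute)
qed

text \<open>Off \<open>M\<close>, the direction from the nearest point of \<open>M\<close> to \<open>X j\<close> is asymptotically normal to \<open>M\<close>,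
  and relative interiority leaves room to move the limiting subgradient in that direction.  The
  two prox-regularity inequalities between \<open>X j\<close> and its nearest point then contradict each other.\<close>

lemma partly_smooth_identification:
  fixes X V :: "nat \<Rightarrow> 'a::euclidean_space"
  assumes st: "structured_critical_point r f g M xs"
    and X: "X \<longlonglongrightarrow> xs" and V: "V \<longlonglongrightarrow> - nabla f xs"
    and sub: "\<And>j. V j \<in> limiting_subdiff g (X j)" and gX: "(\<lambda>j. g (X j)) \<longlonglongrightarrow> g xs"
    and off: "\<And>j. X j \<notin> M"
  shows False
proof -
  have xsM: "xs \<in> M" and ri: "0 \<in> rel_interior (subdiff_sum f g xs)" and pr: "prox_regular r g xs"
    and ps: "partly_smooth g xs M"
    using st by (auto simp: structured_critical_point_def)
  have sm: "submanifold_around M xs" and C2: "C2_restricted_near M g xs"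
    and cont: "setmap_continuous_at M (limiting_subdiff g) xs"
    using ps by (auto simp: partly_smooth_def)
  obtain a where aff: "affine hull (limiting_subdiff g xs) = (\<lambda>w. a + w) ` normal_space M xs"
    using ps by (auto simp: partly_smooth_def)
  obtain P h h' G G' A \<delta> where "local_model M g xs P h h' G G' A \<delta>"
    using local_model_exists[OF sm C2] by blast
  then interpret lm: local_model M g xs P h h' G G' A \<delta> .
  obtain \<rho> where \<rho>: "\<rho> > 0" "compact (M \<inter> cball xs \<rho>)" using compact_submanifold_cball[OF sm] by blast

  define vb where "vb = - nabla f xs"
  have "vb \<in> rel_interior (limiting_subdiff g xs)"
  proof -
    have "rel_interior (subdiff_sum f g xs) = (\<lambda>v. nabla f xs + v) ` rel_interior (limiting_subdiff g xs)"
      unfolding subdiff_sum_def by (rule rel_interior_translation)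
    then obtain v where "v \<in> rel_interior (limiting_subdiff g xs)" "nabla f xs + v = 0" using ri by auto
    moreover from this have "v = vb" by (simp add: vb_def eq_neg_iff_add_eq_0 add.commute)
    ultimately show ?thesis by simp
  qed
  then obtain e where vb: "vb \<in> limiting_subdiff g xs" and e: "e > 0"
      "ball vb e \<inter> affine hull (limiting_subdiff g xs) \<subseteq> limiting_subdiff g xs"
    unfolding mem_rel_interior_ball by blast

  have "\<exists>p. p \<in> M \<inter> cball xs \<rho> \<and> (\<forall>z\<in>M \<inter> cball xs \<rho>. dist (X j) p \<le> dist (X j) z)" for j
  proof -
    have "M \<inter> cball xs \<rho> \<noteq> {}" using xsM \<rho> by auto
    moreover have "continuous_on (M \<inter> cball xs \<rho>) (dist (X j))" by (intro continuous_intros)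
    ultimately show ?thesis using continuous_attains_inf[OF \<rho>(2), of "dist (X j)"] by blast
  qed
  then obtain p where p: "\<And>j. p j \<in> M \<inter> cball xs \<rho>"
    and pmin: "\<And>j z. z \<in> M \<inter> cball xs \<rho> \<Longrightarrow> dist (X j) (p j) \<le> dist (X j) z" by metis
  have Xp: "dist (X j) (p j) \<le> dist (X j) xs" for j using pmin[of xs] xsM \<rho> by simp
  have dX: "(\<lambda>j. dist (X j) xs) \<longlonglongrightarrow> 0" using X tendsto_dist_iff by blast
  have t0: "(\<lambda>j. dist (X j) (p j)) \<longlonglongrightarrow> 0"
    by (rule tendsto_sandwich[OF _ _ tendsto_const dX]) (use Xp in auto)
  have plim: "p \<longlonglongrightarrow> xs"
  proof -
    have "(\<lambda>j. X j - (X j - p j)) \<longlonglongrightarrow> xs - 0"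
      by (intro tendsto_diff X) (use t0 in \<open>simp add: dist_norm tendsto_norm_zero_iff\<close>)
    then show ?thesis by simp
  qed
  define t where "t j = norm (X j - p j)" for j
  have t: "t j > 0" for j using off[of j] p[of j] by (auto simp: t_def)
  have tlim: "t \<longlonglongrightarrow> 0" using t0 by (simp add: t_def[abs_def] dist_norm)
  define w where "w j = (1 / t j) *\<^sub>R (X j - p j)" for j
  have "w j \<in> sphere 0 1" for j using t[of j] by (simp add: w_def t_def)
  then obtain wl \<sigma> where wl: "wl \<in> sphere 0 1" and \<sigma>: "strict_mono \<sigma>" and wlim: "(w \<circ> \<sigma>) \<longlonglongrightarrow> wl"
    using compact_sphere[of 0 1] unfolding compact_def by metis
  have subseq: "(\<lambda>j. Y (\<sigma> j)) \<longlonglongrightarrow> l" if "Y \<longlonglongrightarrow> l" for Y :: "nat \<Rightarrow> 'b::topological_space" and l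
    using LIMSEQ_subseq_LIMSEQ[OF that \<sigma>] by (simp add: comp_def)
  have wlim': "(\<lambda>j. w (\<sigma> j)) \<longlonglongrightarrow> wl" using wlim by (simp add: comp_def)
  have near: "\<forall>\<^sub>F j in sequentially. norm (p j - xs) < b" if "b > 0" for b
    using tendstoD[OF plim that] by (simp add: dist_norm)

  have wN: "wl \<in> normal_space M xs"
  proof -
    \<comment> \<open>\<open>w j\<close> is normal at \<open>p j\<close>, not at \<open>xs\<close>.
      The vector \<open>v\<close> is moved to the tangent vector \<open>P (p j) v\<close>, which
      returns to \<open>v\<close> in the limit by continuity of \<open>P\<close>.\<close>
    have "wl \<bullet> v = 0" if v: "v \<in> tangent_space M xs" for v
    proof -
      have "\<forall>\<^sub>F j in sequentially. w j \<bullet> P (p j) v = 0"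
        using near[OF \<rho>(1)] near[OF lm.\<delta>]
      proof eventually_elim
        case (elim j)
        have "(X j - p j) \<bullet> P (p j) v = 0"
          by (rule nearest_point_normal[of _ M "p j" "ball xs \<rho>"])
            (use elim p[of j] lm.P_in pmin in \<open>auto simp: dist_norm norm_minus_commute\<close>)
        then show ?case by (simp add: w_def)
      qed
      then have z: "(\<lambda>j. w (\<sigma> j) \<bullet> P (p (\<sigma> j)) v) \<longlonglongrightarrow> 0"
        by (intro subseq tendsto_eventually)
      have "isCont P xs"
      proof -
        have "((\<lambda>x. A * norm (x - xs)) \<longlongrightarrow> A * norm (xs - xs)) (at xs)" by (intro tendsto_intros)
        moreover have "\<forall>\<^sub>F x in at xs. norm (P x - P xs) \<le> A * norm (x - xs)"
          using lm.P_lip lm.\<delta> unfolding eventually_at by (auto simp: dist_norm)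
        ultimately have "((\<lambda>x. P x - P xs) \<longlongrightarrow> 0) (at xs)"
          using Lim_null_comparison[of "\<lambda>x. P x - P xs" "\<lambda>x. A * norm (x - xs)" "at xs"] by simp
        then show ?thesis unfolding isCont_def by (simp add: LIM_zero_iff)
      qed
      then have "(\<lambda>j. P (p (\<sigma> j))) \<longlonglongrightarrow> P xs" by (rule isCont_tendsto_compose) (rule subseq[OF plim])
      then have "(\<lambda>j. w (\<sigma> j) \<bullet> P (p (\<sigma> j)) v) \<longlonglongrightarrow> wl \<bullet> P xs v"
        by (intro tendsto_inner wlim' blinfun.tendsto tendsto_const)
      then have "wl \<bullet> P xs v = 0" using z LIMSEQ_unique by blast
      moreover have "P xs v = v" using lm.P_id[OF xsM _ v] lm.\<delta> by simp
      ultimately show ?thesis by simp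
    qed
    then show ?thesis
      by (auto simp: normal_space_def orthogonal_comp_def orthogonal_def inner_commute)
  qed

  \<comment> \<open>The tilt is normal, so \<open>u\<close> stays in the affine hull, a translate of
    the normal space; the factor \<open>e / 2\<close> keeps it in the ball given by relative
    interiority.\<close>
  define u where "u = vb + (e / 2) *\<^sub>R wl"
  have u: "u \<in> limiting_subdiff g xs"
  proof -
    have sN: "subspace (normal_space M xs)" unfolding normal_space_def by (rule subspace_orthogonal_comp)
    obtain n where n: "n \<in> normal_space M xs" "vb = a + n"
      using hull_inc[OF vb, of affine] aff by auto
    have "n + (e / 2) *\<^sub>R wl \<in> normal_space M xs" using sN n wN by (simp add: subspace_add subspace_scale)
    then have "u \<in> affine hull (limiting_subdiff g xs)" unfolding aff u_def n(2) by (auto simp: add.assoc)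
    moreover have "u \<in> ball vb e" using e wl by (simp add: u_def dist_norm)
    ultimately show ?thesis using e by blast
  qed

  \<comment> \<open>Inner semicontinuity along \<open>M\<close>: the tilted subgradient at
    \<open>xs\<close> is approached by subgradients at the nearest points, whereas
    \<open>V j\<close> at \<open>X j\<close> approaches the untilted \<open>vb\<close>.\<close>
  have "\<exists>us. (\<forall>\<^sub>F j in sequentially. us j \<in> limiting_subdiff g (p j)) \<and> us \<longlonglongrightarrow> u"
    using cont u p plim unfolding setmap_continuous_at_def by blast
  then obtain us where us: "\<forall>\<^sub>F j in sequentially. us j \<in> limiting_subdiff g (p j)" "us \<longlonglongrightarrow> u"
    by blast

  have prox_reg: "\<exists>\<epsilon>>0. \<forall>x x' v. v \<in> limiting_subdiff g x \<and> norm (x - xs) < \<epsilon> \<and> norm (x' - xs) < \<epsilon> \<and>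
        norm (v - c) < \<epsilon> \<and> g x < g xs + ereal \<epsilon> \<longrightarrow>
        g x + ereal (v \<bullet> (x' - x) - r / 2 * (norm (x' - x))\<^sup>2) \<le> g x'"
    if "c \<in> limiting_subdiff g xs" for c
    using pr that unfolding prox_regular_def by blast
  obtain e1 where e1: "e1 > 0" "\<And>x x' v. v \<in> limiting_subdiff g x \<Longrightarrow> norm (x - xs) < e1 \<Longrightarrow> norm (x' - xs) < e1 \<Longrightarrow>
        norm (v - vb) < e1 \<Longrightarrow> g x < g xs + ereal e1 \<Longrightarrow>
        g x + ereal (v \<bullet> (x' - x) - r / 2 * (norm (x' - x))\<^sup>2) \<le> g x'"
    using prox_reg[OF vb] by blast
  obtain e2 where e2: "e2 > 0" "\<And>x x' v. v \<in> limiting_subdiff g x \<Longrightarrow> norm (x - xs) < e2 \<Longrightarrow> norm (x' - xs) < e2 \<Longrightarrow>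
        norm (v - u) < e2 \<Longrightarrow> g x < g xs + ereal e2 \<Longrightarrow>
        g x + ereal (v \<bullet> (x' - x) - r / 2 * (norm (x' - x))\<^sup>2) \<le> g x'"
    using prox_reg[OF u] by blast
  have fin: "\<bar>g xs\<bar> \<noteq> \<infinity>" using vb by (simp add: limiting_subdiff_def)
  have above: "g xs < g xs + ereal b" if "b > 0" for b using fin that by (cases "g xs") auto
  have gp: "(\<lambda>j. g (p j)) \<longlonglongrightarrow> g xs"
  proof -
    have "isCont h xs" using lm.h_deriv[of xs] lm.\<delta> has_derivative_continuous by fastforce
    then have "(\<lambda>j. h (p j)) \<longlonglongrightarrow> h xs" using plim by (rule isCont_tendsto_compose)
    then have "(\<lambda>j. ereal (h (p j))) \<longlonglongrightarrow> g xs" using lm.F_eq[OF xsM] lm.\<delta> by simp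
    moreover have "\<forall>\<^sub>F j in sequentially. ereal (h (p j)) = g (p j)"
      using near[OF lm.\<delta>] by eventually_elim (use lm.F_eq p in simp)
    ultimately show ?thesis by (rule Lim_transform_eventually)
  qed
  have nX: "\<forall>\<^sub>F j in sequentially. norm (X j - xs) < b" if "b > 0" for b
    using tendstoD[OF X that] by (simp add: dist_norm)
  have nV: "\<forall>\<^sub>F j in sequentially. norm (V j - vb) < b" if "b > 0" for b
    using tendstoD[OF V that] by (simp add: dist_norm vb_def)
  have nus: "\<forall>\<^sub>F j in sequentially. norm (us j - u) < b" if "b > 0" for b
    using tendstoD[OF us(2) that] by (simp add: dist_norm)
  \<comment> \<open>Prox-regularity is used around \<open>vb\<close> with base point
    \<open>X j\<close> and around \<open>u\<close> with base point \<open>p j\<close>. The values of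
    \<open>g\<close> cancel in the sum, and division by \<open>t j\<close> leaves a right-hand side
    tending to 0, while the left-hand side tends to \<open>e / 2\<close> along the
    subsequence.\<close>
  have "\<forall>\<^sub>F j in sequentially. (us j - V j) \<bullet> w j \<le> r * t j"
    using nX[OF e1(1)] near[OF e1(1)] nV[OF e1(1)] order_tendstoD(2)[OF gX above[OF e1(1)]]
      nX[OF e2(1)] near[OF e2(1)] nus[OF e2(1)] order_tendstoD(2)[OF gp above[OF e2(1)]] us(1)
  proof eventually_elim
    case (elim j)
    have 1: "g (X j) + ereal (V j \<bullet> (p j - X j) - r / 2 * (norm (p j - X j))\<^sup>2) \<le> g (p j)"
      using e1(2)[OF sub] elim by blast
    have 2: "g (p j) + ereal (us j \<bullet> (X j - p j) - r / 2 * (norm (X j - p j))\<^sup>2) \<le> g (X j)"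
      using e2(2) elim by blast
    have "\<bar>g (X j)\<bar> \<noteq> \<infinity>" "\<bar>g (p j)\<bar> \<noteq> \<infinity>"
      using sub[of j] elim(9) by (auto simp: limiting_subdiff_def)
    then obtain \<alpha> \<beta> where ab: "g (X j) = ereal \<alpha>" "g (p j) = ereal \<beta>" by (metis abs_ereal.simps(2,3) ereal_cases)
    have "us j \<bullet> (X j - p j) + V j \<bullet> (p j - X j) \<le> r * (t j)\<^sup>2"
      using 1 2 by (simp add: ab t_def norm_minus_commute)
    then have "(us j - V j) \<bullet> (X j - p j) \<le> r * (t j)\<^sup>2"
      by (simp add: inner_diff_left inner_diff_right)
    then have "(1 / t j) * ((us j - V j) \<bullet> (X j - p j)) \<le> (1 / t j) * (r * (t j)\<^sup>2)"
      using t[of j] by (intro mult_left_mono) auto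
    then show ?case using t[of j] by (simp add: w_def power2_eq_square)
  qed
  then have "\<forall>\<^sub>F j in sequentially. (us (\<sigma> j) - V (\<sigma> j)) \<bullet> w (\<sigma> j) \<le> r * t (\<sigma> j)"
    using \<sigma> by (rule eventually_subseq[rotated])
  moreover have "(\<lambda>j. (us (\<sigma> j) - V (\<sigma> j)) \<bullet> w (\<sigma> j)) \<longlonglongrightarrow> (u - vb) \<bullet> wl"
    unfolding vb_def by (intro tendsto_intros wlim' subseq us(2) V)
  moreover have "(\<lambda>j. r * t (\<sigma> j)) \<longlonglongrightarrow> r * 0" by (intro tendsto_intros subseq tlim)
  ultimately have "(u - vb) \<bullet> wl \<le> r * 0"
    using tendsto_le[OF trivial_limit_sequentially] by blast
  moreover have "(u - vb) \<bullet> wl = e / 2" using wl by (simp add: u_def power2_norm_eq_inner[symmetric])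
  ultimately show False using e by simp
qed

text \<open>By contradiction with sequences: the proximal bound sends offending points
  \<open>X n\<close> to \<open>xs\<close>, their Fermat subgradients converge to
  \<open>- nabla f xs\<close>, and \<open>prox_limit\<close> gives convergence of the values, so
  \<open>partly_smooth_identification\<close> applies.\<close>

lemma structured_critical_active:
  fixes xs :: "'a::euclidean_space"
  assumes st: "structured_critical_point r f g M xs" and f: "C2_on UNIV f"
    and g: "proper_fun g" "lower_semicont g"
    and lip: "L-lipschitz_on UNIV (nabla f)" and \<gamma>: "0 < \<gamma>" "r < 1 / \<gamma>"
  obtains \<epsilon> where "\<epsilon> > 0" "\<And>x y. norm (y - xs) < \<epsilon> \<Longrightarrow> x \<in> prox \<gamma> g (y - \<gamma> *\<^sub>R nabla f y) \<Longrightarrow> x \<in> M"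
proof (rule ccontr)
  assume no: "\<not> thesis"
  note intro = that
  have "\<exists>y x. norm (y - xs) < \<epsilon> \<and> x \<in> prox \<gamma> g (y - \<gamma> *\<^sub>R nabla f y) \<and> x \<notin> M" if "\<epsilon> > 0" for \<epsilon>
    using intro[OF that] no by blast
  then have "\<forall>n. \<exists>y x. norm (y - xs) < inverse (real (Suc n)) \<and> x \<in> prox \<gamma> g (y - \<gamma> *\<^sub>R nabla f y) \<and> x \<notin> M"
    by simp
  then obtain Y X where YX: "\<And>n. norm (Y n - xs) < inverse (real (Suc n))"
    "\<And>n. X n \<in> prox \<gamma> g (Y n - \<gamma> *\<^sub>R nabla f (Y n))" "\<And>n. X n \<notin> M" by metis
  have Y: "Y \<longlonglongrightarrow> xs"
    by (rule LIMSEQ_norm_0[of "\<lambda>n. Y n - xs", THEN LIM_zero_cancel]) (use YX(1) in \<open>simp add: inverse_eq_divide\<close>)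
  define C where "C = 2 * (L + 1 / \<gamma>) / (1 / \<gamma> - r)"
  have X: "X \<longlonglongrightarrow> xs"
  proof (rule LIM_zero_cancel, rule Lim_null_comparison)
    show "\<forall>\<^sub>F n in sequentially. norm (X n - xs) \<le> C * norm (Y n - xs)"
      unfolding C_def by (intro always_eventually allI structured_critical_prox_lipschitz[OF st g(1) lip \<gamma> YX(2)])
    have "(\<lambda>n. C * norm (Y n - xs)) \<longlonglongrightarrow> C * norm (xs - xs)" by (intro tendsto_intros Y)
    then show "(\<lambda>n. C * norm (Y n - xs)) \<longlonglongrightarrow> 0" by simp
  qed
  have "continuous_on UNIV (nabla f)" by (rule lipschitz_on_continuous_on[OF lip])
  then have G: "(\<lambda>n. nabla f (Y n)) \<longlonglongrightarrow> nabla f xs"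
    using Y by (simp add: continuous_on_eq_continuous_at isCont_tendsto_compose)
  have fin: "g xs \<noteq> \<infinity>" using structured_critical_prox_bound(1)[OF st g(1)] by auto
  have "(\<lambda>n. (1 / \<gamma>) *\<^sub>R (Y n - X n) - nabla f (Y n)) \<longlonglongrightarrow> (1 / \<gamma>) *\<^sub>R (xs - xs) - nabla f xs"
    by (intro tendsto_intros Y X G)
  then have "(\<lambda>n. (1 / \<gamma>) *\<^sub>R (Y n - X n) - nabla f (Y n)) \<longlonglongrightarrow> - nabla f xs" by simp
  moreover have "(1 / \<gamma>) *\<^sub>R (Y n - X n) - nabla f (Y n) \<in> limiting_subdiff g (X n)" for n
    by (rule regular_subdiff_subset_limiting[OF prox_regular_subdiff[OF g(1) \<gamma>(1) YX(2)]])
  ultimately show False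
    using partly_smooth_identification[OF st X _ _ prox_limit(1)[OF g \<gamma>(1) YX(2) X Y G fin] YX(3)] by blast
qed

lemma C2_restricted_near_objective:
  fixes f :: "'a::euclidean_space \<Rightarrow> real"
  shows "C2_restricted_near M g xs \<Longrightarrow> C2_on UNIV f \<Longrightarrow> C2_restricted_near M (objective f g) xs"
proof -
  assume "C2_restricted_near M g xs" and f: "C2_on UNIV f"
  then obtain U h where U: "open U" "xs \<in> U" "C2_on U h" "\<And>z. z \<in> M \<inter> U \<Longrightarrow> g z = ereal (h z)"
    unfolding C2_restricted_near_def by blast
  obtain f' where f': "\<And>x. (f has_derivative blinfun_apply (f' x)) (at x)" "C1_on UNIV f'"
    using f unfolding C2_on_def by (metis (no_types) UNIV_I)
  obtain h' where h': "\<And>x. x \<in> U \<Longrightarrow> (h has_derivative blinfun_apply (h' x)) (at x)" "C1_on U h'"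
    using U(3) unfolding C2_on_def by (metis (no_types))
  have "C2_on U (\<lambda>x. f x + h x)"
    unfolding C2_on_def
  proof (intro exI conjI ballI)
    show "((\<lambda>x. f x + h x) has_derivative blinfun_apply (f' x + h' x)) (at x)" if "x \<in> U" for x
      using has_derivative_add[OF f'(1) h'(1)[OF that]] by (simp add: plus_blinfun.rep_eq)
    show "C1_on U (\<lambda>x. f' x + h' x)"
      by (rule C1_on_add[OF C1_on_subset[OF f'(2)] h'(2)]) simp
  qed
  then show "C2_restricted_near M (objective f g) xs"
    unfolding C2_restricted_near_def objective_def
    using U by (intro exI[of _ U] exI[of _ "\<lambda>x. f x + h x"]) auto
qed

text \<open>By the quadratic minorant, \<open>xs\<close> minimises \<open>k\<close> on
  \<open>M\<close> near \<open>xs\<close>. The derivatives of \<open>k\<close> and \<open>h\<close>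
  agree at \<open>xs\<close>: the two terms with \<open>nabla f xs\<close> cancel and the square is
  flat there.\<close>

lemma (in local_model) structured_critical_gradient_zero:
  assumes st: "structured_critical_point r f g M xs" and f: "C2_on UNIV f" and g: "proper_fun g"
    and F: "F = objective f g"
  shows "G xs = 0"
proof -
  have x0: "norm (xs - xs) < \<delta>" using \<delta> by simp
  have gh: "g z = ereal (h z - f z)" if "z \<in> M" "norm (z - xs) < \<delta>" for z
    using F_eq[OF that] unfolding F objective_def by (cases "g z") auto
  define k where "k z = h z - f z + nabla f xs \<bullet> (z - xs) + r / 2 * ((z - xs) \<bullet> (z - xs))" for z
  have "(k has_derivative (\<lambda>v. h' xs v - nabla f xs \<bullet> v + nabla f xs \<bullet> v + r / 2 * ((xs - xs) \<bullet> v + v \<bullet> (xs - xs)))) (at xs)"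
    unfolding k_def[abs_def]
    by (rule derivative_eq_intros h_deriv[OF x0] has_derivative_nabla[OF f] refl)+ simp
  then have der: "(k has_derivative h' xs) (at xs)" by simp
  have min: "k xs \<le> k z" if "z \<in> M \<inter> ball xs \<delta>" for z
  proof -
    have z: "z \<in> M" "norm (z - xs) < \<delta>" using that by (auto simp: dist_norm norm_minus_commute)
    show ?thesis
      using structured_critical_prox_bound(2)[OF st g, of z] gh[OF z] gh[OF xs x0]
      by (simp add: k_def power2_norm_eq_inner)
  qed
  have "h' xs (G xs) = 0"
    by (rule tangential_derivative_zero_at_min[OF G_in[OF xs x0] open_ball _ min der]) (use \<delta> in auto)
  then show ?thesis using h'_eq[OF xs x0 G_in[OF xs x0]] by simp
qed

section \<open>Global decrease, limit points and the local superlinear rate\<close>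

section \<open>Convergence of the iterates\<close>

lemma stepsize_gap:
  fixes L \<gamma> :: real
  assumes "0 \<le> L" "0 < \<gamma>" "\<gamma> < 1 / L"
  shows "0 < 1 / (2 * \<gamma>) - L / 2"
proof -
  \<comment> \<open>For \<open>L = 0\<close> the quotient \<open>1 / L\<close> is 0, which
    \<open>0 < \<gamma>\<close> and \<open>\<gamma> < 1 / L\<close> exclude.\<close>
  have "L > 0" using assms by (cases "L = 0") auto
  then show ?thesis using assms by (simp add: field_simps)
qed

lemma iterates_sufficient_decrease:
  fixes f :: "'a::euclidean_space \<Rightarrow> real"
  assumes std: "standing_assumptions L f g" and \<gamma>: "0 < \<gamma>" "\<gamma> < 1 / L" and m: "0 < m" and \<tau>: "0 < \<tau>"
    and it: "prox_newton_iterates f g \<gamma> m \<tau> R \<eta> Mk x y d \<alpha>" and k: "1 \<le> k"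
  shows "\<bar>g (x k)\<bar> \<noteq> \<infinity>"
    and "real_of_ereal (objective f g (x (Suc k))) + (1 / (2 * \<gamma>) - L / 2) * (norm (x (Suc k) - y k))\<^sup>2
      \<le> real_of_ereal (objective f g (x k))"
proof -
  have f: "C2_on UNIV f" and lip: "L-lipschitz_on UNIV (nabla f)" and g: "proper_fun g"
    using std by (auto simp: standing_assumptions_def)
  have px: "x j \<in> prox \<gamma> g (y (j - 1) - \<gamma> *\<^sub>R nabla f (y (j - 1)))" if "1 \<le> j" for j
    using it that by (simp add: prox_newton_iterates_def)
  have fin: "\<bar>g (x j)\<bar> \<noteq> \<infinity>" if "1 \<le> j" for j by (rule prox_finite[OF g px[OF that]])
  show "\<bar>g (x k)\<bar> \<noteq> \<infinity>" by (rule fin[OF k])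
  let ?G = "riem_grad (Mk k) (objective f g) (x k)"
  have tn: "truncated_newton_update (objective f g) m \<tau> (Mk k) (R (Mk k)) (\<eta> k) (x k) (d k) (\<alpha> k) (y k)"
    using it k by (simp add: prox_newton_iterates_def)
  then have arm: "objective f g (y k) \<le> objective f g (x k) + ereal (m * \<alpha> k * (?G \<bullet> d k))"
    and \<alpha>: "\<alpha> k > 0" and Gd: "?G \<bullet> d k \<le> 0"
    using \<tau> by (auto simp: truncated_newton_update_def backtracking_step_def armijo_def split: if_splits)
  have neg: "m * \<alpha> k * (?G \<bullet> d k) \<le> 0" using m \<alpha> Gd by (simp add: mult_nonneg_nonpos)
  obtain a where a: "g (x k) = ereal a" using fin[OF k] by (cases "g (x k)") auto
  have "objective f g (x k) + ereal (m * \<alpha> k * (?G \<bullet> d k)) \<le> ereal (f (x k) + a)"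
    using neg by (simp add: objective_def a)
  then have Fy: "objective f g (y k) \<le> ereal (f (x k) + a)" using arm by (rule order_trans[rotated])
  have "g (y k) \<noteq> - \<infinity>" using g by (simp add: proper_fun_def)
  \<comment> \<open>Only the Armijo inequality makes \<open>g (y k)\<close> finite; this admits
    \<open>y k\<close> as competitor in its own proximal step.\<close>
  then obtain b where b: "g (y k) = ereal b" using Fy by (cases "g (y k)") (auto simp: objective_def)
  obtain c where c: "g (x (Suc k)) = ereal c" using fin[of "Suc k"] by (cases "g (x (Suc k))") auto
  have "c + nabla f (y k) \<bullet> (x (Suc k) - y k) + 1 / (2 * \<gamma>) * (norm (x (Suc k) - y k))\<^sup>2 \<le> b"
    using prox_step[OF g \<gamma>(1) px[of "Suc k"], of "y k"] b c by simp
  moreover have "f (x (Suc k)) \<le> f (y k) + nabla f (y k) \<bullet> (x (Suc k) - y k) + L / 2 * (norm (x (Suc k) - y k))\<^sup>2"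
    by (rule descent_lemma[OF f lip])
  moreover have "f (y k) + b \<le> f (x k) + a" using Fy by (simp add: objective_def b)
  ultimately show "real_of_ereal (objective f g (x (Suc k))) + (1 / (2 * \<gamma>) - L / 2) * (norm (x (Suc k) - y k))\<^sup>2
      \<le> real_of_ereal (objective f g (x k))"
    by (simp add: objective_def a c algebra_simps)
qed

lemma iterates_limits:
  fixes f :: "'a::euclidean_space \<Rightarrow> real"
  assumes std: "standing_assumptions L f g" and \<gamma>: "0 < \<gamma>" "\<gamma> < 1 / L" and m: "0 < m" and \<tau>: "0 < \<tau>"
    and it: "prox_newton_iterates f g \<gamma> m \<tau> R \<eta> Mk x y d \<alpha>"
  obtains l where "(\<lambda>k. objective f g (x k)) \<longlonglongrightarrow> ereal l" "(\<lambda>k. x (Suc k) - y k) \<longlonglongrightarrow> 0"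
proof -
  note dec = iterates_sufficient_decrease[OF std \<gamma> m \<tau> it]
  obtain B :: real where B: "\<And>z. ereal B \<le> objective f g z" using std by (auto simp: standing_assumptions_def)
  have "0 \<le> L" using std lipschitz_on_nonneg by (auto simp: standing_assumptions_def)
  then have \<kappa>: "0 < 1 / (2 * \<gamma>) - L / 2" using stepsize_gap \<gamma> by blast
  define \<kappa> where "\<kappa> = 1 / (2 * \<gamma>) - L / 2"
  \<comment> \<open>Shifted by one because \<open>x 0\<close> is arbitrary and may have an infinite
    value.\<close>
  define X where "X k = real_of_ereal (objective f g (x (Suc k)))" for k
  have step: "X (Suc k) + \<kappa> * (norm (x (Suc (Suc k)) - y (Suc k)))\<^sup>2 \<le> X k" for k
    using dec(2)[of "Suc k"] by (simp add: X_def \<kappa>_def)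
  have F: "objective f g (x (Suc k)) = ereal (X k)" for k
  proof -
    obtain a where "g (x (Suc k)) = ereal a" using dec(1)[of "Suc k"] by (cases "g (x (Suc k))") auto
    then show ?thesis by (simp add: X_def objective_def)
  qed
  have "0 \<le> \<kappa> * (norm (x (Suc (Suc k)) - y (Suc k)))\<^sup>2" for k using \<kappa> by (simp add: \<kappa>_def)
  then have "X (Suc k) \<le> X k" for k using step[of k] by (meson add_increasing2 order_refl order_trans le_add_same_cancel1)
  then have "decseq X" by (simp add: decseq_Suc_iff)
  moreover have "\<forall>k. B \<le> X k" using B[of "x (Suc _)"] unfolding F by simp
  ultimately obtain l where l: "X \<longlonglongrightarrow> l" by (rule decseq_convergent)
  have "(\<lambda>k. ereal (X k)) \<longlonglongrightarrow> ereal l" using l by simp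
  then have 1: "(\<lambda>k. objective f g (x k)) \<longlonglongrightarrow> ereal l"
    unfolding F[symmetric] by (rule LIMSEQ_imp_Suc)
  have D: "(\<lambda>k. (1 / \<kappa>) * (X k - X (Suc k))) \<longlonglongrightarrow> (1 / \<kappa>) * (l - l)"
    by (intro tendsto_intros l LIMSEQ_Suc[OF l])
  have "(\<lambda>k. (norm (x (Suc (Suc k)) - y (Suc k)))\<^sup>2) \<longlonglongrightarrow> 0"
  proof (rule tendsto_sandwich[OF _ _ tendsto_const])
    show "(\<lambda>k. (1 / \<kappa>) * (X k - X (Suc k))) \<longlonglongrightarrow> 0" using D by simp
    have "(norm (x (Suc (Suc k)) - y (Suc k)))\<^sup>2 \<le> (1 / \<kappa>) * (X k - X (Suc k))" for k
    proof -
      have "(norm (x (Suc (Suc k)) - y (Suc k)))\<^sup>2 * \<kappa> \<le> X k - X (Suc k)"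
        using step[of k] by (simp add: mult.commute)
      then have "(norm (x (Suc (Suc k)) - y (Suc k)))\<^sup>2 \<le> (X k - X (Suc k)) / \<kappa>"
        using \<kappa> by (simp only: \<kappa>_def pos_le_divide_eq)
      then show ?thesis by simp
    qed
    then show "\<forall>\<^sub>F k in sequentially. (norm (x (Suc (Suc k)) - y (Suc k)))\<^sup>2 \<le> (1 / \<kappa>) * (X k - X (Suc k))"
      by simp
  qed simp
  from tendsto_real_sqrt[OF this] have "(\<lambda>k. norm (x (Suc (Suc k)) - y (Suc k))) \<longlonglongrightarrow> 0" by simp
  then have "(\<lambda>k. x (Suc (Suc k)) - y (Suc k)) \<longlonglongrightarrow> 0" by (simp add: tendsto_norm_zero_iff)
  then have 2: "(\<lambda>k. x (Suc k) - y k) \<longlonglongrightarrow> 0" by (rule LIMSEQ_imp_Suc)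
  show ?thesis using that[OF 1 2] .
qed

lemma limit_point_critical:
  fixes f :: "'a::euclidean_space \<Rightarrow> real"
  assumes std: "standing_assumptions L f g" and \<gamma>: "0 < \<gamma>"
    and it: "prox_newton_iterates f g \<gamma> m \<tau> R \<eta> Mk x y d \<alpha>"
    and F: "(\<lambda>k. objective f g (x k)) \<longlonglongrightarrow> ereal l" and gap: "(\<lambda>k. x (Suc k) - y k) \<longlonglongrightarrow> 0"
    and z: "limit_point_of_seq x z"
  shows "critical_point f g z" and "objective f g z = ereal l"
proof -
  have f: "C2_on UNIV f" and lip: "L-lipschitz_on UNIV (nabla f)" and g: "proper_fun g" "lower_semicont g"
    using std by (auto simp: standing_assumptions_def)
  obtain s where s: "strict_mono s" "(x \<circ> s) \<longlonglongrightarrow> z" using z by (auto simp: limit_point_of_seq_def)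
  \<comment> \<open>The proximal step links \<open>x (Suc k)\<close> to \<open>y k\<close>, so the
    subsequence is written with a successor; starting from \<open>s (Suc 0)\<close> makes the
    subtraction genuine.\<close>
  define \<sigma> where "\<sigma> j = s (Suc j) - 1" for j
  have s1: "s (Suc j) \<ge> 1" for j using seq_suble[OF s(1), of "Suc j"] by simp
  have \<sigma>s: "Suc (\<sigma> j) = s (Suc j)" for j using s1[of j] by (simp add: \<sigma>_def)
  have \<sigma>: "strict_mono \<sigma>"
  proof (rule strict_monoI)
    fix i j :: nat assume "i < j"
    then have "Suc (\<sigma> i) < Suc (\<sigma> j)" unfolding \<sigma>s using s(1) by (simp add: strict_mono_less)
    then show "\<sigma> i < \<sigma> j" by simp
  qed
  define X Y where "X j = x (Suc (\<sigma> j))" and "Y j = y (\<sigma> j)" for j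
  have X: "X \<longlonglongrightarrow> z" using LIMSEQ_Suc[OF s(2)] by (simp add: X_def[abs_def] \<sigma>s)
  have "(\<lambda>j. X j - Y j) \<longlonglongrightarrow> 0"
    using LIMSEQ_subseq_LIMSEQ[OF gap \<sigma>] by (simp add: X_def Y_def comp_def)
  from tendsto_diff[OF X this] have Y: "Y \<longlonglongrightarrow> z" by simp
  have "continuous_on UNIV (nabla f)" by (rule lipschitz_on_continuous_on[OF lip])
  then have G: "(\<lambda>j. nabla f (Y j)) \<longlonglongrightarrow> nabla f z"
    using Y by (simp add: continuous_on_eq_continuous_at isCont_tendsto_compose)
  have px: "X j \<in> prox \<gamma> g (Y j - \<gamma> *\<^sub>R nabla f (Y j))" for j
    using it unfolding prox_newton_iterates_def X_def Y_def by (metis diff_Suc_1 le_add1 plus_1_eq_Suc)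
  have FX: "(\<lambda>j. objective f g (X j)) \<longlonglongrightarrow> ereal l"
    using LIMSEQ_subseq_LIMSEQ[OF LIMSEQ_Suc[OF F] \<sigma>] by (simp add: X_def comp_def)
  have fc: "isCont f z" using has_derivative_nabla[OF f] has_derivative_continuous by blast
  have fX: "(\<lambda>j. f (X j)) \<longlonglongrightarrow> f z" using fc X by (rule isCont_tendsto_compose)
  \<comment> \<open>At an infinite value, semicontinuity would push \<open>g (X j)\<close> beyond
    what \<open>objective f g (X j) < l + 1\<close> and \<open>f (X j) > f z - 1\<close>
    permit.\<close>
  have fin: "g z \<noteq> \<infinity>"
  proof
    assume inf: "g z = \<infinity>"
    have "\<forall>\<^sub>F j in sequentially. ereal (l + 1 - (f z - 1)) < g (X j)"
      by (rule lower_semicont_sequentially[OF g(2) X]) (simp add: inf)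
    moreover have "\<forall>\<^sub>F j in sequentially. f z - 1 < f (X j)" by (rule order_tendstoD(1)[OF fX]) simp
    moreover have "\<forall>\<^sub>F j in sequentially. objective f g (X j) < ereal (l + 1)" by (rule order_tendstoD(2)[OF FX]) simp
    ultimately have "\<forall>\<^sub>F j in sequentially. False"
    proof eventually_elim
      case (elim j)
      then show ?case by (cases "g (X j)") (auto simp: objective_def)
    qed
    then show False by simp
  qed
  have gX: "(\<lambda>j. g (X j)) \<longlonglongrightarrow> g z" and sd: "- nabla f z \<in> limiting_subdiff g z"
    using prox_limit[OF g \<gamma> px X Y G fin] by blast+
  show "critical_point f g z"
    unfolding critical_point_def subdiff_sum_def using sd by (intro image_eqI[of _ _ "- nabla f z"]) simp_all
  have "(\<lambda>j. objective f g (X j)) \<longlonglongrightarrow> objective f g z"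
    unfolding objective_def by (intro tendsto_add_ereal_general2 gX) (use fX in auto)
  then show "objective f g z = ereal l" using FX LIMSEQ_unique by blast
qed

text \<open>Puts \<open>s = norm (x - xs) powr \<theta>\<close> into \<open>newton_step\<close>. The
  constant \<open>C * A\<^sup>2\<close> combines the forcing bound, at most
  \<open>C * A * s\<close>, with \<open>norm (G x) \<le> A * norm (x - xs)\<close>.\<close>

lemma (in newton_model) truncated_newton_step:
  assumes R: "second_order_retraction M R" and \<theta>: "0 < \<theta>" "\<theta> \<le> 1" and C: "0 < C" and m: "0 < m" "m < 1 / 2"
  obtains \<epsilon> C6 where "0 < \<epsilon>" "\<epsilon> \<le> \<delta>" "0 < C6"
    "\<And>x d \<eta> \<alpha> y. x \<in> M \<Longrightarrow> norm (x - xs) < \<epsilon> \<Longrightarrow> \<eta> \<le> C * norm (riem_grad M F x) powr \<theta> \<Longrightarrow>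
       truncated_newton_update F m \<tau> M R \<eta> x d \<alpha> y \<Longrightarrow>
       norm (y - xs) \<le> C6 * norm (x - xs) powr (1 + \<theta>)"
proof -
  obtain s0 C6 where s0: "0 < s0" "0 < C6" and step: "\<And>x d s \<eta>. x \<in> M \<Longrightarrow> norm (x - xs) \<le> s \<Longrightarrow> s \<le> s0 \<Longrightarrow>
       d \<in> tangent_space M x \<Longrightarrow> \<eta> * norm (G x) \<le> (C * A\<^sup>2) * s * norm (x - xs) \<Longrightarrow>
       norm (G x + riem_hess M F x d) \<le> \<eta> * norm (G x) \<Longrightarrow>
       norm (x - xs) < \<delta> \<and> norm (R x d - xs) \<le> C6 * s * norm (x - xs) \<and> F (R x d) \<le> F x + ereal (m * (G x \<bullet> d))"
  proof (rule newton_step[OF R _ m, of "C * A\<^sup>2"], goal_cases)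
    case (2 s0 C6)
    from 2(2-) show ?case by (rule that)
  qed (use C in simp)
  \<comment> \<open>The entry 1 gives \<open>n \<le> n powr \<theta>\<close>, as \<theta> \<le> 1;
    the last one gives \<open>n powr \<theta> \<le> s0\<close>.\<close>
  define \<epsilon> where "\<epsilon> = min (min \<delta> 1) (s0 powr (1 / \<theta>))"
  have main: "norm (y - xs) \<le> C6 * norm (x - xs) powr (1 + \<theta>)"
    if x: "x \<in> M" "norm (x - xs) < \<epsilon>" and \<eta>: "\<eta> \<le> C * norm (riem_grad M F x) powr \<theta>"
      and tn: "truncated_newton_update F m \<tau> M R \<eta> x d \<alpha> y" for x d \<eta> \<alpha> y
  proof -
    define n where "n = norm (x - xs)"
    define s where "s = n powr \<theta>"
    have n: "0 \<le> n" "n < \<delta>" "n \<le> 1" "n < s0 powr (1 / \<theta>)" using x(2) by (auto simp: n_def \<epsilon>_def)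
    have ns: "n \<le> s"
    proof (cases "n = 0")
      case False
      then have "n powr 1 \<le> n powr \<theta>" using n \<theta> by (intro powr_mono') auto
      then show ?thesis using n by (simp add: s_def)
    qed (simp add: s_def)
    have "s \<le> (s0 powr (1 / \<theta>)) powr \<theta>" unfolding s_def using n \<theta> by (intro powr_mono2) auto
    then have ss0: "s \<le> s0" using \<theta> s0 by (simp add: powr_powr)
    have grad: "riem_grad M F x = G x" using grad_eq x(1) n by (simp add: n_def)
    have Gn: "norm (G x) \<le> A * n" using norm_G[of x] n by (simp add: n_def)
    have "norm (G x) powr \<theta> \<le> (A * n) powr \<theta>" using Gn \<theta> by (intro powr_mono2) auto
    also have "\<dots> = A powr \<theta> * s" using A n by (simp add: powr_mult s_def)
    also have "\<dots> \<le> A * s"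
    proof (rule mult_right_mono)
      have "A powr \<theta> \<le> A powr 1" using A \<theta> by (intro powr_mono) auto
      then show "A powr \<theta> \<le> A" using A by simp
    qed (simp add: s_def)
    finally have "C * norm (G x) powr \<theta> \<le> C * (A * s)" using C by (intro mult_left_mono) auto
    then have "\<eta> \<le> C * (A * s)" using \<eta> grad by simp
    then have "\<eta> * norm (G x) \<le> (C * (A * s)) * (A * n)"
      using Gn C A n by (intro mult_mono) (auto simp: s_def)
    then have f: "\<eta> * norm (G x) \<le> (C * A\<^sup>2) * s * norm (x - xs)"
      by (simp add: power2_eq_square n_def mult.assoc mult.left_commute)
    have d: "d \<in> tangent_space M x" and res: "norm (G x + riem_hess M F x d) \<le> \<eta> * norm (G x)"
      and bt: "backtracking_step F m \<tau> R x (G x) d \<alpha>" and y: "y = R x (\<alpha> *\<^sub>R d)"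
      using tn by (auto simp: truncated_newton_update_def grad)
    have st: "norm (R x d - xs) \<le> C6 * s * norm (x - xs)" "F (R x d) \<le> F x + ereal (m * (G x \<bullet> d))"
      using step[OF x(1) _ ss0 d f res] ns by (auto simp: n_def)
    have "armijo F m R x (G x) d (\<tau> ^ 0)" using st(2) by (simp add: armijo_def)
    \<comment> \<open>Backtracking returns the first accepted power of \<tau>, and the power 0 is
      accepted.\<close>
    then have "\<alpha> = 1" using bt unfolding backtracking_step_def by (metis gr0I power_0)
    then have "norm (y - xs) \<le> C6 * (s * n)" using st(1) y by (simp add: n_def mult.assoc)
    also have "s * n = n powr (1 + \<theta>)" using n by (cases "n = 0") (auto simp: s_def powr_add)
    finally show ?thesis by (simp add: n_def)
  qed
  show ?thesis by (rule that[of \<epsilon> C6, OF _ _ s0(2) main]) (use \<delta> s0 in \<open>auto simp: \<epsilon>_def\<close>)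
qed

text \<open>The contraction holds only within radius \<epsilon>, so remaining inside and decaying go
  through one induction.\<close>

lemma geometric_decay:
  fixes a :: "nat \<Rightarrow> real"
  assumes "\<And>k. k \<ge> N \<Longrightarrow> a k < \<epsilon> \<Longrightarrow> a (Suc k) \<le> a k / 2" and "\<And>k. 0 \<le> a k" and "a N < \<epsilon>"
  shows "\<And>k. k \<ge> N \<Longrightarrow> a k < \<epsilon>" and "a \<longlonglongrightarrow> 0"
proof -
  have main: "a (N + j) \<le> a N * (1 / 2) ^ j \<and> a (N + j) < \<epsilon>" for j
  proof (induction j)
    case (Suc j)
    then have "a (Suc (N + j)) \<le> a (N + j) / 2" using assms(1) by simp
    then show ?case using Suc assms(2)[of "N + j"] by auto
  qed (use assms in simp)
  then show "a k < \<epsilon>" if "k \<ge> N" for k using that by (metis le_add_diff_inverse)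
  have "(\<lambda>j. a N * (1 / 2) ^ j) \<longlonglongrightarrow> a N * 0" by (intro tendsto_intros LIMSEQ_realpow_zero) auto
  then have lim: "(\<lambda>j. a N * (1 / 2) ^ j) \<longlonglongrightarrow> 0" by simp
  have "(\<lambda>j. a (N + j)) \<longlonglongrightarrow> 0"
    by (rule tendsto_sandwich[OF _ _ tendsto_const lim]) (simp_all add: main assms(2))
  then show "a \<longlonglongrightarrow> 0" using LIMSEQ_offset[of a N] by (simp add: add.commute)
qed

lemma superlinear_convergence:
  fixes f :: "'a::euclidean_space \<Rightarrow> real"
  assumes std: "standing_assumptions L f g" and \<gamma>: "0 < \<gamma>" and m: "0 < m" "m < 1 / 2"
    and it: "prox_newton_iterates f g \<gamma> m \<tau> R \<eta> Mk x y d \<alpha>"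
    and lp: "limit_point_of_seq y xs" and st: "structured_critical_point r f g M xs" and r: "r < 1 / \<gamma>"
    and ident: "identifies_near Mk x M xs"
    and pos: "riem_hess_pos_def M (objective f g) xs" and hl: "riem_hess_loc_lipschitz M (objective f g) xs"
    and \<theta>: "0 < \<theta>" "\<theta> \<le> 1"
    and \<eta>: "\<eta> \<in> O(\<lambda>k. norm (riem_grad (Mk k) (objective f g) (x k)) powr \<theta>)"
  shows "\<forall>\<^sub>F k in sequentially. x k \<in> M" and "x \<longlonglongrightarrow> xs"
    and "\<exists>c>0. \<forall>\<^sub>F k in sequentially. riem_dist M (x (k + 1)) xs
            \<le> ereal (c * real_of_ereal (riem_dist M (x k) xs) powr (1 + \<theta>))"
proof -
  have f: "C2_on UNIV f" and lip: "L-lipschitz_on UNIV (nabla f)" and g: "proper_fun g" "lower_semicont g"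
    using std by (auto simp: standing_assumptions_def)
  have sm: "submanifold_around M xs" and C2: "C2_restricted_near M g xs"
    using st by (auto simp: structured_critical_point_def partly_smooth_def)
  obtain P h h' G G' A0 \<delta>0 where "local_model M (objective f g) xs P h h' G G' A0 \<delta>0"
    using local_model_exists[OF sm C2_restricted_near_objective[OF C2 f]] by blast
  then interpret lm: local_model M "objective f g" xs P h h' G G' A0 \<delta>0 .
  have crit: "G xs = 0" by (rule lm.structured_critical_gradient_zero[OF st f g(1) refl])
  obtain A \<delta> \<mu> where "newton_model M (objective f g) xs P h h' G G' A \<delta> \<mu>"
    using lm.newton_model_exists[OF crit pos hl] by blast
  then interpret nm: newton_model M "objective f g" xs P h h' G G' A \<delta> \<mu> .

  have itk: "x k \<in> prox \<gamma> g (y (k - 1) - \<gamma> *\<^sub>R nabla f (y (k - 1)))"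
      "second_order_retraction (Mk k) (R (Mk k))"
      "truncated_newton_update (objective f g) m \<tau> (Mk k) (R (Mk k)) (\<eta> k) (x k) (d k) (\<alpha> k) (y k)"
    if "1 \<le> k" for k
    using it that by (auto simp: prox_newton_iterates_def)
  obtain \<epsilon>1 where \<epsilon>1: "\<epsilon>1 > 0" "\<And>x y. norm (y - xs) < \<epsilon>1 \<Longrightarrow> x \<in> prox \<gamma> g (y - \<gamma> *\<^sub>R nabla f y) \<Longrightarrow> x \<in> M"
    using structured_critical_active[OF st f g lip \<gamma> r] by blast
  obtain \<epsilon>2 where \<epsilon>2: "\<epsilon>2 > 0" "\<And>k. 1 \<le> k \<Longrightarrow> x k \<in> M \<Longrightarrow> dist (x k) xs < \<epsilon>2 \<Longrightarrow> Mk k = M"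
    using ident unfolding identifies_near_def by blast
  define K where "K = 2 * (L + 1 / \<gamma>) / (1 / \<gamma> - r)"
  have K: "K > 0"
    using lipschitz_on_nonneg[OF lip] \<gamma> r by (simp add: K_def add_nonneg_pos)
  have xy: "norm (x (Suc k) - xs) \<le> K * norm (y k - xs)" for k
    using structured_critical_prox_lipschitz[OF st g(1) lip \<gamma> r itk(1)[of "Suc k"]] by (simp add: K_def)
  obtain c where c: "c > 0" "\<forall>\<^sub>F k in sequentially. norm (\<eta> k) \<le> c * norm (norm (riem_grad (Mk k) (objective f g) (x k)) powr \<theta>)"
    using \<eta> by (rule landau_o.bigE)
  then obtain N where N: "\<And>k. k \<ge> N \<Longrightarrow> \<bar>\<eta> k\<bar> \<le> c * norm (riem_grad (Mk k) (objective f g) (x k)) powr \<theta>"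
    by (auto simp: eventually_sequentially)
  obtain s where s: "strict_mono s" "(y \<circ> s) \<longlonglongrightarrow> xs" using lp by (auto simp: limit_point_of_seq_def)

  have "\<exists>\<epsilon>3 C6. 0 < \<epsilon>3 \<and> \<epsilon>3 \<le> \<delta> \<and> 0 < C6 \<and> (\<forall>k\<ge>max 1 N. x k \<in> M \<and> Mk k = M \<and> norm (x k - xs) < \<epsilon>3 \<longrightarrow>
     norm (y k - xs) \<le> C6 * norm (x k - xs) powr (1 + \<theta>))"
  \<comment> \<open>A retraction is guaranteed only on delivered manifolds. If \<open>R M\<close> is
    none, then \<open>M\<close> is never delivered and the claim is vacuous.\<close>
  proof (cases "second_order_retraction M (R M)")
    case True
    obtain \<epsilon>3 C6 where "0 < \<epsilon>3" "\<epsilon>3 \<le> \<delta>" "0 < C6"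
      "\<And>x d \<eta> \<alpha> y. x \<in> M \<Longrightarrow> norm (x - xs) < \<epsilon>3 \<Longrightarrow> \<eta> \<le> c * norm (riem_grad M (objective f g) x) powr \<theta> \<Longrightarrow>
       truncated_newton_update (objective f g) m \<tau> M (R M) \<eta> x d \<alpha> y \<Longrightarrow>
       norm (y - xs) \<le> C6 * norm (x - xs) powr (1 + \<theta>)"
    proof (rule nm.truncated_newton_step[OF True \<theta> c(1) m, where \<tau> = \<tau>], goal_cases)
      case (1 \<epsilon> C6)
      from 1(2-) show ?case by (rule that)
    qed
    note E = this
    have "norm (y k - xs) \<le> C6 * norm (x k - xs) powr (1 + \<theta>)"
      if k: "k \<ge> max 1 N" "x k \<in> M" "Mk k = M" "norm (x k - xs) < \<epsilon>3" for k
    proof (rule E(4)[OF k(2,4)])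
      show "\<eta> k \<le> c * norm (riem_grad M (objective f g) (x k)) powr \<theta>" using N[of k] k by auto
      show "truncated_newton_update (objective f g) m \<tau> M (R M) (\<eta> k) (x k) (d k) (\<alpha> k) (y k)"
        using itk(3)[of k] k by simp
    qed
    then show ?thesis using E(1-3) by blast
  next
    case False
    then have "Mk k \<noteq> M" if "k \<ge> 1" for k using itk(2)[OF that] by metis
    then show ?thesis using nm.\<delta> by (intro exI[of _ \<delta>] exI[of _ 1]) auto
  qed
  then obtain \<epsilon>3 C6 where \<epsilon>3: "0 < \<epsilon>3" "\<epsilon>3 \<le> \<delta>" "0 < C6" and newton: "\<And>k. k \<ge> max 1 N \<Longrightarrow> x k \<in> M \<Longrightarrow> Mk k = M \<Longrightarrow>
     norm (x k - xs) < \<epsilon>3 \<Longrightarrow> norm (y k - xs) \<le> C6 * norm (x k - xs) powr (1 + \<theta>)" by blast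

  \<comment> \<open>In order: delivery of \<open>M\<close>, the Newton estimate, the comparison of
    distances, and \<open>C6 * K * n powr \<theta> \<le> 1 / 2\<close>, which makes one Newton step
    after one proximal step a contraction.\<close>
  define \<epsilon>4 where "\<epsilon>4 = min (min \<epsilon>2 \<epsilon>3) (min (\<delta> / 2) ((1 / (2 * C6 * K)) powr (1 / \<theta>)))"
  have "(1 / (2 * C6 * K)) powr (1 / \<theta>) > 0" using \<epsilon>3(3) K by simp
  then have \<epsilon>4: "\<epsilon>4 > 0" using \<epsilon>2(1) \<epsilon>3(1) nm.\<delta> by (simp add: \<epsilon>4_def)
  define \<epsilon> where "\<epsilon> = min \<epsilon>1 (\<epsilon>4 / K)"
  have \<epsilon>: "\<epsilon> > 0" using \<epsilon>1(1) \<epsilon>4 K by (simp add: \<epsilon>_def)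
  have loc: "x (Suc k) \<in> M \<and> norm (x (Suc k) - xs) < \<epsilon>4" if "norm (y k - xs) < \<epsilon>" for k
  proof
    show "x (Suc k) \<in> M" using \<epsilon>1(2)[of "y k"] that itk(1)[of "Suc k"] by (simp add: \<epsilon>_def)
    have "norm (y k - xs) < \<epsilon>4 / K" using that by (simp add: \<epsilon>_def)
    then have "K * norm (y k - xs) < \<epsilon>4" using K by (simp add: field_simps)
    then show "norm (x (Suc k) - xs) < \<epsilon>4" using xy[of k] by linarith
  qed
  have rate: "norm (y (Suc k) - xs) \<le> C6 * norm (x (Suc k) - xs) powr (1 + \<theta>)"
    if "k \<ge> N" "norm (y k - xs) < \<epsilon>" for k
    using newton[of "Suc k"] \<epsilon>2(2)[of "Suc k"] loc[OF that(2)] that(1) by (simp add: \<epsilon>4_def dist_norm)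
  have contr: "norm (y (Suc k) - xs) \<le> norm (y k - xs) / 2" if k: "k \<ge> N" "norm (y k - xs) < \<epsilon>" for k
  proof -
    let ?n = "norm (x (Suc k) - xs)"
    have "?n powr \<theta> \<le> ((1 / (2 * C6 * K)) powr (1 / \<theta>)) powr \<theta>"
      using loc[OF k(2)] \<theta> by (intro powr_mono2) (auto simp: \<epsilon>4_def)
    then have *: "?n powr \<theta> \<le> 1 / (2 * C6 * K)" using \<theta> \<epsilon>3 K by (simp add: powr_powr)
    have "norm (y (Suc k) - xs) \<le> C6 * (?n * ?n powr \<theta>)"
      using rate[OF k] by (cases "?n = 0") (auto simp: powr_add)
    also have "\<dots> \<le> C6 * ((K * norm (y k - xs)) * (1 / (2 * C6 * K)))"
      using xy[of k] * \<epsilon>3 K by (intro mult_left_mono mult_mono) auto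
    also have "\<dots> = norm (y k - xs) / 2" using \<epsilon>3 K by (simp add: field_simps)
    finally show ?thesis .
  qed

  have "\<forall>\<^sub>F j in sequentially. norm (y (s j) - xs) < \<epsilon>"
    using tendstoD[OF s(2) \<epsilon>] by (simp add: dist_norm)
  \<comment> \<open>The limit point serves only to enter the ball once, at an index
    \<open>s j \<ge> N\<close> where the forcing bound already holds.\<close>
  then obtain j where j: "j \<ge> N" "norm (y (s j) - xs) < \<epsilon>"
    unfolding eventually_sequentially by (meson nle_le)
  have sj: "s j \<ge> N" using seq_suble[OF s(1), of j] j(1) by linarith
  have near: "norm (y k - xs) < \<epsilon>" if "k \<ge> s j" for k
    using geometric_decay(1)[of "s j" "\<lambda>k. norm (y k - xs)" \<epsilon>] contr j(2) sj that by simp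
  have ylim: "(\<lambda>k. norm (y k - xs)) \<longlonglongrightarrow> 0"
    using geometric_decay(2)[of "s j" "\<lambda>k. norm (y k - xs)" \<epsilon>] contr j(2) sj by simp
  have xM: "x k \<in> M \<and> norm (x k - xs) < \<epsilon>4" if "k \<ge> Suc (s j)" for k
    using loc[OF near[of "k - 1"]] that by (cases k) auto
  show "\<forall>\<^sub>F k in sequentially. x k \<in> M" using xM by (auto simp: eventually_sequentially)
  have "(\<lambda>k. K * norm (y k - xs)) \<longlonglongrightarrow> K * 0" by (intro tendsto_intros ylim)
  then have "(\<lambda>k. x (Suc k) - xs) \<longlonglongrightarrow> 0"
    using Lim_null_comparison[of "\<lambda>k. x (Suc k) - xs" "\<lambda>k. K * norm (y k - xs)" sequentially] xy by simp
  then have "(\<lambda>k. x (Suc k)) \<longlonglongrightarrow> xs" by (rule LIM_zero_cancel)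
  then show "x \<longlonglongrightarrow> xs" by (rule LIMSEQ_imp_Suc)
  \<comment> \<open>The factor 2 compares the distances, \<open>K\<close> is the proximal bound and
    \<open>C6\<close> the Newton estimate.\<close>
  have "riem_dist M (x (k + 1)) xs \<le> ereal (2 * K * C6 * real_of_ereal (riem_dist M (x k) xs) powr (1 + \<theta>))"
    if k: "k \<ge> Suc (s j)" for k
  proof -
    obtain i where i: "k = Suc i" "i \<ge> s j" using k by (cases k) auto
    have xk: "x k \<in> M" "norm (x k - xs) < \<delta> / 2" and xk': "x (Suc k) \<in> M" "norm (x (Suc k) - xs) < \<delta> / 2"
      using xM[of k] xM[of "Suc k"] k by (auto simp: \<epsilon>4_def)
    \<comment> \<open>The upper bound \<open>riem_dist_le\<close> makes the distance finite, so the
      conversion to \<open>real\<close> loses nothing.\<close>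
    have "norm (x k - xs) \<le> real_of_ereal (riem_dist M (x k) xs)"
      using norm_le_riem_dist[of "x k" xs M] nm.riem_dist_le[OF xk]
      by (cases "riem_dist M (x k) xs") auto
    then have "norm (x k - xs) powr (1 + \<theta>) \<le> real_of_ereal (riem_dist M (x k) xs) powr (1 + \<theta>)"
      using \<theta> by (intro powr_mono2) auto
    then have "C6 * norm (x k - xs) powr (1 + \<theta>) \<le> C6 * real_of_ereal (riem_dist M (x k) xs) powr (1 + \<theta>)"
      using \<epsilon>3 by (intro mult_left_mono) auto
    moreover have "norm (y k - xs) \<le> C6 * norm (x k - xs) powr (1 + \<theta>)"
      using rate[of i] near[of i] i sj by simp
    ultimately have "K * norm (y k - xs) \<le> K * (C6 * real_of_ereal (riem_dist M (x k) xs) powr (1 + \<theta>))"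
      using K by (intro mult_left_mono) auto
    then have "2 * norm (x (Suc k) - xs) \<le> 2 * K * C6 * real_of_ereal (riem_dist M (x k) xs) powr (1 + \<theta>)"
      using xy[of k] by simp
    then show ?thesis using nm.riem_dist_le[OF xk'] by (simp add: order_trans[OF _ ereal_less_eq(3)[THEN iffD2]])
  qed
  moreover have "2 * K * C6 > 0" using K \<epsilon>3 by simp
  ultimately show "\<exists>c>0. \<forall>\<^sub>F k in sequentially. riem_dist M (x (k + 1)) xs
            \<le> ereal (c * real_of_ereal (riem_dist M (x k) xs) powr (1 + \<theta>))"
    unfolding eventually_sequentially by blast
qed

theorem theorem4p2:
  fixes f :: "'a::euclidean_space \<Rightarrow> real" and g :: "'a \<Rightarrow> ereal"
    and L \<gamma> m\<^sub>1 \<tau> :: real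
    and R :: "'a set \<Rightarrow> 'a \<Rightarrow> 'a \<Rightarrow> 'a"
    and \<eta> \<alpha> :: "nat \<Rightarrow> real" and Mk :: "nat \<Rightarrow> 'a set" and x y d :: "nat \<Rightarrow> 'a"
  assumes "standing_assumptions L f g"
    and "0 < \<gamma>" and "\<gamma> < 1 / L"
    and "0 < m\<^sub>1" and "m\<^sub>1 < 1 / 2"
    and "0 < \<tau>" and "\<tau> < 1"
    and "prox_newton_iterates f g \<gamma> m\<^sub>1 \<tau> R \<eta> Mk x y d \<alpha>"
  shows "(\<forall>z. limit_point_of_seq x z \<longrightarrow> critical_point f g z) \<and>
    (\<forall>z z'. limit_point_of_seq x z \<and> limit_point_of_seq x z' \<longrightarrow>
       objective f g z = objective f g z') \<and>
    (\<forall>x\<^sub>s M r \<theta>.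
       limit_point_of_seq y x\<^sub>s \<and>
       submanifold M \<and> structured_critical_point r f g M x\<^sub>s \<and> r < 1 / \<gamma> \<and>
       identifies_near Mk x M x\<^sub>s \<and>
       riem_hess_pos_def M (objective f g) x\<^sub>s \<and>
       riem_hess_loc_lipschitz M (objective f g) x\<^sub>s \<and>
       0 < \<theta> \<and> \<theta> \<le> 1 \<and>
       \<eta> \<in> O(\<lambda>k. norm (riem_grad (Mk k) (objective f g) (x k)) powr \<theta>) \<longrightarrow>
       (\<forall>\<^sub>F k in sequentially. x k \<in> M) \<and>
       x \<longlonglongrightarrow> x\<^sub>s \<and>
       (\<exists>c>0. \<forall>\<^sub>F k in sequentially.
          riem_dist M (x (k + 1)) x\<^sub>s
            \<le> ereal (c * real_of_ereal (riem_dist M (x k) x\<^sub>s) powr (1 + \<theta>))))"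
proof (intro conjI)
  obtain l where l: "(\<lambda>k. objective f g (x k)) \<longlonglongrightarrow> ereal l" "(\<lambda>k. x (Suc k) - y k) \<longlonglongrightarrow> 0"
    using iterates_limits[OF assms(1-4,6,8)] by blast
  note crit = limit_point_critical[OF assms(1,2,8) l]
  show "\<forall>z. limit_point_of_seq x z \<longrightarrow> critical_point f g z" using crit(1) by blast
  show "\<forall>z z'. limit_point_of_seq x z \<and> limit_point_of_seq x z' \<longrightarrow> objective f g z = objective f g z'"
    using crit(2) by simp
qed (intro allI impI, elim conjE, intro conjI superlinear_convergence[OF assms(1,2,4,5,8)]; assumption)

end
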